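(* Let $n\ge d\ge 1$ and let $\mu\in\mathcal P(\mathbb R^n)$, $\nu\in\mathcal P(\mathbb R^d)$ be two probability measures with compact supports. Suppose that $\mu\ll\mathrm{Leb}_n$. Then there exists an optimal correspondence map $T:\mathbb R^n\to\mathbb R^d$ for the inner product Gromov--Wasserstein problem $$\min_{\pi\in\Pi(\mu,\nu)}\int\int\big|\langle x,x'\rangle-\langle y,y'\rangle\big|^2\,d\pi(x,y)\,d\pi(x',y'),$$ i.e. a measurable map $T$ with $T_\#\mu=\nu$ such that $(\mathrm{id},T)_\#\mu$ is a minimizer, which can be written as $$T=O_{\mathcal Y}^\top\circ T_0\circ p_{\mathbb R^d}\circ O_{\mathcal X},$$ where $O_{\mathcal X}\in O_n(\mathbb R)$, $O_{\mathcal Y}\in O_d(\mathbb R)$, $p_{\mathbb R^d}:\mathbb R^n\to\mathbb R^d$ is the projection on the first $d$ coordinates, and $$T_0:\mathbb R^d\to\mathbb R^d,\qquad (x_1,\dots,x_d)\mapsto\big(\nabla f\circ\Sigma(x_1,\dots,x_h),\ \nabla g_{x_1,\dots,x_h}(x_{h+1},\dots,x_d)\big),$$ where $h\le d$, $\Sigma\in\mathbb R^{h\times h}$ is diagonal with positive entries, and $f:\mathbb R^h\to\mathbb R$ and all the $g_{x_1,\dots,x_h}:\mathbb R^{d-h}\to\mathbb R$ are convex functions.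
   Context: $\Pi(\mu,\nu)$ is the set of probability measures on $\mathbb R^n\times\mathbb R^d$ with first marginal $\mu$ and second marginal $\nu$. $O_n(\mathbb R)$ is the group of real orthogonal $n\times n$ matrices; $T_\#\mu$ is the pushforward; $\mathrm{Leb}_n$ is Lebesgue measure. Gradients of convex functions are defined Lebesgue-almost everywhere, and the identities describing $T$ are understood $\mu$-almost everywhere (with $T$ measurable). When $h=0$ (resp. $h=d$) the first (resp. second) block of $T_0$ is absent. *)

theory Defs
  imports "HOL-Probability.Probability"
begin

section \<open>Measures, couplings and the Gromov--Wasserstein functional\<close>

definition msupport :: "'a::topological_space measure \<Rightarrow> 'a set" where
  "msupport M = {x. \<forall>U. open U \<and> x \<in> U \<longrightarrow> emeasure M U > 0}"

definition couplings :: "'a measure \<Rightarrow> 'b measure \<Rightarrow> ('a \<times> 'b) measure set" where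
  "couplings \<mu> \<nu> = {\<pi>. prob_space \<pi> \<and> sets \<pi> = sets (\<mu> \<Otimes>\<^sub>M \<nu>) \<and>
     distr \<pi> \<mu> fst = \<mu> \<and> distr \<pi> \<nu> snd = \<nu>}"

definition gw_cost :: "('a::real_inner \<times> 'b::real_inner) measure \<Rightarrow> ennreal" where
  "gw_cost \<pi> = (\<integral>\<^sup>+ (x, y). (\<integral>\<^sup>+ (x', y'). ennreal (\<bar>x \<bullet> x' - y \<bullet> y'\<bar>\<^sup>2) \<partial>\<pi>) \<partial>\<pi>)"

definition gw_minimizer ::
  "'a::real_inner measure \<Rightarrow> 'b::real_inner measure \<Rightarrow> ('a \<times> 'b) measure \<Rightarrow> bool" where
  "gw_minimizer \<mu> \<nu> \<pi> \<longleftrightarrow>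
     \<pi> \<in> couplings \<mu> \<nu> \<and> (\<forall>\<pi>'\<in>couplings \<mu> \<nu>. gw_cost \<pi> \<le> gw_cost \<pi>')"

definition optimal_map ::
  "'a::real_inner measure \<Rightarrow> 'b::real_inner measure \<Rightarrow> ('a \<Rightarrow> 'b) \<Rightarrow> bool" where
  "optimal_map \<mu> \<nu> T \<longleftrightarrow> T \<in> \<mu> \<rightarrow>\<^sub>M \<nu> \<and> distr \<mu> \<nu> T = \<nu> \<and>
     gw_minimizer \<mu> \<nu> (distr \<mu> (\<mu> \<Otimes>\<^sub>M \<nu>) (\<lambda>x. (x, T x)))"

section \<open>Coordinates\<close>

text \<open>
  The coordinates of a vector in \<open>real ^ 'n\<close> are numbered 1, 2, ..., CARD('n) in the order of
  the index type; \<open>coord_at k\<close> is the index with number \<open>k\<close>.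
\<close>

definition coord_no :: "'n::{finite,linorder} \<Rightarrow> nat" where
  "coord_no i = card {..i}"

definition coord_at :: "nat \<Rightarrow> 'n::{finite,linorder}" where
  "coord_at k = (THE i. coord_no i = k)"

lemma strict_mono_coord_no: "strict_mono coord_no"
  unfolding coord_no_def by (intro strict_monoI psubset_card_mono) auto

lemma bij_betw_coord_no: "bij_betw coord_no (UNIV :: 'n::{finite,linorder} set) {1..CARD('n)}"
proof -
  have inj: "inj (coord_no :: 'n \<Rightarrow> nat)"
    using strict_mono_coord_no by (rule strict_mono_imp_inj_on)
  have "coord_no i \<in> {1..CARD('n)}" for i :: 'n
    unfolding coord_no_def by (auto simp: Suc_le_eq card_gt_0_iff intro: card_mono)
  then have "range (coord_no :: 'n \<Rightarrow> nat) = {1..CARD('n)}"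
    by (intro card_subset_eq) (auto simp: card_image[OF inj])
  with inj show ?thesis by (simp add: bij_betw_def)
qed

lemma coord_at_coord_no [simp]: "coord_at (coord_no i) = i"
  unfolding coord_at_def
  by (rule the_equality) (auto dest: injD[OF strict_mono_imp_inj_on[OF strict_mono_coord_no]])

lemma coord_no_coord_at:
  assumes "1 \<le> k" "k \<le> CARD('n::{finite,linorder})"
  shows "coord_no (coord_at k :: 'n) = k"
proof -
  obtain i :: 'n where "coord_no i = k"
    using bij_betw_imp_surj_on[OF bij_betw_coord_no] assms by (metis atLeastAtMost_iff imageE)
  then show ?thesis by auto
qed

text \<open>Projection on the first CARD('d) coordinates; meaningful for CARD('d) at most CARD('n).\<close>

definition proj_first :: "real ^ 'n::{finite,linorder} \<Rightarrow> real ^ 'd::{finite,linorder}" where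
  "proj_first x = (\<chi> i. x $ coord_at (coord_no i))"

text \<open>
  For \<open>h \<le> d = CARD('d)\<close>, the spaces of dimension \<open>h\<close> and \<open>d - h\<close> are realised as the coordinate
  subspaces \<open>first_space h\<close> and \<open>last_space h\<close> of \<open>real ^ 'd\<close>, so that the vector made of the
  blocks \<open>a\<close> and \<open>b\<close> is the sum \<open>a + b\<close>.  A function on one of these spaces is a function on
  \<open>real ^ 'd\<close> of which only the restriction to the subspace is used; an empty block is the
  subspace \<open>{0}\<close> and contributes 0.
\<close>

definition first_space :: "nat \<Rightarrow> (real ^ 'd::{finite,linorder}) set" where
  "first_space h = {x. \<forall>i. h < coord_no i \<longrightarrow> x $ i = 0}"

definition last_space :: "nat \<Rightarrow> (real ^ 'd::{finite,linorder}) set" where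
  "last_space h = {x. \<forall>i. coord_no i \<le> h \<longrightarrow> x $ i = 0}"

definition first_block :: "nat \<Rightarrow> real ^ 'd::{finite,linorder} \<Rightarrow> real ^ 'd::{finite,linorder}" where
  "first_block h x = (\<chi> i. if coord_no i \<le> h then x $ i else 0)"

definition last_block :: "nat \<Rightarrow> real ^ 'd::{finite,linorder} \<Rightarrow> real ^ 'd::{finite,linorder}" where
  "last_block h x = (\<chi> i. if coord_no i \<le> h then 0 else x $ i)"

text \<open>A diagonal \<open>h \<times> h\<close> matrix with positive diagonal, acting on \<open>first_space h\<close>.\<close>

definition pos_diagonal :: "nat \<Rightarrow> real ^ 'd::{finite,linorder} ^ 'd::{finite,linorder} \<Rightarrow> bool" where
  "pos_diagonal h S \<longleftrightarrow>
     (\<forall>i j. i \<noteq> j \<longrightarrow> S $ i $ j = 0) \<and>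
     (\<forall>i. if coord_no i \<le> h then S $ i $ i > 0 else S $ i $ i = 0)"

section \<open>Gradients and the block map\<close>

text \<open>
  The gradient at \<open>x \<in> V\<close> of a function on the subspace \<open>V\<close>: the vector of \<open>V\<close> representing the
  derivative within \<open>V\<close>.  It is determined uniquely when \<open>f\<close> is differentiable at \<open>x\<close> within \<open>V\<close>
  and is arbitrary otherwise.
\<close>

definition grad_on :: "'a::euclidean_space set \<Rightarrow> ('a \<Rightarrow> real) \<Rightarrow> 'a \<Rightarrow> 'a" where
  "grad_on V f x = (THE u. u \<in> V \<and> (f has_derivative (\<lambda>v. u \<bullet> v)) (at x within V))"

definition T0_map ::
  "nat \<Rightarrow> real ^ 'd::{finite,linorder} ^ 'd::{finite,linorder}
    \<Rightarrow> (real ^ 'd::{finite,linorder} \<Rightarrow> real)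
    \<Rightarrow> (real ^ 'd::{finite,linorder} \<Rightarrow> real ^ 'd::{finite,linorder} \<Rightarrow> real)
    \<Rightarrow> real ^ 'd::{finite,linorder} \<Rightarrow> real ^ 'd::{finite,linorder}" where
  "T0_map h S f g x =
     grad_on (first_space h) f (S *v first_block h x) +
     grad_on (last_space h) (g (first_block h x)) (last_block h x)"

text \<open>The points at which both gradients in \<open>T0_map\<close> exist.\<close>

definition T0_domain ::
  "nat \<Rightarrow> real ^ 'd::{finite,linorder} ^ 'd::{finite,linorder}
    \<Rightarrow> (real ^ 'd::{finite,linorder} \<Rightarrow> real)
    \<Rightarrow> (real ^ 'd::{finite,linorder} \<Rightarrow> real ^ 'd::{finite,linorder} \<Rightarrow> real)
    \<Rightarrow> (real ^ 'd::{finite,linorder}) set" where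
  "T0_domain h S f g =
     {x. f differentiable (at (S *v first_block h x) within first_space h) \<and>
         g (first_block h x) differentiable (at (last_block h x) within last_space h)}"

end

theory Submission
  imports Defs
begin

text \<open>
  For a coupling \<open>\<pi>\<close> write \<open>cross \<pi>\<close> for the matrix \<open>\<integral> y x\<^sup>T d\<pi>\<close>. Expanding the square, the cost of \<open>\<pi>\<close> is a
  constant minus \<open>2 |cross \<pi>|\<^sup>2\<close>. Let \<open>C\<close> be an element of maximal norm in the closure of the set of
  all these matrices. Any coupling that maximises the linear functional \<open>\<integral> \<langle>C x, y\<rangle> d\<pi>\<close> satisfies
  \<open>|C|\<^sup>2 \<le> \<langle>C, cross \<pi>\<rangle>\<close>, hence \<open>|C| \<le> |cross \<pi>|\<close>, and is optimal; no weak compactness of the set of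
  couplings is needed.

  After a singular value decomposition of \<open>C\<close> the linear problem only involves the first \<open>h = rank C\<close>
  coordinates, where it is solved by a gradient \<open>s = \<nabla>f \<circ> \<Sigma>\<close>. The remaining coordinates are
  transported by gradients of convex functions that depend on the value \<open>s(x\<^sub>1, \<dots>, x\<^sub>h)\<close>. Since that
  value has the same law as the first block of \<open>y\<close>, both steps are instances of one transport problem
  with a parameter, and no disintegration occurs. Its dual problem has a minimiser that is jointly
  measurable in the parameter, and the first variation at the minimiser says that the gradient of the
  potential has the required law.
\<close>

section \<open>Selecting an almost everywhere convergent sequence\<close>

text \<open>The cost is constant minus a convex function of the coupling, so linearising at a
  maximiser of |cross \<pi>|^2 loses nothing: \<open>C\<close> is a limit of such matrices, hence
  |C|^2 is at most the supremum of \<langle>C, cross \<pi>\<rangle>, and Cauchy-Schwarz turns a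
  coupling attaining that supremum into an optimal one. Since \<open>C\<close> vanishes on the
  remaining coordinates after the decomposition, the second block of the map is free as far as the
  cost is concerned and serves only to produce the law \<nu>.

  Two obstacles shape the rest. Compactness of potentials for each single parameter would choose a
  subsequence depending on that parameter, with no control of measurability. The almost optimal
  pairs of potentials are midpoint convex, and elements of almost minimal norm give one sequence
  that converges for almost every parameter. Secondly, s is only a measurable function of x, so no
  change of variables is available on its fibres. Differentiability is therefore tested only along
  directions of x that keep the parameter fixed, where absolute continuity still excludes the
  exceptional points.\<close>

lemma abs_le_half_sum_square:
  fixes t e :: real
  assumes "e > 0"
  shows "\<bar>t\<bar> \<le> (e + t\<^sup>2 / e) / 2"
proof -
  have "0 \<le> (\<bar>t\<bar> - e)\<^sup>2 / e" using assms by simp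
  also have "\<dots> = t\<^sup>2 / e - 2 * \<bar>t\<bar> + e"
    using assms by (simp add: power2_diff field_simps power2_eq_square)
  finally show ?thesis by simp
qed

text \<open>
  The elements of almost minimal \<open>L\<^sup>2\<close> norm in \<open>C n\<close> form a Cauchy sequence by the parallelogram law.
\<close>
lemma nested_midpoint_convex_AE_convergent:
  fixes M :: "'w measure" and C :: "nat \<Rightarrow> ('w \<Rightarrow> real) set"
  assumes M: "prob_space M"
    and ne: "\<And>n. C n \<noteq> {}" and dec: "\<And>n. C (Suc n) \<subseteq> C n"
    and meas: "\<And>f. f \<in> C 0 \<Longrightarrow> f \<in> borel_measurable M"
    and bnd: "\<And>f w. f \<in> C 0 \<Longrightarrow> \<bar>f w\<bar> \<le> B"
    and mid: "\<And>n f g. f \<in> C n \<Longrightarrow> g \<in> C n \<Longrightarrow> (\<lambda>w. (f w + g w) / 2) \<in> C n"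
  obtains F where "\<And>n. F n \<in> C n" "AE w in M. convergent (\<lambda>n. F n w)"
proof -
  interpret prob_space M by fact
  have anti: "C n \<subseteq> C m" if "m \<le> n" for m n
    using that by (rule lift_Suc_antimono_le[of C, OF dec])
  have meas': "f \<in> borel_measurable M" if "f \<in> C n" for f n
    using that anti[of 0 n] meas by auto
  have bnd': "\<bar>f w\<bar> \<le> B" if "f \<in> C n" for f n w
    using that anti[of 0 n] bnd by auto
  have int2: "integrable M (\<lambda>w. (f w)\<^sup>2)" if "f \<in> C n" for f n
  proof (rule integrable_const_bound[where B="B\<^sup>2"])
    show "AE w in M. norm ((f w)\<^sup>2) \<le> B\<^sup>2"
      using bnd'[OF that] by (auto simp: abs_le_square_iff[symmetric] intro!: AE_I2 order_trans[OF _ abs_ge_self])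
  qed (use meas'[OF that] in measurable)
  have intp: "integrable M (\<lambda>w. f w * g w)" if "f \<in> C n" "g \<in> C m" for f g n m
  proof (rule integrable_const_bound[where B="B * B"])
    show "AE w in M. norm (f w * g w) \<le> B * B"
      using bnd'[OF that(1)] bnd'[OF that(2)]
      by (auto simp: abs_mult intro!: AE_I2 mult_mono order_trans[OF abs_ge_zero])
  qed (use meas'[OF that(1)] meas'[OF that(2)] in measurable)
  define q where "q f = (\<integral>w. (f w)\<^sup>2 \<partial>M)" for f :: "'w \<Rightarrow> real"
  have q0: "0 \<le> q f" for f by (simp add: q_def)
  have qB: "q f \<le> B\<^sup>2" if "f \<in> C n" for f n
  proof -
    have "q f \<le> (\<integral>w. B\<^sup>2 \<partial>M)"
      unfolding q_def using bnd'[OF that] int2[OF that]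
      by (intro integral_mono) (auto simp: abs_le_square_iff[symmetric] intro!: order_trans[OF _ abs_ge_self])
    then show ?thesis by (simp add: prob_space)
  qed
  define a where "a n = Inf (q ` C n)" for n
  have bdd: "bdd_below (q ` C n)" for n by (rule bdd_belowI[of _ 0]) (use q0 in auto)
  have a_le: "a n \<le> q f" if "f \<in> C n" for f n
    unfolding a_def by (rule cInf_lower) (use that bdd in auto)
  have a_mono: "a n \<le> a m" if "n \<le> m" for n m
    unfolding a_def by (rule cInf_superset_mono) (use ne bdd anti[OF that] in auto)
  have a_B: "a n \<le> B\<^sup>2" for n
  proof -
    obtain f where "f \<in> C n" using ne by blast
    then show ?thesis using a_le qB by (meson order_trans)
  qed
  have "incseq a" using a_mono by (simp add: incseq_def)
  then obtain L where L: "a \<longlonglongrightarrow> L" "\<And>n. a n \<le> L"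
    using incseq_convergent[of a "B\<^sup>2"] a_B by blast
  have "\<exists>n. (\<forall>m\<ge>n. L - a m < (1/4)^k / 8)" for k
  proof -
    have "eventually (\<lambda>m. L - (1/4)^k / 8 < a m) sequentially"
      using L(1) by (rule order_tendstoD) simp
    then obtain N where "\<forall>m\<ge>N. L - (1/4)^k / 8 < a m" unfolding eventually_sequentially by blast
    then have "\<forall>m\<ge>N. L - a m < (1/4)^k / 8" by fastforce
    then show ?thesis ..
  qed
  \<comment> \<open>The eighths are a budget: with the excess (1/4)^k/8 allowed to
    \<open>F k\<close> below, the parallelogram identity leaves at most 9/16 of (1/4)^k.\<close>
  then obtain n0 where n0: "\<And>k m. m \<ge> n0 k \<Longrightarrow> L - a m < (1/4)^k / 8" by metis
  \<comment> \<open>The sum makes \<open>n\<close> increasing and at least \<open>n0 k\<close>; the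
    summand \<open>k\<close> gives \<open>k \<le> n k\<close>, so that \<open>F k\<close> lies in
    \<open>C k\<close>.\<close>
  define n where "n k = k + (\<Sum>j\<le>k. n0 j)" for k
  have n_ge: "n0 k \<le> n k" "k \<le> n k" for k
    unfolding n_def by (auto intro!: trans_le_add2 member_le_sum)
  have n_mono: "n k \<le> n (Suc k)" for k unfolding n_def by simp
  have "\<exists>f\<in>C (n k). q f < a (n k) + (1/4)^k / 8" for k
  proof -
    have "Inf (q ` C (n k)) < a (n k) + (1/4)^k / 8" by (simp add: a_def)
    from cInf_lessD[OF _ this] obtain y where "y \<in> q ` C (n k)" "y < a (n k) + (1/4)^k / 8"
      using ne by auto
    then show ?thesis by blast
  qed
  then obtain F where F: "\<And>k. F k \<in> C (n k)" "\<And>k. q (F k) < a (n k) + (1/4)^k / 8" by metis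
  have diff2: "(\<integral>w. (F (Suc k) w - F k w)\<^sup>2 \<partial>M) \<le> (1/4)^k" for k
  proof -
    let ?f = "F k" and ?g = "F (Suc k)"
    have g: "?g \<in> C (n k)" using F(1)[of "Suc k"] anti[OF n_mono] by auto
    note f = F(1)[of k]
    let ?h = "\<lambda>w. (?f w + ?g w) / 2"
    have h: "?h \<in> C (n k)" using mid f g by blast
    \<comment> \<open>Parallelogram identity: the midpoint stays in the set, so its norm cannot fall
      below the infimum, and two almost minimal elements must be close.\<close>
    have "(\<integral>w. (?g w - ?f w)\<^sup>2 \<partial>M) = (\<integral>w. 2 * (?f w)\<^sup>2 + 2 * (?g w)\<^sup>2 - 4 * (?h w)\<^sup>2 \<partial>M)"
      by (intro Bochner_Integration.integral_cong) (auto simp: power2_eq_square field_simps)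
    also have "\<dots> = 2 * q ?f + 2 * q ?g - 4 * q ?h"
      unfolding q_def using int2[OF f] int2[OF g] int2[OF h] by simp
    also have "\<dots> \<le> (1/4)^k"
    proof -
      have p: "(0::real) < (1/4)^k" "(1/4::real)^Suc k = (1/4)^k / 4" by simp_all
      show ?thesis
        using a_le[OF h] F(2)[of k] F(2)[of "Suc k", unfolded p(2)] n0[OF n_ge(1)[of k]]
          L(2)[of "n (Suc k)"] p(1) by linarith
    qed
    finally show ?thesis .
  qed
  have diff1: "(\<integral>\<^sup>+w. ennreal \<bar>F (Suc k) w - F k w\<bar> \<partial>M) \<le> ennreal ((1/2)^k)" for k
  proof -
    let ?d = "\<lambda>w. F (Suc k) w - F k w"
    note [measurable] = meas'[OF F(1)[of k]] meas'[OF F(1)[of "Suc k"]]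
    have i: "integrable M (\<lambda>w. (?d w)\<^sup>2)"
      unfolding power2_diff using int2[OF F(1)[of k]] int2[OF F(1)[of "Suc k"]]
        intp[OF F(1)[of "Suc k"] F(1)[of k]] by (simp add: mult.assoc)
    \<comment> \<open>The weight (1/2)^k is the square root of the bound in \<open>diff2\<close>, so
      the arithmetic-geometric inequality returns exactly (1/2)^k, which is summable.\<close>
    have e: "((1::real)/2)^k > 0" by simp
    have "(\<integral>\<^sup>+w. ennreal \<bar>?d w\<bar> \<partial>M) \<le> (\<integral>\<^sup>+w. ennreal (((1/2)^k + (?d w)\<^sup>2 / (1/2)^k) / 2) \<partial>M)"
      using abs_le_half_sum_square[OF e] by (intro nn_integral_mono ennreal_leI) auto
    also have "\<dots> = ennreal (\<integral>w. ((1/2)^k + (?d w)\<^sup>2 / (1/2)^k) / 2 \<partial>M)"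
      using i by (intro nn_integral_eq_integral) auto
    also have "(\<integral>w. ((1/2)^k + (?d w)\<^sup>2 / (1/2)^k) / 2 \<partial>M)
        = ((1/2)^k + (\<integral>w. (?d w)\<^sup>2 \<partial>M) / (1/2)^k) / 2"
      using i by (simp add: prob_space)
    also have "\<dots> \<le> ((1/2)^k + (1/4)^k / (1/2)^k) / 2"
      using diff2[of k] e by (intro divide_right_mono add_left_mono) auto
    also have "(1/4::real)^k = (1/2)^k * (1/2)^k" by (simp flip: power_mult_distrib)
    also have "((1/2)^k + (1/2)^k * (1/2)^k / (1/2)^k) / 2 = ((1/2)^k :: real)" by simp
    finally show ?thesis by (simp add: ennreal_leI)
  qed
  have "(\<integral>\<^sup>+w. (\<Sum>k. ennreal \<bar>F (Suc k) w - F k w\<bar>) \<partial>M) = (\<Sum>k. \<integral>\<^sup>+w. ennreal \<bar>F (Suc k) w - F k w\<bar> \<partial>M)"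
    using meas'[OF F(1)] by (intro nn_integral_suminf) measurable
  also have "\<dots> \<le> (\<Sum>k. ennreal ((1/2)^k))"
    by (intro suminf_le diff1) auto
  also have "\<dots> = ennreal (\<Sum>k. (1/2)^k)"
    by (intro suminf_ennreal2) (auto simp: summable_geometric)
  also have "\<dots> < \<infinity>" by simp
  finally have "AE w in M. (\<Sum>k. ennreal \<bar>F (Suc k) w - F k w\<bar>) \<noteq> \<infinity>"
    using meas'[OF F(1)] by (intro nn_integral_PInf_AE) auto
  then have conv: "AE w in M. convergent (\<lambda>k. F k w)"
  proof eventually_elim
    case (elim w)
    then have "summable (\<lambda>k. \<bar>F (Suc k) w - F k w\<bar>)"
      by (intro summable_suminf_not_top) auto
    then have "summable (\<lambda>k. F (Suc k) w - F k w)"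
      by (rule summable_rabs_cancel)
    then have "(\<lambda>n. \<Sum>k<n. F (Suc k) w - F k w) \<longlonglongrightarrow> (\<Sum>k. F (Suc k) w - F k w)"
      by (rule summable_LIMSEQ)
    then have "(\<lambda>n. F n w - F 0 w) \<longlonglongrightarrow> (\<Sum>k. F (Suc k) w - F k w)"
      using sum_lessThan_telescope[of "\<lambda>n. F n w"] by simp
    from tendsto_add[OF this tendsto_const[of "F 0 w"]] show ?case by (auto simp: convergent_def)
  qed
  have "F k \<in> C k" for k using F(1)[of k] anti[OF n_ge(2)[of k]] by auto
  with conv show ?thesis by (rule that[rotated])
qed

section \<open>The dual of the conditional transport problem\<close>

definition legendre :: "'e::real_inner set \<Rightarrow> ('e \<Rightarrow> real) \<Rightarrow> 'e \<Rightarrow> real" where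
  "legendre D k w = (SUP a\<in>D. a \<bullet> w - k a)"

section \<open>Conjugates of bounded functions on bounded sets\<close>

context
  fixes D :: "'e::euclidean_space set" and R B :: real and k :: "'e \<Rightarrow> real"
  assumes D: "D \<noteq> {}" "D \<subseteq> cball 0 R" and k: "\<And>a. a \<in> D \<Longrightarrow> \<bar>k a\<bar> \<le> B"
begin

lemma legendre_bdd: "bdd_above ((\<lambda>a. a \<bullet> w - k a) ` D)"
proof (rule bdd_aboveI2)
  fix a assume a: "a \<in> D"
  have "a \<bullet> w \<le> norm a * norm w" by (rule norm_cauchy_schwarz)
  also have "\<dots> \<le> R * norm w" using a D by (intro mult_right_mono) auto
  finally show "a \<bullet> w - k a \<le> R * norm w + B" using k[OF a] by auto
qed

lemma legendre_upper: "a \<in> D \<Longrightarrow> a \<bullet> w - k a \<le> legendre D k w"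
  unfolding legendre_def by (rule cSUP_upper[OF _ legendre_bdd])

lemma legendre_least: "(\<And>a. a \<in> D \<Longrightarrow> a \<bullet> w - k a \<le> c) \<Longrightarrow> legendre D k w \<le> c"
  unfolding legendre_def by (rule cSUP_least[OF D(1)])

text \<open>For continuous \<open>k\<close> a countable dense set can replace its closure in the
  supremum, which reconciles measurability with the inequality at every point.\<close>

lemma legendre_upper_closure:
  assumes "continuous_on (closure D) k" "a \<in> closure D"
  shows "a \<bullet> w - k a \<le> legendre D k w"
proof (rule continuous_le_on_closure[OF _ assms(2)])
  show "continuous_on (closure D) (\<lambda>a. a \<bullet> w - k a)"
    using assms(1) by (intro continuous_intros)
qed (rule legendre_upper)

lemma legendre_lipschitz: "\<bar>legendre D k w - legendre D k w'\<bar> \<le> R * norm (w - w')"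
proof -
  have "legendre D k w \<le> legendre D k w' + R * norm (w - w')" for w w'
  proof (rule legendre_least)
    fix a assume a: "a \<in> D"
    have "a \<bullet> (w - w') \<le> norm a * norm (w - w')" by (rule norm_cauchy_schwarz)
    also have "\<dots> \<le> R * norm (w - w')" using a D by (intro mult_right_mono) auto
    finally show "a \<bullet> w - k a \<le> legendre D k w' + R * norm (w - w')"
      using legendre_upper[OF a, of w'] by (simp add: inner_diff_right)
  qed
  from this[of w w'] this[of w' w] show ?thesis by (simp add: norm_minus_commute)
qed

lemma legendre_convex: "convex_on UNIV (legendre D k)"
proof (rule convex_onI)
  fix t :: real and v w :: 'e
  assume t: "0 < t" "t < 1"
  show "legendre D k ((1 - t) *\<^sub>R v + t *\<^sub>R w) \<le> (1 - t) * legendre D k v + t * legendre D k w"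
  proof (rule legendre_least)
    fix a assume a: "a \<in> D"
    have "a \<bullet> ((1 - t) *\<^sub>R v + t *\<^sub>R w) - k a = (1 - t) * (a \<bullet> v - k a) + t * (a \<bullet> w - k a)"
      by (simp add: inner_add_right algebra_simps)
    also have "\<dots> \<le> (1 - t) * legendre D k v + t * legendre D k w"
      using t by (intro add_mono mult_left_mono legendre_upper[OF a]) auto
    finally show "a \<bullet> ((1 - t) *\<^sub>R v + t *\<^sub>R w) - k a \<le> (1 - t) * legendre D k v + t * legendre D k w" .
  qed
qed auto

lemma legendre_bound: 
  assumes "0 \<le> R"
  shows "\<bar>legendre D k w\<bar> \<le> R * norm w + B"
proof -
  obtain a where a: "a \<in> D" using D by blast
  have *: "\<bar>a \<bullet> w\<bar> \<le> R * norm w" if "a \<in> D" for a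
  proof -
    have "\<bar>a \<bullet> w\<bar> \<le> norm a * norm w" by (rule Cauchy_Schwarz_ineq2)
    also have "\<dots> \<le> R * norm w" using that D by (intro mult_right_mono) auto
    finally show ?thesis .
  qed
  have "legendre D k w \<le> R * norm w + B"
  proof (rule legendre_least)
    fix a assume a: "a \<in> D"
    show "a \<bullet> w - k a \<le> R * norm w + B" using *[OF a] k[OF a] by linarith
  qed
  moreover have "- (R * norm w + B) \<le> legendre D k w"
    using legendre_upper[OF a, of w] *[OF a] k[OF a] by linarith
  ultimately show ?thesis by simp
qed

end

lemma legendre_orthogonal_cong:
  assumes "\<And>a. a \<in> D \<Longrightarrow> a \<bullet> w = a \<bullet> w'"
  shows "legendre D k w = legendre D k w'"
  unfolding legendre_def using assms by (intro SUP_cong) auto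

lemma legendre_measurable:
  fixes D :: "'e::euclidean_space set" and k :: "'p \<Rightarrow> 'e \<Rightarrow> real" and R B :: real
  assumes "countable D" "D \<noteq> {}" "D \<subseteq> cball 0 R" "\<And>p a. a \<in> D \<Longrightarrow> \<bar>k p a\<bar> \<le> B"
    and "case_prod k \<in> borel_measurable (N \<Otimes>\<^sub>M borel)"
  shows "(\<lambda>(p, w). legendre D (k p) w) \<in> borel_measurable (N \<Otimes>\<^sub>M borel)"
proof -
  have 1: "(\<lambda>p. k p a) \<in> borel_measurable N" for a
    using measurable_compose[OF measurable_Pair2' assms(5), of a] by simp
  have "(\<lambda>x. SUP a\<in>D. a \<bullet> snd x - k (fst x) a) \<in> borel_measurable (N \<Otimes>\<^sub>M borel)"
  proof (rule borel_measurable_cSUP[OF assms(1)])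
    show "bdd_above ((\<lambda>a. a \<bullet> snd x - k (fst x) a) ` D)" for x
      by (rule legendre_bdd[OF assms(2,3,4)])
    show "(\<lambda>x. a \<bullet> snd x - k (fst x) a) \<in> borel_measurable (N \<Otimes>\<^sub>M borel)" for a
      using measurable_compose[OF measurable_fst 1] by measurable
  qed
  then show ?thesis by (simp add: legendre_def split_beta')
qed

text \<open>An \<epsilon>/3 argument. The selection lemma controls only countably many points for
  almost every parameter; the uniform Lipschitz constant carries the convergence to all the
  others.\<close>

lemma equilipschitz_convergent:
  fixes f :: "nat \<Rightarrow> 'e::metric_space \<Rightarrow> real"
  assumes lip: "\<And>n x y. x \<in> X \<Longrightarrow> y \<in> X \<Longrightarrow> \<bar>f n x - f n y\<bar> \<le> L * dist x y"
    and D: "D \<subseteq> X" "X \<subseteq> closure D" and conv: "\<And>x. x \<in> D \<Longrightarrow> convergent (\<lambda>n. f n x)"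
    and x: "x \<in> X" and L: "L \<ge> 0"
  shows "convergent (\<lambda>n. f n x)"
proof -
  have "Cauchy (\<lambda>n. f n x)"
  proof (rule metric_CauchyI)
    fix e :: real assume e: "e > 0"
    have "x \<in> closure D" using x D by blast
    \<comment> \<open>\<open>L + 1\<close> instead of \<open>L\<close> keeps the radius meaningful
      when \<open>L = 0\<close>.\<close>
    then obtain y where y: "y \<in> D" "dist y x < e / (3 * (L + 1))"
      using e L unfolding closure_approachable by (meson divide_pos_pos add_nonneg_pos mult_pos_pos zero_less_numeral zero_less_one)
    have "L * dist x y \<le> (L + 1) * dist x y" by (simp add: algebra_simps)
    also have "\<dots> < e / 3" using y(2) L by (simp add: dist_commute field_simps)
    finally have d: "\<bar>f n x - f n y\<bar> < e / 3" for n
      using lip[of x y n] x y(1) D by auto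
    have "Cauchy (\<lambda>n. f n y)" using conv[OF y(1)] by (simp add: Cauchy_convergent_iff)
    then obtain M where M: "\<And>m n. m \<ge> M \<Longrightarrow> n \<ge> M \<Longrightarrow> dist (f m y) (f n y) < e / 3"
      using e by (meson metric_CauchyD divide_pos_pos zero_less_numeral)
    have "dist (f m x) (f n x) < e" if "m \<ge> M" "n \<ge> M" for m n
      using M[OF that] d[of m] d[of n] unfolding dist_real_def by linarith
    then show "\<exists>M. \<forall>m\<ge>M. \<forall>n\<ge>M. dist (f m x) (f n x) < e" by blast
  qed
  then show ?thesis by (simp add: Cauchy_convergent_iff)
qed

lemma dense_sequence:
  fixes Y :: "'e::euclidean_space set"
  assumes "Y \<noteq> {}"
  obtains s :: "nat \<Rightarrow> 'e" where "range s \<subseteq> Y" "Y \<subseteq> closure (range s)"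
proof -
  obtain T where T: "countable T" "T \<subseteq> Y" "Y \<subseteq> closure T" using separable by blast
  then have "T \<noteq> {}" using assms by auto
  with T(1) obtain s :: "nat \<Rightarrow> 'e" where "range s = T" by (metis range_from_nat_into)
  with T show ?thesis by (intro that[of s]) auto
qed

text \<open>
  \<open>b\<close> and \<open>b'\<close> are the parameters on the two sides; \<open>z\<close> has to be transported to \<open>z'\<close> by the gradient of
  a convex function that may depend on the parameter.
\<close>
locale dual_problem = M: prob_space \<mu> + N: prob_space \<nu>
  for \<mu> :: "'a measure" and \<nu> :: "'c measure" +
  fixes b :: "'a \<Rightarrow> 'p::{metric_space, second_countable_topology}" and b' :: "'c \<Rightarrow> 'p"
    and z :: "'a \<Rightarrow> 'e::euclidean_space" and z' :: "'c \<Rightarrow> 'e"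
    and Y :: "'e set" and R :: real
  assumes b_meas [measurable]: "b \<in> borel_measurable \<mu>" "b' \<in> borel_measurable \<nu>"
    and z_meas [measurable]: "z \<in> borel_measurable \<mu>" "z' \<in> borel_measurable \<nu>"
    and same_law: "distr \<mu> borel b = distr \<nu> borel b'"
    and Y: "compact Y" "0 \<in> Y" "Y \<subseteq> cball 0 R"
    and z_in: "AE x in \<mu>. z x \<in> cball 0 R" and z'_in: "AE y in \<nu>. z' y \<in> Y"
begin

lemma R_nonneg: "0 \<le> R" using Y by auto

definition dense_seq :: "nat \<Rightarrow> 'e" where
  "dense_seq = (SOME s. range s \<subseteq> Y \<and> Y \<subseteq> closure (range s))"

lemma dense_seq: "range dense_seq \<subseteq> Y" "closure (range dense_seq) = Y"
proof -
  have "\<exists>s::nat \<Rightarrow> 'e. range s \<subseteq> Y \<and> Y \<subseteq> closure (range s)"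
    using dense_sequence[of Y] Y by (metis empty_iff)
  from someI_ex[OF this] have *: "range dense_seq \<subseteq> Y" "Y \<subseteq> closure (range dense_seq)"
    unfolding dense_seq_def by auto
  then show "range dense_seq \<subseteq> Y" "closure (range dense_seq) = Y"
    using closure_minimal[OF *(1)] compact_imp_closed[OF Y(1)] by auto
qed

text \<open>The supremum runs over a countable dense subset of \<open>Y\<close> so that it stays jointly measurable.\<close>
definition conjugate :: "('p \<Rightarrow> 'e \<Rightarrow> real) \<Rightarrow> 'p \<Rightarrow> 'e \<Rightarrow> real" where
  "conjugate \<psi> p w = legendre (range dense_seq) (\<psi> p) w"

text \<open>The class in which perturbations are allowed: large enough to contain all continuous
  bounded test functions of (p, y), yet with finite conjugates.\<close>

definition admissible :: "('p \<Rightarrow> 'e \<Rightarrow> real) \<Rightarrow> bool" where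
  "admissible \<psi> \<longleftrightarrow> case_prod \<psi> \<in> borel_measurable (borel \<Otimes>\<^sub>M borel) \<and>
     (\<exists>B. \<forall>p. \<forall>y\<in>Y. \<bar>\<psi> p y\<bar> \<le> B) \<and> (\<forall>p. continuous_on Y (\<psi> p))"

text \<open>The class in which limits are taken. Its bounds are those that double conjugation and
  normalisation at 0 produce, and all its pointwise conditions survive midpoints and pointwise
  limits. The conditions hold for every parameter, not just almost every one.\<close>

definition feasible :: "('p \<Rightarrow> 'e \<Rightarrow> real) \<Rightarrow> ('p \<Rightarrow> 'e \<Rightarrow> real) \<Rightarrow> bool" where
  "feasible \<phi> \<psi> \<longleftrightarrow> case_prod \<phi> \<in> borel_measurable (borel \<Otimes>\<^sub>M borel) \<and>
     case_prod \<psi> \<in> borel_measurable (borel \<Otimes>\<^sub>M borel) \<and>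
     (\<forall>p. \<forall>w\<in>cball 0 R. \<forall>w'\<in>cball 0 R. \<bar>\<phi> p w - \<phi> p w'\<bar> \<le> R * dist w w') \<and>
     (\<forall>p. \<forall>w\<in>Y. \<forall>w'\<in>Y. \<bar>\<psi> p w - \<psi> p w'\<bar> \<le> R * dist w w') \<and>
     (\<forall>p. \<forall>w\<in>cball 0 R. \<bar>\<phi> p w\<bar> \<le> 2 * R\<^sup>2) \<and> (\<forall>p. \<forall>w\<in>Y. \<bar>\<psi> p w\<bar> \<le> 2 * R\<^sup>2) \<and>
     (\<forall>p. \<forall>w\<in>cball 0 R. \<forall>y\<in>Y. y \<bullet> w \<le> \<phi> p w + \<psi> p y)"

definition cost :: "('p \<Rightarrow> 'e \<Rightarrow> real) \<Rightarrow> ('p \<Rightarrow> 'e \<Rightarrow> real) \<Rightarrow> real" where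
  "cost \<phi> \<psi> = (\<integral>x. \<phi> (b x) (z x) \<partial>\<mu>) + (\<integral>y. \<psi> (b' y) (z' y) \<partial>\<nu>)"

lemma meas_comp1:
  assumes "case_prod \<phi> \<in> borel_measurable (borel \<Otimes>\<^sub>M borel)"
  shows "(\<lambda>x. \<phi> (b x) (z x)) \<in> borel_measurable \<mu>"
  using measurable_compose[OF measurable_Pair[OF b_meas(1) z_meas(1)] assms] by simp

lemma meas_comp2:
  assumes "case_prod \<phi> \<in> borel_measurable (borel \<Otimes>\<^sub>M borel)"
  shows "(\<lambda>x. \<phi> (b' x) (z' x)) \<in> borel_measurable \<nu>"
  using measurable_compose[OF measurable_Pair[OF b_meas(2) z_meas(2)] assms] by simp

lemma int_comp1:
  fixes B :: real
  assumes "case_prod \<phi> \<in> borel_measurable (borel \<Otimes>\<^sub>M borel)" "\<And>p w. w \<in> cball 0 R \<Longrightarrow> \<bar>\<phi> p w\<bar> \<le> B"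
  shows "integrable \<mu> (\<lambda>x. \<phi> (b x) (z x))"
  by (rule M.integrable_const_bound[where B=B]) (use z_in assms(2) meas_comp1[OF assms(1)] in auto)

lemma int_comp2:
  fixes B :: real
  assumes "case_prod \<phi> \<in> borel_measurable (borel \<Otimes>\<^sub>M borel)" "\<And>p w. w \<in> Y \<Longrightarrow> \<bar>\<phi> p w\<bar> \<le> B"
  shows "integrable \<nu> (\<lambda>x. \<phi> (b' x) (z' x))"
  by (rule N.integrable_const_bound[where B=B]) (use z'_in assms(2) meas_comp2[OF assms(1)] in auto)

lemma feasibleD:
  assumes "feasible \<phi> \<psi>"
  shows "case_prod \<phi> \<in> borel_measurable (borel \<Otimes>\<^sub>M borel)"
    "case_prod \<psi> \<in> borel_measurable (borel \<Otimes>\<^sub>M borel)"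
    "\<And>p w w'. w \<in> cball 0 R \<Longrightarrow> w' \<in> cball 0 R \<Longrightarrow> \<bar>\<phi> p w - \<phi> p w'\<bar> \<le> R * dist w w'"
    "\<And>p w w'. w \<in> Y \<Longrightarrow> w' \<in> Y \<Longrightarrow> \<bar>\<psi> p w - \<psi> p w'\<bar> \<le> R * dist w w'"
    "\<And>p w. w \<in> cball 0 R \<Longrightarrow> \<bar>\<phi> p w\<bar> \<le> 2 * R\<^sup>2"
    "\<And>p w. w \<in> Y \<Longrightarrow> \<bar>\<psi> p w\<bar> \<le> 2 * R\<^sup>2"
    "\<And>p w y. w \<in> cball 0 R \<Longrightarrow> y \<in> Y \<Longrightarrow> y \<bullet> w \<le> \<phi> p w + \<psi> p y"
  using assms unfolding feasible_def by blast+

lemma feasible_int: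
  assumes "feasible \<phi> \<psi>"
  shows "integrable \<mu> (\<lambda>x. \<phi> (b x) (z x))" "integrable \<nu> (\<lambda>x. \<psi> (b' x) (z' x))"
  using int_comp1[OF feasibleD(1,5)[OF assms]] int_comp2[OF feasibleD(2,6)[OF assms]] by auto

lemma cost_lower:
  assumes "feasible \<phi> \<psi>"
  shows "- 4 * R\<^sup>2 \<le> cost \<phi> \<psi>"
proof -
  have "(\<integral>x. - 2 * R\<^sup>2 \<partial>\<mu>) \<le> (\<integral>x. \<phi> (b x) (z x) \<partial>\<mu>)"
    by (intro integral_mono_AE feasible_int[OF assms])
       (use z_in feasibleD(5)[OF assms] in \<open>auto simp: abs_le_iff minus_le_iff\<close>)
  moreover have "(\<integral>x. - 2 * R\<^sup>2 \<partial>\<nu>) \<le> (\<integral>x. \<psi> (b' x) (z' x) \<partial>\<nu>)"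
    by (intro integral_mono_AE feasible_int[OF assms])
       (use z'_in feasibleD(6)[OF assms] in \<open>auto simp: abs_le_iff minus_le_iff\<close>)
  ultimately show ?thesis by (simp add: cost_def M.prob_space N.prob_space)
qed

lemma admissibleD:
  assumes "admissible \<psi>"
  shows "case_prod \<psi> \<in> borel_measurable (borel \<Otimes>\<^sub>M borel)"
    "continuous_on Y (\<psi> p)"
  using assms unfolding admissible_def by auto

lemma conjugate_props:
  assumes "admissible \<psi>"
  shows "case_prod (conjugate \<psi>) \<in> borel_measurable (borel \<Otimes>\<^sub>M borel)"
    and "\<bar>conjugate \<psi> p w - conjugate \<psi> p w'\<bar> \<le> R * dist w w'"
    and "convex_on UNIV (conjugate \<psi> p)"
    and "y \<in> Y \<Longrightarrow> y \<bullet> w \<le> conjugate \<psi> p w + \<psi> p y"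
    and "(\<And>y. y \<in> Y \<Longrightarrow> y \<bullet> w \<le> c + \<psi> p y) \<Longrightarrow> conjugate \<psi> p w \<le> c"
    and "\<exists>B. \<forall>p. \<forall>w\<in>cball 0 R. \<bar>conjugate \<psi> p w\<bar> \<le> B"
proof -
  obtain B where B: "\<And>p y. y \<in> Y \<Longrightarrow> \<bar>\<psi> p y\<bar> \<le> B" using assms unfolding admissible_def by blast
  have D: "range dense_seq \<noteq> {}" "range dense_seq \<subseteq> cball 0 R" using dense_seq Y by auto
  have k: "\<bar>\<psi> q a\<bar> \<le> B" if "a \<in> range dense_seq" for q a using B that dense_seq(1) by blast
  show "case_prod (conjugate \<psi>) \<in> borel_measurable (borel \<Otimes>\<^sub>M borel)"
    using legendre_measurable[OF _ D, of \<psi> B borel] k admissibleD(1)[OF assms]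
    by (simp add: conjugate_def[abs_def])
  show "\<bar>conjugate \<psi> p w - conjugate \<psi> p w'\<bar> \<le> R * dist w w'"
    unfolding conjugate_def dist_norm by (rule legendre_lipschitz[OF D k[of _ p]])
  show "convex_on UNIV (conjugate \<psi> p)"
    unfolding conjugate_def[abs_def] by (rule legendre_convex[OF D k[of _ p]])
  show "y \<bullet> w \<le> conjugate \<psi> p w + \<psi> p y" if "y \<in> Y"
    unfolding conjugate_def
  proof -
    have "y \<bullet> w - \<psi> p y \<le> legendre (range dense_seq) (\<psi> p) w"
      by (rule legendre_upper_closure[OF D k[of _ p]]) (use admissibleD(2)[OF assms] dense_seq(2) that in auto)
    then show "y \<bullet> w \<le> legendre (range dense_seq) (\<psi> p) w + \<psi> p y" by simp
  qed
  show "conjugate \<psi> p w \<le> c" if "\<And>y. y \<in> Y \<Longrightarrow> y \<bullet> w \<le> c + \<psi> p y"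
    unfolding conjugate_def
  proof (rule legendre_least[OF D k[of _ p]])
    fix a assume "a \<in> range dense_seq"
    then show "a \<bullet> w - \<psi> p a \<le> c" using that[of a] dense_seq(1) by auto
  qed
  have "\<bar>conjugate \<psi> p w\<bar> \<le> R * R + B" if "w \<in> cball 0 R" for p w
  proof -
    have "\<bar>conjugate \<psi> p w\<bar> \<le> R * norm w + B"
      unfolding conjugate_def by (rule legendre_bound[OF D k[of _ p] R_nonneg])
    also have "\<dots> \<le> R * R + B" using that R_nonneg by (intro add_right_mono mult_left_mono) auto
    finally show ?thesis .
  qed
  then show "\<exists>B. \<forall>p. \<forall>w\<in>cball 0 R. \<bar>conjugate \<psi> p w\<bar> \<le> B" by blast
qed

text \<open>When \<open>Y\<close> lies in one coordinate block, the potential is constant along the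
  complementary block. This settles differentiability in those directions, along which
  \<open>z\<close> cannot move.\<close>

lemma conjugate_orth:
  assumes "\<And>y. y \<in> Y \<Longrightarrow> y \<bullet> v = 0"
  shows "conjugate \<psi> p (w + v) = conjugate \<psi> p w"
  unfolding conjugate_def
proof (rule legendre_orthogonal_cong)
  fix a assume "a \<in> range dense_seq"
  then have "a \<in> Y" using dense_seq(1) by auto
  then show "a \<bullet> (w + v) = a \<bullet> w" using assms by (simp add: inner_add_right)
qed

lemma admissible_int:
  assumes "admissible \<psi>"
  shows "integrable \<mu> (\<lambda>x. conjugate \<psi> (b x) (z x))" "integrable \<nu> (\<lambda>x. \<psi> (b' x) (z' x))"
proof -
  obtain B where B: "\<And>p w. w \<in> cball 0 R \<Longrightarrow> \<bar>conjugate \<psi> p w\<bar> \<le> B"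
    using conjugate_props(6)[OF assms] by blast
  obtain B' where B': "\<And>p w. w \<in> Y \<Longrightarrow> \<bar>\<psi> p w\<bar> \<le> B'"
    using assms unfolding admissible_def by blast
  show "integrable \<mu> (\<lambda>x. conjugate \<psi> (b x) (z x))" "integrable \<nu> (\<lambda>x. \<psi> (b' x) (z' x))"
    using int_comp1[OF conjugate_props(1)[OF assms] B] int_comp2[OF admissibleD(1)[OF assms] B'] by auto
qed

lemma feasible_admissible:
  assumes "feasible \<phi> \<psi>"
  shows "admissible \<psi>"
  unfolding admissible_def
proof (intro conjI allI)
  show "continuous_on Y (\<psi> p)" for p
    by (rule lipschitz_on_continuous_on[where L=R])
      (use feasibleD(4)[OF assms] R_nonneg in \<open>auto intro!: lipschitz_onI simp: dist_real_def\<close>)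
qed (use feasibleD(2,6)[OF assms] in auto)

lemma cost_conjugate_le:
  assumes "feasible \<phi> \<psi>"
  shows "cost (conjugate \<psi>) \<psi> \<le> cost \<phi> \<psi>"
  unfolding cost_def
proof (intro add_right_mono integral_mono_AE)
  note adm = feasible_admissible[OF assms]
  show "integrable \<mu> (\<lambda>x. conjugate \<psi> (b x) (z x))" by (rule admissible_int[OF adm])
  show "integrable \<mu> (\<lambda>x. \<phi> (b x) (z x))" by (rule feasible_int[OF assms])
  show "AE x in \<mu>. conjugate \<psi> (b x) (z x) \<le> \<phi> (b x) (z x)"
    using z_in
  proof eventually_elim
    case (elim x)
    show ?case by (rule conjugate_props(5)[OF adm]) (use feasibleD(7)[OF assms] elim in auto)
  qed
qed

text \<open>
  Passing to the double conjugate makes both potentials Lipschitz; the normalisation \<open>\<psi> p 0 = 0\<close> is free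
  because the parameters have the same law, and makes them uniformly bounded.
\<close>
lemma improve_potentials:
  assumes adm: "admissible \<psi>"
  obtains \<phi>' \<psi>' where "feasible \<phi>' \<psi>'" "cost \<phi>' \<psi>' \<le> cost (conjugate \<psi>) \<psi>"
proof -
  let ?X = "cball (0::'e) R"
  obtain s :: "nat \<Rightarrow> 'e" where s: "range s \<subseteq> ?X" "?X \<subseteq> closure (range s)"
    using dense_sequence[of ?X] R_nonneg by auto
  have cl: "closure (range s) = ?X" using s closure_minimal[OF s(1)] by auto
  define \<phi> where "\<phi> = conjugate \<psi>"
  obtain B where B: "\<And>p w. w \<in> ?X \<Longrightarrow> \<bar>\<phi> p w\<bar> \<le> B"
    using conjugate_props(6)[OF adm] unfolding \<phi>_def by blast
  have k: "\<bar>\<phi> p a\<bar> \<le> B" if "a \<in> range s" for p a using B that s(1) by blast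
  have ne: "range s \<noteq> {}" by auto
  note leg = legendre_upper_closure[OF ne s(1) k] legendre_least[OF ne s(1) k]
    legendre_lipschitz[OF ne s(1) k] legendre_bound[OF ne s(1) k R_nonneg]
  \<comment> \<open>The second conjugate, again over a dense sequence for measurability; continuity
    of \<phi> extends the duality inequality to the whole ball.\<close>
  define \<xi> where "\<xi> p y = legendre (range s) (\<phi> p) y" for p y
  have \<phi>_m [measurable]: "case_prod \<phi> \<in> borel_measurable (borel \<Otimes>\<^sub>M borel)"
    unfolding \<phi>_def by (rule conjugate_props(1)[OF adm])
  have \<xi>_m [measurable]: "case_prod \<xi> \<in> borel_measurable (borel \<Otimes>\<^sub>M borel)"
    using legendre_measurable[OF _ ne s(1), of \<phi> B borel] k by (simp add: \<xi>_def[abs_def])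
  have \<phi>_lip: "\<bar>\<phi> p w - \<phi> p w'\<bar> \<le> R * dist w w'" for p w w'
    unfolding \<phi>_def by (rule conjugate_props(2)[OF adm])
  have \<phi>_cont: "continuous_on ?X (\<phi> p)" for p
    by (rule lipschitz_on_continuous_on[where L=R])
      (use \<phi>_lip R_nonneg in \<open>auto intro!: lipschitz_onI simp: dist_real_def\<close>)
  have \<xi>_lip: "\<bar>\<xi> p w - \<xi> p w'\<bar> \<le> R * dist w w'" for p w w'
    unfolding \<xi>_def dist_norm by (rule leg(3))
  have ineq: "y \<bullet> w \<le> \<phi> p w + \<xi> p y" if "w \<in> ?X" for p w y
  proof -
    have "w \<bullet> y - \<phi> p w \<le> \<xi> p y"
      unfolding \<xi>_def by (rule leg(1)) (use \<phi>_cont[of p] cl that in auto)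
    then show ?thesis by (simp add: inner_commute)
  qed
  have \<xi>_le: "\<xi> p y \<le> \<psi> p y" if "y \<in> Y" for p y
    unfolding \<xi>_def
  proof (rule leg(2))
    fix a assume "a \<in> range s"
    show "a \<bullet> y - \<phi> p a \<le> \<psi> p y"
      using conjugate_props(4)[OF adm that, of a p] by (simp add: \<phi>_def inner_commute)
  qed
  define c where "c p = \<xi> p 0" for p
  have cB: "\<bar>c p\<bar> \<le> B" for p
  proof -
    have "\<bar>c p\<bar> \<le> R * norm (0::'e) + B" unfolding c_def \<xi>_def by (rule leg(4))
    then show ?thesis by simp
  qed
  have c_m [measurable]: "c \<in> borel_measurable borel"
  proof -
    have "(\<lambda>p. case_prod \<xi> (p, 0)) \<in> borel_measurable borel" by measurable
    then show ?thesis by (simp add: c_def[abs_def])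
  qed
  define \<phi>' where "\<phi>' p w = \<phi> p w + c p" for p w
  define \<psi>' where "\<psi>' p y = \<xi> p y - c p" for p y
  have \<psi>'_bd: "\<bar>\<psi>' p y\<bar> \<le> R\<^sup>2" if "y \<in> Y" for p y
  proof -
    have "\<bar>\<psi>' p y\<bar> \<le> R * norm y" using \<xi>_lip[of p y 0] by (simp add: \<psi>'_def c_def)
    also have "\<dots> \<le> R * R" using that Y R_nonneg by (intro mult_left_mono) auto
    finally show ?thesis by (simp add: power2_eq_square)
  qed
  have ineq': "y \<bullet> w \<le> \<phi>' p w + \<psi>' p y" if "w \<in> ?X" for p w y
    using ineq[OF that] by (simp add: \<phi>'_def \<psi>'_def)
  \<comment> \<open>The lower bound is the duality inequality at y = 0, where \<open>\<psi>'\<close>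
    vanishes. The upper bound is the Lipschitz constant R times the diameter 2R of the ball.\<close>
  have \<phi>'_bd: "\<bar>\<phi>' p w\<bar> \<le> 2 * R\<^sup>2" if w: "w \<in> ?X" for p w
  proof -
    have "0 \<le> \<phi>' p w" using ineq'[OF w, of 0 p] by (simp add: \<psi>'_def c_def)
    moreover have "c p \<le> 2 * R\<^sup>2 - \<phi> p w"
      unfolding c_def \<xi>_def
    proof (rule leg(2))
      fix a assume "a \<in> range s"
      then have "dist w a \<le> 2 * R" using w s(1) norm_triangle_ineq4[of w a] by (force simp: dist_norm)
      then have "R * dist w a \<le> R * (2 * R)" using R_nonneg by (intro mult_left_mono) auto
      then show "a \<bullet> 0 - \<phi> p a \<le> 2 * R\<^sup>2 - \<phi> p w" using \<phi>_lip[of p w a] by (simp add: power2_eq_square)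
    qed
    ultimately show ?thesis by (simp add: \<phi>'_def)
  qed
  have feas: "feasible \<phi>' \<psi>'"
    unfolding feasible_def
  proof (intro conjI allI ballI)
    have "(\<lambda>x. case_prod \<phi> x + c (fst x)) \<in> borel_measurable (borel \<Otimes>\<^sub>M borel)" by measurable
    then show "case_prod \<phi>' \<in> borel_measurable (borel \<Otimes>\<^sub>M borel)"
      by (simp add: \<phi>'_def[abs_def] split_beta')
    have "(\<lambda>x. case_prod \<xi> x - c (fst x)) \<in> borel_measurable (borel \<Otimes>\<^sub>M borel)" by measurable
    then show "case_prod \<psi>' \<in> borel_measurable (borel \<Otimes>\<^sub>M borel)"
      by (simp add: \<psi>'_def[abs_def] split_beta')
    show "\<bar>\<psi>' p w\<bar> \<le> 2 * R\<^sup>2" if "w \<in> Y" for p w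
      using \<psi>'_bd[OF that, of p] by simp
  qed (use \<phi>_lip \<xi>_lip ineq' \<phi>'_bd in \<open>auto simp: \<phi>'_def \<psi>'_def\<close>)
  have ci1: "integrable \<mu> (\<lambda>x. c (b x))"
    by (rule M.integrable_const_bound[where B=B]) (use cB in auto)
  have ci2: "integrable \<nu> (\<lambda>x. c (b' x))"
    by (rule N.integrable_const_bound[where B=B]) (use cB in auto)
  have "(\<integral>x. c (b x) \<partial>\<mu>) = (\<integral>p. c p \<partial>distr \<mu> borel b)" by (simp add: integral_distr)
  also have "\<dots> = (\<integral>y. c (b' y) \<partial>\<nu>)" unfolding same_law by (simp add: integral_distr)
  finally have c_eq: "(\<integral>x. c (b x) \<partial>\<mu>) = (\<integral>y. c (b' y) \<partial>\<nu>)" .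
  have "(\<integral>x. \<phi>' (b x) (z x) \<partial>\<mu>) = (\<integral>x. \<phi> (b x) (z x) \<partial>\<mu>) + (\<integral>x. c (b x) \<partial>\<mu>)"
    unfolding \<phi>'_def using admissible_int(1)[OF adm] ci1 by (simp add: \<phi>_def)
  moreover have "(\<integral>y. \<psi>' (b' y) (z' y) \<partial>\<nu>) \<le> (\<integral>y. \<psi> (b' y) (z' y) - c (b' y) \<partial>\<nu>)"
    using feasible_int(2)[OF feas] admissible_int(2)[OF adm] ci2 z'_in \<xi>_le
    by (intro integral_mono_AE) (auto simp: \<psi>'_def)
  ultimately have "cost \<phi>' \<psi>' \<le> cost (conjugate \<psi>) \<psi>"
    unfolding cost_def \<phi>_def using admissible_int(2)[OF adm] ci2 c_eq by simp
  with feas show ?thesis by (rule that)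
qed

text \<open>The cost is affine, so midpoints of almost optimal feasible pairs are almost optimal.
  This is what \<open>nested_midpoint_convex_AE_convergent\<close> asks for.\<close>

lemma feasible_mid:
  assumes "feasible \<phi>1 \<psi>1" "feasible \<phi>2 \<psi>2"
  defines "\<phi> \<equiv> \<lambda>p w. (\<phi>1 p w + \<phi>2 p w) / 2" and "\<psi> \<equiv> \<lambda>p w. (\<psi>1 p w + \<psi>2 p w) / 2"
  shows "feasible \<phi> \<psi>" "cost \<phi> \<psi> = (cost \<phi>1 \<psi>1 + cost \<phi>2 \<psi>2) / 2"
proof -
  note f1 = feasibleD[OF assms(1)] note f2 = feasibleD[OF assms(2)]
  have mid: "\<bar>(x + y) / 2\<bar> \<le> c" if "\<bar>x\<bar> \<le> c" "\<bar>y\<bar> \<le> c" for x y c :: real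
    using that unfolding abs_le_iff by argo
  have lip: "\<bar>(x + y) / 2 - (x' + y') / 2\<bar> \<le> c" if "\<bar>x - x'\<bar> \<le> c" "\<bar>y - y'\<bar> \<le> c" for x y x' y' c :: real
    using that unfolding abs_le_iff by argo
  show "feasible \<phi> \<psi>"
    unfolding feasible_def
  proof (intro conjI allI ballI)
    note [measurable] = f1(1,2) f2(1,2)
    have "(\<lambda>x. (case_prod \<phi>1 x + case_prod \<phi>2 x) / 2) \<in> borel_measurable (borel \<Otimes>\<^sub>M borel)" by measurable
    then show "case_prod \<phi> \<in> borel_measurable (borel \<Otimes>\<^sub>M borel)"
      by (simp add: \<phi>_def[abs_def] split_beta')
    have "(\<lambda>x. (case_prod \<psi>1 x + case_prod \<psi>2 x) / 2) \<in> borel_measurable (borel \<Otimes>\<^sub>M borel)" by measurable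
    then show "case_prod \<psi> \<in> borel_measurable (borel \<Otimes>\<^sub>M borel)"
      by (simp add: \<psi>_def[abs_def] split_beta')
    show "y \<bullet> w \<le> \<phi> p w + \<psi> p y" if "w \<in> cball 0 R" "y \<in> Y" for p w y
      using f1(7)[OF that, of p] f2(7)[OF that, of p] unfolding \<phi>_def \<psi>_def by argo
  qed (unfold \<phi>_def \<psi>_def, (intro mid lip f1(3-6) f2(3-6); assumption)+)
  show "cost \<phi> \<psi> = (cost \<phi>1 \<psi>1 + cost \<phi>2 \<psi>2) / 2"
    unfolding cost_def \<phi>_def \<psi>_def
    using feasible_int[OF assms(1)] feasible_int[OF assms(2)] by (simp add: field_simps)
qed

lemma feasible_exists: "\<exists>\<phi> \<psi>. feasible \<phi> \<psi>"
proof -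
  have "feasible (\<lambda>p w. R\<^sup>2) (\<lambda>p y. 0)"
    unfolding feasible_def
  proof (intro conjI allI ballI)
    fix w y :: 'e assume wy: "w \<in> cball 0 R" "y \<in> Y"
    have "y \<bullet> w \<le> norm y * norm w" by (rule norm_cauchy_schwarz)
    also have "\<dots> \<le> R * R" using wy Y R_nonneg by (intro mult_mono) auto
    finally show "y \<bullet> w \<le> R\<^sup>2 + 0" by (simp add: power2_eq_square)
  qed (auto simp: R_nonneg)
  then show ?thesis by blast
qed

text \<open>The sets \<open>S n\<close> of pairs within 1/(n+1) of the infimum decrease and are
  midpoint convex. Selecting from them yields a minimising sequence that converges at a dense set of
  points for almost every parameter, hence everywhere on the ball and on \<open>Y\<close> by
  equicontinuity, and dominated convergence passes to the cost. Arbitrary admissible competitors are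
  compared after \<open>improve_potentials\<close>.\<close>

lemma minimizer_exists:
  obtains \<psi> where "admissible \<psi>" "\<And>\<psi>'. admissible \<psi>' \<Longrightarrow> cost (conjugate \<psi>) \<psi> \<le> cost (conjugate \<psi>') \<psi>'"
proof -
  let ?X = "cball (0::'e) R"
  obtain s :: "nat \<Rightarrow> 'e" where s: "range s \<subseteq> ?X" "?X \<subseteq> closure (range s)"
    using dense_sequence[of ?X] R_nonneg by auto
  define m where "m = Inf {cost \<phi> \<psi> | \<phi> \<psi>. feasible \<phi> \<psi>}"
  have bdd: "bdd_below {cost \<phi> \<psi> | \<phi> \<psi>. feasible \<phi> \<psi>}"
    by (rule bdd_belowI[of _ "- 4 * R\<^sup>2"]) (use cost_lower in auto)
  have m_le: "m \<le> cost \<phi> \<psi>" if "feasible \<phi> \<psi>" for \<phi> \<psi>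
    unfolding m_def by (rule cInf_lower[OF _ bdd]) (use that in blast)
  \<comment> \<open>Encodes a pair of potentials as one real function: even indices sample \<phi> on
    a dense sequence of the ball, odd indices sample \<psi> on one of \<open>Y\<close>. The encoding
    is affine, so midpoints are preserved.\<close>
  define Fn :: "('p \<Rightarrow> 'e \<Rightarrow> real) \<times> ('p \<Rightarrow> 'e \<Rightarrow> real) \<Rightarrow> nat \<times> 'p \<Rightarrow> real" where
    "Fn = (\<lambda>(\<phi>, \<psi>) (k, p). if even k then \<phi> p (s (k div 2)) else \<psi> p (dense_seq (k div 2)))"
  define S where "S n = {(\<phi>, \<psi>). feasible \<phi> \<psi> \<and> cost \<phi> \<psi> \<le> m + 1 / real (Suc n)}" for n
  \<comment> \<open>A probability on the indices that charges each of them: almost everywhere for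
    the product then means, for each index, almost every parameter.\<close>
  define P where "P = measure_pmf (geometric_pmf (1/2))"
  define Q where "Q = distr \<mu> borel b"
  interpret Q: prob_space Q unfolding Q_def by (rule M.prob_space_distr) simp
  interpret P: prob_space P unfolding P_def by (rule prob_space_measure_pmf)
  interpret PQ: pair_prob_space P Q ..
  have bnd: "\<bar>Fn c w\<bar> \<le> 2 * R\<^sup>2" if "c \<in> S n" for c w n
  proof -
    obtain \<phi> \<psi> k p where [simp]: "c = (\<phi>, \<psi>)" "w = (k, p)" by (metis surj_pair)
    have "feasible \<phi> \<psi>" using that by (simp add: S_def)
    moreover have "s (k div 2) \<in> ?X" "dense_seq (k div 2) \<in> Y" using s(1) dense_seq(1) by blast+
    ultimately show ?thesis using feasibleD(5,6) by (auto simp: Fn_def)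
  qed
  obtain F where F: "\<And>n. F n \<in> Fn ` S n" "AE w in P \<Otimes>\<^sub>M Q. convergent (\<lambda>n. F n w)"
  proof (rule nested_midpoint_convex_AE_convergent[of "P \<Otimes>\<^sub>M Q" "\<lambda>n. Fn ` S n" "2 * R\<^sup>2"])
    show "prob_space (P \<Otimes>\<^sub>M Q)" by (rule PQ.prob_space_axioms)
    show "Fn ` S n \<noteq> {}" for n
    proof -
      have "\<exists>x\<in>{cost \<phi> \<psi> | \<phi> \<psi>. feasible \<phi> \<psi>}. x < m + 1 / real (Suc n)"
      proof (rule cInf_lessD)
        show "{cost \<phi> \<psi> | \<phi> \<psi>. feasible \<phi> \<psi>} \<noteq> {}" using feasible_exists by blast
      qed (simp flip: m_def)
      then show ?thesis by (force simp: S_def)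
    qed
    have "S (Suc n) \<subseteq> S n" for n
    proof -
      have "1 / real (Suc (Suc n)) \<le> 1 / real (Suc n)" by (intro divide_left_mono) auto
      then show ?thesis by (auto simp: S_def)
    qed
    then show "Fn ` S (Suc n) \<subseteq> Fn ` S n" for n by blast
    show "\<bar>f w\<bar> \<le> 2 * R\<^sup>2" if "f \<in> Fn ` S 0" for f w using that bnd by blast
    show "f \<in> borel_measurable (P \<Otimes>\<^sub>M Q)" if fS: "f \<in> Fn ` S 0" for f
    proof -
      obtain \<phi> \<psi> where f: "f = Fn (\<phi>, \<psi>)" "feasible \<phi> \<psi>" using fS by (auto simp: S_def)
      note [measurable] = feasibleD(1,2)[OF f(2)]
      have 1: "(\<lambda>p. \<phi> p a) \<in> borel_measurable borel" "(\<lambda>p. \<psi> p a) \<in> borel_measurable borel" for a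
      proof -
        have "(\<lambda>p. case_prod \<phi> (p, a)) \<in> borel_measurable borel" by measurable
        then show "(\<lambda>p. \<phi> p a) \<in> borel_measurable borel" by simp
        have "(\<lambda>p. case_prod \<psi> (p, a)) \<in> borel_measurable borel" by measurable
        then show "(\<lambda>p. \<psi> p a) \<in> borel_measurable borel" by simp
      qed
      have "f \<in> borel_measurable (count_space UNIV \<Otimes>\<^sub>M (borel :: 'p measure))"
      proof (rule measurable_pair_measure_countable1)
        show "(\<lambda>y. f (x, y)) \<in> borel_measurable borel" for x
          using 1 by (cases "even x") (auto simp: f(1) Fn_def)
      qed simp
      also have "measurable (count_space UNIV \<Otimes>\<^sub>M (borel :: 'p measure)) (borel :: real measure)
          = measurable (P \<Otimes>\<^sub>M Q) borel"
        by (intro measurable_cong_sets sets_pair_measure_cong) (auto simp: P_def Q_def)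
      finally show ?thesis .
    qed
    show "(\<lambda>w. (f w + g w) / 2) \<in> Fn ` S n" if "f \<in> Fn ` S n" "g \<in> Fn ` S n" for f g n
    proof -
      obtain \<phi>1 \<psi>1 \<phi>2 \<psi>2 where f: "f = Fn (\<phi>1, \<psi>1)" "(\<phi>1, \<psi>1) \<in> S n"
        and g: "g = Fn (\<phi>2, \<psi>2)" "(\<phi>2, \<psi>2) \<in> S n" using \<open>f \<in> _\<close> \<open>g \<in> _\<close> by auto
      let ?\<phi> = "\<lambda>p w. (\<phi>1 p w + \<phi>2 p w) / 2" and ?\<psi> = "\<lambda>p w. (\<psi>1 p w + \<psi>2 p w) / 2"
      have "(?\<phi>, ?\<psi>) \<in> S n"
        using f(2) g(2) feasible_mid[of \<phi>1 \<psi>1 \<phi>2 \<psi>2] by (auto simp: S_def)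
      moreover have "(\<lambda>w. (f w + g w) / 2) = Fn (?\<phi>, ?\<psi>)"
        by (auto simp: f g Fn_def fun_eq_iff)
      ultimately show ?thesis by blast
    qed
  qed (blast intro: that)
  have "\<exists>c. c \<in> S n \<and> F n = Fn c" for n using F(1)[of n] by blast
  then obtain c where c: "\<And>n. c n \<in> S n" "\<And>n. F n = Fn (c n)" by metis
  define \<phi>s where "\<phi>s n = fst (c n)" for n
  define \<psi>s where "\<psi>s n = snd (c n)" for n
  have feas: "feasible (\<phi>s n) (\<psi>s n)" and cst: "cost (\<phi>s n) (\<psi>s n) \<le> m + 1 / real (Suc n)" for n
    using c(1)[of n] by (auto simp: S_def \<phi>s_def \<psi>s_def split_beta)
  note fs = feasibleD[OF feas]
  define good where "good = {p. \<forall>k. convergent (\<lambda>n. \<phi>s n p (s k)) \<and> convergent (\<lambda>n. \<psi>s n p (dense_seq k))}"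
  have m1 [measurable]: "(\<lambda>p. \<phi>s n p a) \<in> borel_measurable borel" "(\<lambda>p. \<psi>s n p a) \<in> borel_measurable borel" for n a
  proof -
    note [measurable] = fs(1,2)[of n]
    have "(\<lambda>p. case_prod (\<phi>s n) (p, a)) \<in> borel_measurable borel" by measurable
    then show "(\<lambda>p. \<phi>s n p a) \<in> borel_measurable borel" by simp
    have "(\<lambda>p. case_prod (\<psi>s n) (p, a)) \<in> borel_measurable borel" by measurable
    then show "(\<lambda>p. \<psi>s n p a) \<in> borel_measurable borel" by simp
  qed
  have good_m [measurable]: "good \<in> sets borel"
  proof -
    have "{p \<in> space borel. \<forall>k. Cauchy (\<lambda>n. \<phi>s n p (s k)) \<and> Cauchy (\<lambda>n. \<psi>s n p (dense_seq k))} \<in> sets borel"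
      by measurable
    then show ?thesis by (simp add: good_def Cauchy_convergent_iff)
  qed
  have Fk: "F n (2 * k, p) = \<phi>s n p (s k)" "F n (2 * k + 1, p) = \<psi>s n p (dense_seq k)" for n k p
    by (simp_all add: c(2) Fn_def \<phi>s_def \<psi>s_def split_beta)
  have "AE k in P. AE p in Q. convergent (\<lambda>n. F n (k, p))"
    using PQ.AE_pair[OF F(2)] .
  then have *: "AE p in Q. convergent (\<lambda>n. F n (k, p))" for k
    unfolding P_def AE_measure_pmf_iff by (simp add: set_pmf_geometric)
  have "AE p in Q. \<forall>k. convergent (\<lambda>n. F n (2 * k, p)) \<and> convergent (\<lambda>n. F n (2 * k + 1, p))"
    unfolding AE_all_countable using *  by (intro allI AE_conjI) auto
  then have AE_good: "AE p in Q. p \<in> good" unfolding Fk good_def by simp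
  have good1: "AE x in \<mu>. b x \<in> good"
    using AE_good unfolding Q_def by (subst (asm) AE_distr_iff) auto
  have good2: "AE y in \<nu>. b' y \<in> good"
    using AE_good unfolding Q_def same_law by (subst (asm) AE_distr_iff) auto
  \<comment> \<open>On the exceptional parameters the first pair of the sequence is kept, so that
    feasibility holds for every parameter.\<close>
  define \<phi> where "\<phi> p w = (if p \<in> good then lim (\<lambda>n. \<phi>s n p w) else \<phi>s 0 p w)" for p w
  define \<psi> where "\<psi> p w = (if p \<in> good then lim (\<lambda>n. \<psi>s n p w) else \<psi>s 0 p w)" for p w
  have lim1: "(\<lambda>n. \<phi>s n p w) \<longlonglongrightarrow> \<phi> p w" if "p \<in> good" "w \<in> ?X" for p w
  proof -
    have "convergent (\<lambda>n. \<phi>s n p w)"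
      by (rule equilipschitz_convergent[of ?X _ R "range s"]) (use s that fs(3) R_nonneg in \<open>auto simp: good_def\<close>)
    then show ?thesis using that by (simp add: \<phi>_def convergent_LIMSEQ_iff)
  qed
  have lim2: "(\<lambda>n. \<psi>s n p w) \<longlonglongrightarrow> \<psi> p w" if "p \<in> good" "w \<in> Y" for p w
  proof -
    have "convergent (\<lambda>n. \<psi>s n p w)"
      by (rule equilipschitz_convergent[of Y _ R "range dense_seq"]) (use dense_seq that fs(4) R_nonneg in \<open>auto simp: good_def\<close>)
    then show ?thesis using that by (simp add: \<psi>_def convergent_LIMSEQ_iff)
  qed
  have feas_lim: "feasible \<phi> \<psi>"
    unfolding feasible_def
  proof (intro conjI allI ballI)
    note [measurable] = fs(1,2)
    have "(\<lambda>x. if fst x \<in> good then lim (\<lambda>n. case_prod (\<phi>s n) x) else case_prod (\<phi>s 0) x)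
        \<in> borel_measurable (borel \<Otimes>\<^sub>M borel)" by measurable
    then show "case_prod \<phi> \<in> borel_measurable (borel \<Otimes>\<^sub>M borel)" by (simp add: \<phi>_def[abs_def] split_beta')
    have "(\<lambda>x. if fst x \<in> good then lim (\<lambda>n. case_prod (\<psi>s n) x) else case_prod (\<psi>s 0) x)
        \<in> borel_measurable (borel \<Otimes>\<^sub>M borel)" by measurable
    then show "case_prod \<psi> \<in> borel_measurable (borel \<Otimes>\<^sub>M borel)" by (simp add: \<psi>_def[abs_def] split_beta')
  next
    fix p w w' assume w: "w \<in> ?X" "w' \<in> ?X"
    show "\<bar>\<phi> p w - \<phi> p w'\<bar> \<le> R * dist w w'"
    proof (cases "p \<in> good")
      case True
      show ?thesis
        by (rule tendsto_upperbound[OF tendsto_rabs[OF tendsto_diff[OF lim1 lim1]]]) (use True w fs(3) in auto)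
    qed (use fs(3) w in \<open>auto simp: \<phi>_def\<close>)
  next
    fix p w w' assume w: "w \<in> Y" "w' \<in> Y"
    show "\<bar>\<psi> p w - \<psi> p w'\<bar> \<le> R * dist w w'"
    proof (cases "p \<in> good")
      case True
      show ?thesis
        by (rule tendsto_upperbound[OF tendsto_rabs[OF tendsto_diff[OF lim2 lim2]]]) (use True w fs(4) in auto)
    qed (use fs(4) w in \<open>auto simp: \<psi>_def\<close>)
  next
    fix p w assume w: "w \<in> ?X"
    show "\<bar>\<phi> p w\<bar> \<le> 2 * R\<^sup>2"
    proof (cases "p \<in> good")
      case True
      show ?thesis
        by (rule tendsto_upperbound[OF tendsto_rabs[OF lim1]]) (use True w fs(5) in auto)
    qed (use fs(5) w in \<open>auto simp: \<phi>_def\<close>)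
  next
    fix p w assume w: "w \<in> Y"
    show "\<bar>\<psi> p w\<bar> \<le> 2 * R\<^sup>2"
    proof (cases "p \<in> good")
      case True
      show ?thesis
        by (rule tendsto_upperbound[OF tendsto_rabs[OF lim2]]) (use True w fs(6) in auto)
    qed (use fs(6) w in \<open>auto simp: \<psi>_def\<close>)
  next
    fix p w y assume w: "w \<in> ?X" "y \<in> Y"
    show "y \<bullet> w \<le> \<phi> p w + \<psi> p y"
    proof (cases "p \<in> good")
      case True
      show ?thesis
        by (rule tendsto_lowerbound[OF tendsto_add[OF lim1 lim2]]) (use True w fs(7) in auto)
    qed (use fs(7) w in \<open>auto simp: \<phi>_def \<psi>_def\<close>)
  qed
  have i1: "(\<lambda>n. \<integral>x. \<phi>s n (b x) (z x) \<partial>\<mu>) \<longlonglongrightarrow> (\<integral>x. \<phi> (b x) (z x) \<partial>\<mu>)"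
  proof (rule integral_dominated_convergence[where w="\<lambda>_. 2 * R\<^sup>2"])
    show "AE x in \<mu>. (\<lambda>n. \<phi>s n (b x) (z x)) \<longlonglongrightarrow> \<phi> (b x) (z x)"
      using good1 z_in by eventually_elim (rule lim1)
    show "AE x in \<mu>. norm (\<phi>s n (b x) (z x)) \<le> 2 * R\<^sup>2" for n
      using z_in by eventually_elim (use fs(5) in auto)
  qed (use meas_comp1 fs(1) feasibleD(1)[OF feas_lim] in auto)
  have i2: "(\<lambda>n. \<integral>x. \<psi>s n (b' x) (z' x) \<partial>\<nu>) \<longlonglongrightarrow> (\<integral>x. \<psi> (b' x) (z' x) \<partial>\<nu>)"
  proof (rule integral_dominated_convergence[where w="\<lambda>_. 2 * R\<^sup>2"])
    show "AE x in \<nu>. (\<lambda>n. \<psi>s n (b' x) (z' x)) \<longlonglongrightarrow> \<psi> (b' x) (z' x)"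
      using good2 z'_in by eventually_elim (rule lim2)
    show "AE x in \<nu>. norm (\<psi>s n (b' x) (z' x)) \<le> 2 * R\<^sup>2" for n
      using z'_in by eventually_elim (use fs(6) in auto)
  qed (use meas_comp2 fs(2) feasibleD(2)[OF feas_lim] in auto)
  have c_lim: "(\<lambda>n. cost (\<phi>s n) (\<psi>s n)) \<longlonglongrightarrow> cost \<phi> \<psi>"
    unfolding cost_def by (rule tendsto_add[OF i1 i2])
  have "(\<lambda>n. m + 1 / real (Suc n)) \<longlonglongrightarrow> m + 0"
    by (intro tendsto_intros LIMSEQ_Suc[OF lim_1_over_n])
  from LIMSEQ_le[OF c_lim this] cst have le_m: "cost \<phi> \<psi> \<le> m" by simp
  show ?thesis
  proof (rule that)
    show "admissible \<psi>" by (rule feasible_admissible[OF feas_lim])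
    fix \<psi>' assume "admissible \<psi>'"
    then obtain \<phi>1 \<psi>1 where 1: "feasible \<phi>1 \<psi>1" "cost \<phi>1 \<psi>1 \<le> cost (conjugate \<psi>') \<psi>'" by (rule improve_potentials)
    have "cost (conjugate \<psi>) \<psi> \<le> cost \<phi> \<psi>" by (rule cost_conjugate_le[OF feas_lim])
    also note le_m
    also have "m \<le> cost \<phi>1 \<psi>1" by (rule m_le[OF 1(1)])
    also note 1(2)
    finally show "cost (conjugate \<psi>) \<psi> \<le> cost (conjugate \<psi>') \<psi>'" .
  qed
qed

end

section \<open>The first variation of the dual problem\<close>

text \<open>The ramp functions decrease to the indicator of the closed set \<open>F\<close>, and the
  closed sets are an intersection-stable generator. The ramps are continuous, hence admissible as
  test functions in the first variation.\<close>

lemma measure_eqI_infdist: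
  fixes M N :: "'a::metric_space measure"
  assumes "prob_space M" "prob_space N" and sets: "sets M = sets borel" "sets N = sets borel"
    and eq: "\<And>F n. closed F \<Longrightarrow> F \<noteq> {} \<Longrightarrow>
      (\<integral>x. max 0 (1 - real n * infdist x F) \<partial>M) = (\<integral>x. max 0 (1 - real n * infdist x F) \<partial>N)"
  shows "M = N"
proof -
  interpret M: prob_space M by fact
  interpret N: prob_space N by fact
  have spc: "space M = UNIV" "space N = UNIV"
    using sets_eq_imp_space_eq[OF sets(1)] sets_eq_imp_space_eq[OF sets(2)] by auto
  have lim: "(\<lambda>n. \<integral>x. max 0 (1 - real n * infdist x F) \<partial>K) \<longlonglongrightarrow> measure K F"
    if F: "closed F" "F \<noteq> {}" and K: "prob_space K" "sets K = sets borel" for K and F :: "'a set"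
  proof -
    interpret K: prob_space K by fact
    have Fm: "F \<in> sets K" using F K(2) by simp
    have fm: "f \<in> borel_measurable K" if "f \<in> borel_measurable borel" for f :: "'a \<Rightarrow> real"
      using that K(2) by (simp cong: measurable_cong_sets)
    have "(\<lambda>n. \<integral>x. max 0 (1 - real n * infdist x F) \<partial>K) \<longlonglongrightarrow> (\<integral>x. indicator F x \<partial>K)"
    proof (rule integral_dominated_convergence[where w="\<lambda>_. 1"])
      show "(\<lambda>x. max 0 (1 - real n * infdist x F)) \<in> borel_measurable K" for n
        by (intro fm borel_measurable_continuous_onI continuous_intros)
      show "indicator F \<in> borel_measurable K" using Fm by simp
      show "AE x in K. norm (max 0 (1 - real n * infdist x F)) \<le> 1" for n
        using infdist_nonneg[of _ F] by (auto simp: max_def intro!: AE_I2)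
      show "AE x in K. (\<lambda>n. max 0 (1 - real n * infdist x F)) \<longlonglongrightarrow> indicator F x"
      proof (rule AE_I2)
        fix x
        show "(\<lambda>n. max 0 (1 - real n * infdist x F)) \<longlonglongrightarrow> indicator F x"
        proof (cases "x \<in> F")
          case True
          then show ?thesis by simp
        next
          case False
          then have d: "infdist x F > 0" using infdist_pos_not_in_closed F by blast
          obtain n0 where n0: "1 / infdist x F < real n0" using reals_Archimedean2 by blast
          have "eventually (\<lambda>n. 0 = max 0 (1 - real n * infdist x F)) sequentially"
            using eventually_ge_at_top[of n0]
          proof eventually_elim
            case (elim n)
            then have "1 / infdist x F < real n" using n0 by linarith
            then have "1 < real n * infdist x F" using d by (simp add: field_simps)
            then show ?case by simp
          qed
          then show ?thesis using False by (simp add: Lim_transform_eventually[OF tendsto_const])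
        qed
      qed
    qed simp
    then show ?thesis using Fm by (simp add: K.emeasure_eq_measure)
  qed
  show ?thesis
  proof (rule measure_eqI_generator_eq[where E="Collect closed" and \<Omega>=UNIV and A="\<lambda>_. UNIV"])
    show "Int_stable (Collect closed)" by (auto simp: Int_stable_def)
    show "sets M = sigma_sets UNIV (Collect closed)" "sets N = sigma_sets UNIV (Collect closed)"
      unfolding sets by (auto simp: borel_eq_closed)
    show "emeasure M F = emeasure N F" if "F \<in> Collect closed" for F
    proof (cases "F = {}")
      case False
      have "measure M F = measure N F"
        using LIMSEQ_unique[OF lim[OF _ False assms(1) sets(1)]] lim[OF _ False assms(2) sets(2)] that
        by (simp add: eq False)
      then show ?thesis by (simp add: M.emeasure_eq_measure N.emeasure_eq_measure)
    qed simp
  qed auto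
qed

text \<open>
  A version of the gradient that is visibly measurable; \<open>lim\<close> is an arbitrary value where the difference
  quotients do not converge.
\<close>
definition quot_grad :: "('e::euclidean_space \<Rightarrow> real) \<Rightarrow> 'e \<Rightarrow> 'e" where
  "quot_grad f w = (\<Sum>e\<in>Basis. lim (\<lambda>n. real (Suc n) * (f (w + (1 / real (Suc n)) *\<^sub>R e) - f w)) *\<^sub>R e)"

lemma quot_grad_eq:
  assumes "(f has_derivative (\<lambda>v. u \<bullet> v)) (at w)"
  shows "quot_grad f w = u"
proof -
  have "lim (\<lambda>n. real (Suc n) * (f (w + (1 / real (Suc n)) *\<^sub>R e) - f w)) = u \<bullet> e" for e
  proof (rule limI)
    have "((\<lambda>t::real. w + t *\<^sub>R e) has_derivative (\<lambda>t. t *\<^sub>R e)) (at 0)"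
      by (auto intro!: derivative_eq_intros)
    moreover have "(f has_derivative (\<lambda>v. u \<bullet> v)) (at (w + 0 *\<^sub>R e))" using assms by simp
    ultimately have "((\<lambda>t. f (w + t *\<^sub>R e)) has_derivative (\<lambda>t. u \<bullet> (t *\<^sub>R e))) (at 0)"
      by (rule has_derivative_compose)
    then have "((\<lambda>t. f (w + t *\<^sub>R e)) has_field_derivative (u \<bullet> e)) (at 0)"
      by (simp add: has_field_derivative_def mult.commute[of _ "u \<bullet> e"])
    then have "((\<lambda>h. (f (w + h *\<^sub>R e) - f w) / h) \<longlongrightarrow> u \<bullet> e) (at 0)"
      by (simp add: DERIV_def)
    moreover have "filterlim (\<lambda>n. 1 / real (Suc n)) (at 0) sequentially"
      unfolding filterlim_at by (intro conjI LIMSEQ_Suc[OF lim_1_over_n]) auto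
    ultimately have "(\<lambda>n. (f (w + (1 / real (Suc n)) *\<^sub>R e) - f w) / (1 / real (Suc n))) \<longlonglongrightarrow> u \<bullet> e"
      by (rule filterlim_compose)
    then show "(\<lambda>n. real (Suc n) * (f (w + (1 / real (Suc n)) *\<^sub>R e) - f w)) \<longlonglongrightarrow> u \<bullet> e"
      by (simp add: mult.commute)
  qed
  then show ?thesis by (simp add: quot_grad_def euclidean_representation)
qed

lemma differentiable_quot_grad:
  fixes f :: "'e::euclidean_space \<Rightarrow> real"
  assumes "f differentiable (at w)"
  shows "(f has_derivative (\<lambda>v. quot_grad f w \<bullet> v)) (at w)"
proof -
  obtain f' where f': "(f has_derivative f') (at w)" using assms by (auto simp: differentiable_def)
  then have l: "linear f'" by (rule has_derivative_linear)
  have "f' = (\<lambda>v. (\<Sum>e\<in>Basis. f' e *\<^sub>R e) \<bullet> v)"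
  proof
    fix v
    have "f' v = f' (\<Sum>e\<in>Basis. (v \<bullet> e) *\<^sub>R e)" by (simp add: euclidean_representation)
    also have "\<dots> = (\<Sum>e\<in>Basis. (v \<bullet> e) * f' e)"
      by (simp add: linear_sum[OF l] linear_scale[OF l])
    also have "\<dots> = (\<Sum>e\<in>Basis. f' e *\<^sub>R e) \<bullet> v"
      unfolding inner_sum_left inner_scaleR_left by (simp add: inner_commute mult.commute)
    finally show "f' v = (\<Sum>e\<in>Basis. f' e *\<^sub>R e) \<bullet> v" .
  qed
  with f' obtain u where "(f has_derivative (\<lambda>v. u \<bullet> v)) (at w)" by metis
  with quot_grad_eq[OF this] show ?thesis by simp
qed

lemma quot_grad_measurable:
  fixes f :: "'p \<Rightarrow> 'e::euclidean_space \<Rightarrow> real"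
  assumes "case_prod f \<in> borel_measurable (N \<Otimes>\<^sub>M borel)"
  shows "(\<lambda>(p, w). quot_grad (f p) w) \<in> borel_measurable (N \<Otimes>\<^sub>M borel)"
proof -
  have [measurable]: "(\<lambda>x. f (fst x) (snd x + v)) \<in> borel_measurable (N \<Otimes>\<^sub>M borel)" for v
  proof -
    have "(\<lambda>x. case_prod f (fst x, snd x + v)) \<in> borel_measurable (N \<Otimes>\<^sub>M borel)"
      by (rule measurable_compose[OF _ assms]) measurable
    then show ?thesis by simp
  qed
  have [measurable]: "(\<lambda>x. f (fst x) (snd x)) \<in> borel_measurable (N \<Otimes>\<^sub>M borel)"
    using assms by (simp add: split_beta')
  have "(\<lambda>x. quot_grad (f (fst x)) (snd x)) \<in> borel_measurable (N \<Otimes>\<^sub>M borel)"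
    unfolding quot_grad_def by measurable
  then show ?thesis by (simp add: split_beta')
qed

section \<open>The envelope theorem for the conjugate and stationarity of the dual cost\<close>

context dual_problem
begin

lemma conjugate_attained:
  assumes "admissible \<psi>"
  obtains y where "y \<in> Y" "conjugate \<psi> p w = y \<bullet> w - \<psi> p y"
proof -
  have "continuous_on Y (\<lambda>y. y \<bullet> w - \<psi> p y)"
    by (intro continuous_intros admissibleD(2)[OF assms])
  then obtain y where y: "y \<in> Y" "\<And>y'. y' \<in> Y \<Longrightarrow> y' \<bullet> w - \<psi> p y' \<le> y \<bullet> w - \<psi> p y"
    using continuous_attains_sup[OF Y(1)] Y(2) by blast
  have "conjugate \<psi> p w \<le> y \<bullet> w - \<psi> p y"
    by (rule conjugate_props(5)[OF assms]) (use y(2) in force)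
  moreover have "y \<bullet> w - \<psi> p y \<le> conjugate \<psi> p w"
    using conjugate_props(4)[OF assms y(1), of w p] by simp
  ultimately show ?thesis using y(1) by (intro that) auto
qed

text \<open>A maximiser \<open>y\<close> is a subgradient: subtracting the linear function it
  defines leaves a function with a minimum at \<open>w\<close>, whose derivative must
  vanish.\<close>

lemma conjugate_gradient:
  assumes adm: "admissible \<psi>" and d: "(conjugate \<psi> p has_derivative (\<lambda>v. u \<bullet> v)) (at w)"
    and y: "y \<in> Y" "conjugate \<psi> p w = y \<bullet> w - \<psi> p y"
  shows "y = u"
proof -
  let ?h = "\<lambda>w'. conjugate \<psi> p w' - y \<bullet> w'"
  have "(?h has_derivative (\<lambda>v. u \<bullet> v - y \<bullet> v)) (at w)"
    by (intro derivative_intros d)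
  moreover have "?h w \<le> ?h w'" for w'
    using conjugate_props(4)[OF adm y(1), of w' p] y(2) by simp
  ultimately have "(\<lambda>v. u \<bullet> v - y \<bullet> v) = (\<lambda>v. 0)"
    by (intro differential_zero_maxmin[of w UNIV ?h]) auto
  then have "(u - y) \<bullet> (u - y) = 0" by (metis inner_diff_left)
  then show ?thesis by simp
qed

text \<open>Differentiability makes the maximiser unique, and the strict inequality for all other
  points is what the envelope theorem below needs.\<close>

lemma conjugate_gradient_unique:
  assumes adm: "admissible \<psi>" and d: "(conjugate \<psi> p has_derivative (\<lambda>v. u \<bullet> v)) (at w)"
  shows "u \<in> Y" "conjugate \<psi> p w = u \<bullet> w - \<psi> p u"
    "y \<in> Y \<Longrightarrow> y \<noteq> u \<Longrightarrow> y \<bullet> w - \<psi> p y < conjugate \<psi> p w"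
proof -
  obtain y where y: "y \<in> Y" "conjugate \<psi> p w = y \<bullet> w - \<psi> p y" using conjugate_attained[OF adm] by blast
  have "y = u" by (rule conjugate_gradient[OF adm d y])
  with y show "u \<in> Y" "conjugate \<psi> p w = u \<bullet> w - \<psi> p u" by auto
  show "y \<bullet> w - \<psi> p y < conjugate \<psi> p w" if "y \<in> Y" "y \<noteq> u" for y
    using conjugate_props(4)[OF adm that(1), of w p] conjugate_gradient[OF adm d that(1)] that(2) by force
qed

lemma admissible_perturb:
  assumes "admissible \<psi>" "admissible \<eta>"
  shows "admissible (\<lambda>p y. \<psi> p y + t * \<eta> p y)"
proof -
  obtain B where B: "\<And>p y. y \<in> Y \<Longrightarrow> \<bar>\<psi> p y\<bar> \<le> B" using assms(1) unfolding admissible_def by blast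
  obtain C where C: "\<And>p y. y \<in> Y \<Longrightarrow> \<bar>\<eta> p y\<bar> \<le> C" using assms(2) unfolding admissible_def by blast
  show ?thesis
    unfolding admissible_def
  proof (intro conjI allI)
    note [measurable] = admissibleD(1)[OF assms(1)] admissibleD(1)[OF assms(2)]
    have "(\<lambda>x. case_prod \<psi> x + t * case_prod \<eta> x) \<in> borel_measurable (borel \<Otimes>\<^sub>M borel)" by measurable
    then show "(\<lambda>(p, y). \<psi> p y + t * \<eta> p y) \<in> borel_measurable (borel \<Otimes>\<^sub>M borel)"
      by (simp add: split_beta')
    have "\<bar>\<psi> p y + t * \<eta> p y\<bar> \<le> B + \<bar>t\<bar> * C" if "y \<in> Y" for p y
    proof -
      have "\<bar>t * \<eta> p y\<bar> \<le> \<bar>t\<bar> * C" unfolding abs_mult using C[OF that] by (intro mult_left_mono) auto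
      then show ?thesis using B[OF that, of p] by linarith
    qed
    then show "\<exists>B. \<forall>p. \<forall>y\<in>Y. \<bar>\<psi> p y + t * \<eta> p y\<bar> \<le> B" by blast
    show "continuous_on Y (\<lambda>y. \<psi> p y + t * \<eta> p y)" for p
      by (intro continuous_intros admissibleD(2) assms)
  qed
qed

text \<open>Conjugation does not increase the supremum distance. This bounds the difference
  quotients and supplies the dominating constant in the first variation.\<close>

lemma conjugate_perturb_bound:
  assumes adm: "admissible \<psi>" "admissible \<eta>" and C: "\<And>p y. y \<in> Y \<Longrightarrow> \<bar>\<eta> p y\<bar> \<le> C" and t: "0 \<le> t"
  shows "\<bar>conjugate (\<lambda>p y. \<psi> p y + t * \<eta> p y) p w - conjugate \<psi> p w\<bar> \<le> t * C"
proof -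
  let ?\<psi>' = "\<lambda>p y. \<psi> p y + t * \<eta> p y"
  note adm' = admissible_perturb[OF adm, of t]
  have tC: "\<bar>t * \<eta> p y\<bar> \<le> t * C" if "y \<in> Y" for y
    unfolding abs_mult using C[OF that] t by (simp add: mult_left_mono)
  have "conjugate ?\<psi>' p w \<le> conjugate \<psi> p w + t * C"
  proof (rule conjugate_props(5)[OF adm'])
    fix y assume y: "y \<in> Y"
    show "y \<bullet> w \<le> conjugate \<psi> p w + t * C + (\<psi> p y + t * \<eta> p y)"
      using conjugate_props(4)[OF adm(1) y, of w p] tC[OF y] by linarith
  qed
  moreover have "conjugate \<psi> p w \<le> conjugate ?\<psi>' p w + t * C"
  proof (rule conjugate_props(5)[OF adm(1)])
    fix y assume y: "y \<in> Y"
    show "y \<bullet> w \<le> conjugate ?\<psi>' p w + t * C + \<psi> p y"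
      using conjugate_props(4)[OF adm' y, of w p] tC[OF y] by linarith
  qed
  ultimately show ?thesis by simp
qed

text \<open>Danskin's theorem: the derivative of a supremum with a unique maximiser \<open>u\<close>
  is the derivative of the term at \<open>u\<close>. The point \<open>u\<close> itself gives the
  lower bound. For the upper bound, points where the perturbation is noticeably more favourable than
  at \<open>u\<close> start out with a strict deficit.\<close>

lemma conjugate_perturb_derivative:
  assumes adm: "admissible \<psi>" "admissible \<eta>" and d: "(conjugate \<psi> p has_derivative (\<lambda>v. u \<bullet> v)) (at w)"
  shows "(\<lambda>n. real (Suc n) * (conjugate (\<lambda>p y. \<psi> p y + 1 / real (Suc n) * \<eta> p y) p w - conjugate \<psi> p w)) \<longlonglongrightarrow> - \<eta> p u"
proof -
  obtain C where C: "\<And>p y. y \<in> Y \<Longrightarrow> \<bar>\<eta> p y\<bar> \<le> C" using adm(2) unfolding admissible_def by blast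
  note u = conjugate_gradient_unique[OF adm(1) d]
  let ?q = "\<lambda>t. conjugate (\<lambda>p y. \<psi> p y + t * \<eta> p y) p w"
  have lower: "- t * \<eta> p u \<le> ?q t - conjugate \<psi> p w" for t
    using conjugate_props(4)[OF admissible_perturb[OF adm, of t] u(1), of w p] u(2) by simp
  have upper: "\<exists>t0>0. \<forall>t. 0 < t \<longrightarrow> t < t0 \<longrightarrow> ?q t - conjugate \<psi> p w \<le> t * (\<epsilon> - \<eta> p u)" if \<epsilon>: "\<epsilon> > 0" for \<epsilon>
  proof -
    \<comment> \<open>The points where \<eta> is smaller than at \<open>u\<close> by at least
      \<epsilon>. This set is compact and omits \<open>u\<close>, so its deficit has a positive
      lower bound \<delta>; outside it the claimed rate holds directly.\<close>
    define U where "U = {y \<in> Y. \<eta> p y \<le> \<eta> p u - \<epsilon>}"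
    have "\<exists>\<delta>>0. \<forall>y\<in>U. y \<bullet> w - \<psi> p y \<le> conjugate \<psi> p w - \<delta>"
    proof (cases "U = {}")
      case False
      have "closed (Y \<inter> \<eta> p -` {..\<eta> p u - \<epsilon>})"
        by (rule continuous_closed_preimage[OF admissibleD(2)[OF adm(2)] compact_imp_closed[OF Y(1)]]) simp
      then have "compact (Y \<inter> (Y \<inter> \<eta> p -` {..\<eta> p u - \<epsilon>}))" by (rule compact_Int_closed[OF Y(1)])
      moreover have "Y \<inter> (Y \<inter> \<eta> p -` {..\<eta> p u - \<epsilon>}) = U" by (auto simp: U_def)
      ultimately have cU: "compact U" by simp
      have cont: "continuous_on U (\<lambda>y. y \<bullet> w - \<psi> p y)"
        by (intro continuous_intros continuous_on_subset[OF admissibleD(2)[OF adm(1)]]) (auto simp: U_def)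
      from continuous_attains_sup[OF cU False cont]
      obtain y1 where y1: "y1 \<in> U" "\<And>y. y \<in> U \<Longrightarrow> y \<bullet> w - \<psi> p y \<le> y1 \<bullet> w - \<psi> p y1"
        by auto
      have "y1 \<noteq> u" "y1 \<in> Y" using y1(1) \<epsilon> by (auto simp: U_def)
      then have "y1 \<bullet> w - \<psi> p y1 < conjugate \<psi> p w" using u(3) by blast
      then show ?thesis using y1(2)
        by (intro exI[of _ "conjugate \<psi> p w - (y1 \<bullet> w - \<psi> p y1)"]) force
    qed (auto intro: exI[of _ 1])
    then obtain \<delta> where \<delta>: "\<delta> > 0" "\<And>y. y \<in> U \<Longrightarrow> y \<bullet> w - \<psi> p y \<le> conjugate \<psi> p w - \<delta>" by blast
    have C0: "0 \<le> C" using C[OF u(1), of p] by linarith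
    show ?thesis
    \<comment> \<open>Two values of \<eta> differ by at most 2C, so for t * 2C < \<delta> no point
      of \<open>U\<close> can make up its deficit; the added 1 covers C = 0.\<close>
    proof (intro exI[of _ "\<delta> / (2 * C + 1)"] conjI allI impI)
      show "\<delta> / (2 * C + 1) > 0" using \<delta> C0 by simp
      fix t assume t: "0 < t" "t < \<delta> / (2 * C + 1)"
      then have tC: "t * (2 * C) < \<delta>" using C0 by (simp add: field_simps)
      have "?q t \<le> conjugate \<psi> p w + t * (\<epsilon> - \<eta> p u)"
      proof (rule conjugate_props(5)[OF admissible_perturb[OF adm]])
        fix y assume y: "y \<in> Y"
        show "y \<bullet> w \<le> conjugate \<psi> p w + t * (\<epsilon> - \<eta> p u) + (\<psi> p y + t * \<eta> p y)"
        proof (cases "y \<in> U")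
          case True
          have "\<eta> p u - \<epsilon> - \<eta> p y \<le> 2 * C" using C[OF y, of p] C[OF u(1), of p] \<epsilon> by linarith
          then have "t * (\<eta> p u - \<epsilon> - \<eta> p y) \<le> t * (2 * C)" using t by (intro mult_left_mono) auto
          with \<delta>(2)[OF True] tC show ?thesis by (simp add: algebra_simps)
        next
          case False
          then have "0 \<le> \<epsilon> - \<eta> p u + \<eta> p y" using y by (auto simp: U_def)
          then have "0 \<le> t * (\<epsilon> - \<eta> p u + \<eta> p y)" using t by simp
          with conjugate_props(4)[OF adm(1) y, of w p] show ?thesis by (simp add: algebra_simps)
        qed
      qed
      then show "?q t - conjugate \<psi> p w \<le> t * (\<epsilon> - \<eta> p u)" by simp
    qed
  qed
  show ?thesis
  proof (rule LIMSEQ_I)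
    fix r :: real assume r: "r > 0"
    obtain t0 where t0: "t0 > 0" "\<And>t. 0 < t \<Longrightarrow> t < t0 \<Longrightarrow> ?q t - conjugate \<psi> p w \<le> t * (r / 2 - \<eta> p u)"
      using upper[of "r / 2"] r by auto
    obtain N where N: "1 / real (Suc N) < t0" using t0(1) nat_approx_posE by (metis of_nat_Suc)
    show "\<exists>no. \<forall>n\<ge>no. norm (real (Suc n) * (?q (1 / real (Suc n)) - conjugate \<psi> p w) - - \<eta> p u) < r"
    proof (intro exI[of _ N] allI impI)
      fix n assume n: "n \<ge> N"
      have "1 / real (Suc n) \<le> 1 / real (Suc N)" using n by (intro divide_left_mono) auto
      then have "?q (1 / real (Suc n)) - conjugate \<psi> p w \<le> 1 / real (Suc n) * (r / 2 - \<eta> p u)"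
        using N by (intro t0) auto
      then have "real (Suc n) * (?q (1 / real (Suc n)) - conjugate \<psi> p w) \<le> real (Suc n) * (1 / real (Suc n) * (r / 2 - \<eta> p u))"
        by (intro mult_left_mono) auto
      also have "\<dots> = r / 2 - \<eta> p u" by simp
      finally have 1: "real (Suc n) * (?q (1 / real (Suc n)) - conjugate \<psi> p w) \<le> r / 2 - \<eta> p u" .
      have "real (Suc n) * (- (1 / real (Suc n)) * \<eta> p u) \<le> real (Suc n) * (?q (1 / real (Suc n)) - conjugate \<psi> p w)"
        by (intro mult_left_mono lower) auto
      also have "real (Suc n) * (- (1 / real (Suc n)) * \<eta> p u) = - \<eta> p u" by simp
      finally show "norm (real (Suc n) * (?q (1 / real (Suc n)) - conjugate \<psi> p w) - - \<eta> p u) < r"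
        using 1 r unfolding real_norm_def by argo
    qed
  qed
qed

text \<open>The cost does not decrease from \<psi> to \<psi> + t \<eta>. Divide by t = 1/(n+1) and
  pass to the limit: the term on \<mu> contributes -\<eta> at the gradient by the envelope theorem,
  the term on \<nu> is linear in t. Since -\<eta> is admissible along with \<eta>, applications
  obtain equality.\<close>

lemma minimizer_first_variation:
  assumes adm: "admissible \<psi>" "admissible \<eta>"
    and min: "\<And>\<psi>'. admissible \<psi>' \<Longrightarrow> cost (conjugate \<psi>) \<psi> \<le> cost (conjugate \<psi>') \<psi>'"
    and G [measurable]: "G \<in> borel_measurable \<mu>"
    and d: "AE x in \<mu>. (conjugate \<psi> (b x) has_derivative (\<lambda>v. G x \<bullet> v)) (at (z x))"
  shows "(\<integral>x. \<eta> (b x) (G x) \<partial>\<mu>) \<le> (\<integral>y. \<eta> (b' y) (z' y) \<partial>\<nu>)"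
proof -
  obtain C where C: "\<And>p y. y \<in> Y \<Longrightarrow> \<bar>\<eta> p y\<bar> \<le> C" using adm(2) unfolding admissible_def by blast
  define \<psi>s where "\<psi>s n = (\<lambda>p y. \<psi> p y + 1 / real (Suc n) * \<eta> p y)" for n
  define q where "q n x = real (Suc n) * (conjugate (\<psi>s n) (b x) (z x) - conjugate \<psi> (b x) (z x))" for n x
  have adm_s: "admissible (\<psi>s n)" for n unfolding \<psi>s_def by (rule admissible_perturb[OF adm])
  note i = admissible_int[OF adm(1)] and i\<eta> = admissible_int(2)[OF adm(2)] and i_s = admissible_int[OF adm_s]
  have "0 \<le> (\<integral>x. q n x \<partial>\<mu>) + (\<integral>y. \<eta> (b' y) (z' y) \<partial>\<nu>)" for n
  proof -
    have "0 \<le> cost (conjugate (\<psi>s n)) (\<psi>s n) - cost (conjugate \<psi>) \<psi>" using min[OF adm_s] by simp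
    also have "\<dots> = (\<integral>x. conjugate (\<psi>s n) (b x) (z x) - conjugate \<psi> (b x) (z x) \<partial>\<mu>) + 1 / real (Suc n) * (\<integral>y. \<eta> (b' y) (z' y) \<partial>\<nu>)"
      unfolding cost_def using i i\<eta> i_s(1) by (simp add: \<psi>s_def)
    finally have "0 \<le> real (Suc n) * ((\<integral>x. conjugate (\<psi>s n) (b x) (z x) - conjugate \<psi> (b x) (z x) \<partial>\<mu>) + 1 / real (Suc n) * (\<integral>y. \<eta> (b' y) (z' y) \<partial>\<nu>))"
      by simp
    then show ?thesis by (simp only: q_def integral_mult_right_zero distrib_left) simp
  qed
  moreover have "(\<lambda>n. \<integral>x. q n x \<partial>\<mu>) \<longlonglongrightarrow> (\<integral>x. - \<eta> (b x) (G x) \<partial>\<mu>)"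
  proof (rule integral_dominated_convergence[where w="\<lambda>_. C"])
    show "AE x in \<mu>. (\<lambda>n. q n x) \<longlonglongrightarrow> - \<eta> (b x) (G x)"
      using d
    proof eventually_elim
      case (elim x)
      show ?case using conjugate_perturb_derivative[OF adm elim] by (simp add: q_def \<psi>s_def)
    qed
    show "AE x in \<mu>. norm (q n x) \<le> C" for n
    proof (rule AE_I2)
      fix x
      have "\<bar>q n x\<bar> = real (Suc n) * \<bar>conjugate (\<psi>s n) (b x) (z x) - conjugate \<psi> (b x) (z x)\<bar>"
        by (simp add: q_def abs_mult)
      also have "\<dots> \<le> real (Suc n) * (1 / real (Suc n) * C)"
        unfolding \<psi>s_def by (intro mult_left_mono conjugate_perturb_bound[OF adm C]) auto
      finally show "norm (q n x) \<le> C" by simp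
    qed
    show "q n \<in> borel_measurable \<mu>" for n
      unfolding q_def using i(1) i_s(1)[of n] by measurable
    show "(\<lambda>x. - \<eta> (b x) (G x)) \<in> borel_measurable \<mu>"
      using measurable_compose[OF measurable_Pair[OF b_meas(1) G] admissibleD(1)[OF adm(2)]] by simp
  qed simp
  ultimately have "0 \<le> (\<integral>x. - \<eta> (b x) (G x) \<partial>\<mu>) + (\<integral>y. \<eta> (b' y) (z' y) \<partial>\<nu>)"
    by (intro tendsto_lowerbound[OF tendsto_add[OF _ tendsto_const]]) auto
  then show ?thesis by simp
qed

text \<open>Differentiability is a hypothesis because it depends on how \<open>b\<close> and
  \<open>z\<close> vary with x; it is required only for potentials with the invariance that a
  conjugate has. The equality on the gradient is complementary slackness, from which optimality
  follows. Matching the joint law with the parameter replaces a disintegration.\<close>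

lemma optimal_potentials:
  assumes diff: "\<And>\<phi>. case_prod \<phi> \<in> borel_measurable (borel \<Otimes>\<^sub>M borel) \<Longrightarrow> (\<And>p. convex_on UNIV (\<phi> p)) \<Longrightarrow>
     (\<And>p w v. (\<And>y. y \<in> Y \<Longrightarrow> y \<bullet> v = 0) \<Longrightarrow> \<phi> p (w + v) = \<phi> p w) \<Longrightarrow>
     AE x in \<mu>. \<phi> (b x) differentiable (at (z x))"
  obtains \<phi> \<psi> where "case_prod \<phi> \<in> borel_measurable (borel \<Otimes>\<^sub>M borel)" "\<And>p. convex_on UNIV (\<phi> p)"
    "AE x in \<mu>. \<phi> (b x) differentiable (at (z x))"
    "integrable \<mu> (\<lambda>x. \<phi> (b x) (z x))" "case_prod \<psi> \<in> borel_measurable (borel \<Otimes>\<^sub>M borel)"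
    "integrable \<nu> (\<lambda>y. \<psi> (b' y) (z' y))"
    "\<And>p w y. y \<in> Y \<Longrightarrow> y \<bullet> w \<le> \<phi> p w + \<psi> p y"
    "AE x in \<mu>. quot_grad (\<phi> (b x)) (z x) \<in> Y"
    "AE x in \<mu>. quot_grad (\<phi> (b x)) (z x) \<bullet> z x = \<phi> (b x) (z x) + \<psi> (b x) (quot_grad (\<phi> (b x)) (z x))"
    "distr \<mu> borel (\<lambda>x. (b x, quot_grad (\<phi> (b x)) (z x))) = distr \<nu> borel (\<lambda>y. (b' y, z' y))"
proof -
  obtain \<psi> where \<psi>: "admissible \<psi>" "\<And>\<psi>'. admissible \<psi>' \<Longrightarrow> cost (conjugate \<psi>) \<psi> \<le> cost (conjugate \<psi>') \<psi>'"
    using minimizer_exists by blast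
  note cp = conjugate_props[OF \<psi>(1)]
  have df: "AE x in \<mu>. conjugate \<psi> (b x) differentiable (at (z x))"
    by (rule diff[OF cp(1,3)]) (rule conjugate_orth)
  define G where "G x = quot_grad (conjugate \<psi> (b x)) (z x)" for x
  have G [measurable]: "G \<in> borel_measurable \<mu>"
    using measurable_compose[OF measurable_Pair[OF b_meas(1) z_meas(1)] quot_grad_measurable[OF cp(1)]]
    by (simp add: G_def[abs_def])
  have d: "AE x in \<mu>. (conjugate \<psi> (b x) has_derivative (\<lambda>v. G x \<bullet> v)) (at (z x))"
    using df unfolding G_def by eventually_elim (rule differentiable_quot_grad)
  have "distr \<mu> borel (\<lambda>x. (b x, G x)) = distr \<nu> borel (\<lambda>y. (b' y, z' y))"
  proof (rule measure_eqI_infdist)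
    show "prob_space (distr \<mu> borel (\<lambda>x. (b x, G x)))" by (rule M.prob_space_distr) measurable
    show "prob_space (distr \<nu> borel (\<lambda>y. (b' y, z' y)))" by (rule N.prob_space_distr) measurable
    fix F :: "('p \<times> 'e) set" and n :: nat assume F: "closed F" "F \<noteq> {}"
    define k where "k x = max 0 (1 - real n * infdist x F)" for x
    have k01: "\<bar>k x\<bar> \<le> 1" for x using infdist_nonneg[of x F] by (auto simp: k_def max_def)
    have kc: "continuous_on UNIV k" unfolding k_def by (intro continuous_intros)
    then have km [measurable]: "k \<in> borel_measurable borel" by (rule borel_measurable_continuous_onI)
    \<comment> \<open>The factor \<open>c\<close> allows both signs, which turns the one-sided first
      variation into an equality of integrals.\<close>
    have a1: "admissible (\<lambda>p y. c * k (p, y))" for c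
      unfolding admissible_def
    proof (intro conjI allI)
      have "(\<lambda>x. c * k x) \<in> borel_measurable (borel :: ('p \<times> 'e) measure)" by measurable
      then show "(\<lambda>(p, y). c * k (p, y)) \<in> borel_measurable (borel \<Otimes>\<^sub>M borel)"
        unfolding borel_prod by (simp add: split_beta')
      have "\<bar>c * k (p, y)\<bar> \<le> \<bar>c\<bar>" for p y
        using mult_left_mono[OF k01[of "(p, y)"], of "\<bar>c\<bar>"] by (simp add: abs_mult)
      then show "\<exists>B. \<forall>p. \<forall>y\<in>Y. \<bar>c * k (p, y)\<bar> \<le> B" by blast
      show "continuous_on Y (\<lambda>y. c * k (p, y))" for p
        by (intro continuous_intros continuous_on_compose2[OF kc]) auto
    qed
    have "(\<integral>x. c * k (b x, G x) \<partial>\<mu>) \<le> (\<integral>y. c * k (b' y, z' y) \<partial>\<nu>)" for c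
      by (rule minimizer_first_variation[OF \<psi>(1) a1 \<psi>(2) G d])
    from this[of 1] this[of "-1"] have "(\<integral>x. k (b x, G x) \<partial>\<mu>) = (\<integral>y. k (b' y, z' y) \<partial>\<nu>)" by simp
    then show "(\<integral>x. max 0 (1 - real n * infdist x F) \<partial>distr \<mu> borel (\<lambda>x. (b x, G x))) =
        (\<integral>x. max 0 (1 - real n * infdist x F) \<partial>distr \<nu> borel (\<lambda>y. (b' y, z' y)))"
      unfolding k_def[symmetric] by (subst (1 2) integral_distr) auto
  qed simp_all
  moreover have "AE x in \<mu>. G x \<in> Y"
    using d by eventually_elim (rule conjugate_gradient_unique(1)[OF \<psi>(1)])
  moreover have "AE x in \<mu>. G x \<bullet> z x = conjugate \<psi> (b x) (z x) + \<psi> (b x) (G x)"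
    using d by eventually_elim (simp add: conjugate_gradient_unique(2)[OF \<psi>(1)])
  ultimately show ?thesis
    using df cp(1,3,4) admissible_int[OF \<psi>(1)] admissibleD(1)[OF \<psi>(1)]
    by (intro that[of "conjugate \<psi>" \<psi>]) (simp_all add: G_def)
qed

end

section \<open>Almost everywhere differentiability along fibres\<close>

text \<open>
  Averaging over translates, \<open>|S| = \<integral>\<^bsub>0\<^esub>\<^bsup>1\<^esup> |S - t u| dt\<close>, and Tonelli's theorem avoid a change of coordinates.
\<close>
lemma null_set_if_countable_on_lines:
  fixes S :: "'a::euclidean_space set"
  assumes S [measurable]: "S \<in> sets borel" and c: "\<And>x. countable {t::real. x + t *\<^sub>R u \<in> S}"
  shows "S \<in> null_sets lborel"
proof -
  have shift: "(\<integral>\<^sup>+x. indicator S (x + t *\<^sub>R u) \<partial>lborel) = emeasure lborel S" for t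
  proof -
    have "emeasure lborel S = emeasure (distr lborel borel ((+) (t *\<^sub>R u))) S"
      by (simp add: lborel_distr_plus)
    also have "\<dots> = (\<integral>\<^sup>+x. indicator S x \<partial>distr lborel borel ((+) (t *\<^sub>R u)))" by simp
    also have "\<dots> = (\<integral>\<^sup>+x. indicator S (t *\<^sub>R u + x) \<partial>lborel)" by (subst nn_integral_distr) auto
    finally show ?thesis by (simp add: add.commute)
  qed
  have "emeasure lborel S = (\<integral>\<^sup>+t. emeasure lborel S * indicator {0..1::real} t \<partial>lborel)"
    by (subst nn_integral_cmult_indicator) auto
  also have "\<dots> = (\<integral>\<^sup>+t. \<integral>\<^sup>+x. indicator {0..1::real} t * indicator S (x + t *\<^sub>R u) \<partial>lborel \<partial>lborel)"
    by (subst nn_integral_cmult) (auto simp: shift mult.commute)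
  also have "\<dots> = (\<integral>\<^sup>+x. \<integral>\<^sup>+t. indicator {0..1::real} t * indicator S (x + t *\<^sub>R u) \<partial>lborel \<partial>lborel)"
    by (subst lborel_pair.Fubini') auto
  also have "\<dots> = (\<integral>\<^sup>+(x::'a). 0 \<partial>lborel)"
  proof (rule nn_integral_cong)
    fix x :: 'a
    have "{t::real. x + t *\<^sub>R u \<in> S} \<in> null_sets lborel" by (rule countable_imp_null_set_lborel[OF c])
    then have "AE t in lborel. \<not> x + t *\<^sub>R u \<in> S"
      using AE_not_in by fastforce
    then have "(\<integral>\<^sup>+t. indicator {0..1::real} t * indicator S (x + t *\<^sub>R u) \<partial>lborel) = (\<integral>\<^sup>+(t::real). 0 \<partial>lborel)"
      by (intro nn_integral_cong_AE) auto
    then show "(\<integral>\<^sup>+t. indicator {0..1::real} t * indicator S (x + t *\<^sub>R u) \<partial>lborel) = 0" by simp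
  qed
  finally show ?thesis using S by (intro null_setsI) auto
qed

text \<open>Limits along 1/(n+1) alone are visibly measurable in any parameter of \<open>k\<close>;
  for convex \<open>k\<close> monotone slopes make them the true one-sided derivatives.\<close>

definition right_deriv :: "(real \<Rightarrow> real) \<Rightarrow> real \<Rightarrow> real" where
  "right_deriv k t = lim (\<lambda>n. real (Suc n) * (k (t + 1 / real (Suc n)) - k t))"

definition left_deriv :: "(real \<Rightarrow> real) \<Rightarrow> real \<Rightarrow> real" where
  "left_deriv k t = lim (\<lambda>n. real (Suc n) * (k t - k (t - 1 / real (Suc n))))"

lemma convex_slopes:
  fixes k :: "real \<Rightarrow> real"
  assumes "convex_on UNIV k" "a < b" "b < c"
  shows "(k b - k a) / (b - a) \<le> (k c - k a) / (c - a)" "(k c - k a) / (c - a) \<le> (k c - k b) / (c - b)"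
proof -
  have flip: "(x - y) / (v - w) = (y - x) / (w - v)" for x y v w :: real
    by (metis minus_diff_eq minus_divide_divide)
  show "(k b - k a) / (b - a) \<le> (k c - k a) / (c - a)" "(k c - k a) / (c - a) \<le> (k c - k b) / (c - b)"
    using convex_on_slope_le[OF assms(1) _ _ assms(2,3)] by (simp_all add: flip[of "k a"] flip[of "k b" "k c"])
qed

text \<open>The quotients decrease with the step and are bounded below by the slopes to the left of
  t. The other two claims place the limit between left and right secant slopes.\<close>

lemma right_deriv_tendsto:
  assumes k: "convex_on UNIV k"
  shows "(\<lambda>n. real (Suc n) * (k (t + 1 / real (Suc n)) - k t)) \<longlonglongrightarrow> right_deriv k t"
    and "t < s \<Longrightarrow> right_deriv k t \<le> (k s - k t) / (s - t)"
    and "s < t \<Longrightarrow> (k t - k s) / (t - s) \<le> right_deriv k t"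
proof -
  define h where "h n = real (Suc n) * (k (t + 1 / real (Suc n)) - k t)" for n
  have h_eq: "h n = (k (t + 1 / real (Suc n)) - k t) / ((t + 1 / real (Suc n)) - t)" for n
    by (simp add: h_def)
  have "h (Suc n) \<le> h n" for n
  proof -
    have "1 / real (Suc (Suc n)) < 1 / real (Suc n)" by (intro divide_strict_left_mono) auto
    then show ?thesis unfolding h_eq by (intro convex_slopes(1)[OF k]) auto
  qed
  then have dec: "decseq h" by (rule decseq_SucI)
  have lower: "(k t - k s) / (t - s) \<le> h n" if "s < t" for s n
  proof -
    have "t < t + 1 / real (Suc n)" by simp
    from convex_slopes[OF k that this] show ?thesis unfolding h_eq by linarith
  qed
  have "\<forall>n. k t - k (t - 1) \<le> h n" using lower[of "t - 1"] by simp
  from decseq_convergent[OF dec this] obtain L where L: "h \<longlonglongrightarrow> L" by blast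
  then have R: "right_deriv k t = L" unfolding right_deriv_def h_def[symmetric] by (rule limI)
  show "(\<lambda>n. real (Suc n) * (k (t + 1 / real (Suc n)) - k t)) \<longlonglongrightarrow> right_deriv k t"
    using L R by (simp add: h_def[abs_def])
  show "(k t - k s) / (t - s) \<le> right_deriv k t" if "s < t"
    unfolding R by (rule LIMSEQ_le_const[OF L]) (use lower[OF that] in blast)
  show "right_deriv k t \<le> (k s - k t) / (s - t)" if ts: "t < s"
  proof -
    obtain n where n: "1 / real (Suc n) < s - t"
      using nat_approx_posE[of "s - t"] ts by (metis diff_gt_0_iff_gt)
    have "L \<le> h n" by (rule decseq_ge[OF dec L])
    also have "\<dots> \<le> (k s - k t) / (s - t)"
      unfolding h_eq by (rule convex_slopes(1)[OF k]) (use n in auto)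
    finally show ?thesis by (simp add: R)
  qed
qed

lemma convex_on_reflect:
  fixes k :: "real \<Rightarrow> real"
  assumes "convex_on UNIV k"
  shows "convex_on UNIV (\<lambda>s. k (- s))"
proof (rule convex_onI)
  fix t x y :: real assume "0 < t" "t < 1"
  then show "k (- ((1 - t) *\<^sub>R x + t *\<^sub>R y)) \<le> (1 - t) * k (- x) + t * k (- y)"
    using convex_onD[OF assms, of t "- x" "- y"] by (simp add: algebra_simps)
qed simp

lemma left_deriv_tendsto:
  assumes k: "convex_on UNIV k"
  shows "(\<lambda>n. real (Suc n) * (k t - k (t - 1 / real (Suc n)))) \<longlonglongrightarrow> left_deriv k t"
    and "t < s \<Longrightarrow> left_deriv k t \<le> (k s - k t) / (s - t)"
    and "s < t \<Longrightarrow> (k t - k s) / (t - s) \<le> left_deriv k t"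
proof -
  define k' where "k' s = k (- s)" for s
  have k': "convex_on UNIV k'" unfolding k'_def by (rule convex_on_reflect[OF k])
  note r = right_deriv_tendsto[OF k', where t="- t"]
  from tendsto_minus[OF r(1)]
  have L: "(\<lambda>n. real (Suc n) * (k t - k (t - 1 / real (Suc n)))) \<longlonglongrightarrow> - right_deriv k' (- t)"
    by (simp add: k'_def algebra_simps)
  then have e: "left_deriv k t = - right_deriv k' (- t)" unfolding left_deriv_def by (rule limI)
  with L show "(\<lambda>n. real (Suc n) * (k t - k (t - 1 / real (Suc n)))) \<longlonglongrightarrow> left_deriv k t" by simp
  show "left_deriv k t \<le> (k s - k t) / (s - t)" if "t < s"
  proof -
    have "(k' (- t) - k' (- s)) / (- t - - s) \<le> right_deriv k' (- t)" by (rule r(3)) (use that in simp)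
    then have "(k t - k s) / (s - t) \<le> right_deriv k' (- t)" by (simp add: k'_def)
    moreover have "(k t - k s) / (s - t) = - ((k s - k t) / (s - t))" by (simp add: minus_divide_left)
    ultimately show ?thesis unfolding e by linarith
  qed
  show "(k t - k s) / (t - s) \<le> left_deriv k t" if "s < t"
  proof -
    have "right_deriv k' (- t) \<le> (k' (- s) - k' (- t)) / (- s - - t)" by (rule r(2)) (use that in simp)
    then have "right_deriv k' (- t) \<le> (k s - k t) / (t - s)" by (simp add: k'_def)
    moreover have "(k s - k t) / (t - s) = - ((k t - k s) / (t - s))" by (simp add: minus_divide_left)
    ultimately show ?thesis unfolding e by linarith
  qed
qed

text \<open>The right derivative is monotone, so it has countably many discontinuities. At a point
  of continuity it is the limit of its values at s < t, each of which is at most the left derivative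
  at t, since the secant slope from s to t separates them.\<close>

lemma countable_one_sided_deriv_neq:
  assumes k: "convex_on UNIV k"
  shows "countable {t. right_deriv k t \<noteq> left_deriv k t}"
proof -
  note r = right_deriv_tendsto[OF k] note l = left_deriv_tendsto[OF k]
  have rl: "right_deriv k s \<le> left_deriv k t" if "s < t" for s t
    using r(2)[OF that] l(3)[OF that] by linarith
  have lr: "left_deriv k t \<le> right_deriv k t" for t
    by (rule LIMSEQ_le_const[OF r(1)])
      (use l(2)[of t "t + 1 / real (Suc n)" for n] in \<open>auto simp: mult.commute\<close>)
  have "mono (right_deriv k)"
  proof (rule monoI)
    fix s t :: real assume "s \<le> t"
    then show "right_deriv k s \<le> right_deriv k t"
      using rl[of s t] lr[of t] by (cases "s = t") auto
  qed
  then have "countable {t. \<not> isCont (right_deriv k) t}" by (rule mono_ctble_discont)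
  moreover have "right_deriv k t = left_deriv k t" if "isCont (right_deriv k) t" for t
  proof -
    have "(right_deriv k \<longlongrightarrow> right_deriv k t) (at_left t)"
      using that unfolding isCont_def by (rule filterlim_mono) (auto simp: at_le)
    moreover have "eventually (\<lambda>s. right_deriv k s \<le> left_deriv k t) (at_left t)"
      using eventually_at_left_real[of "t - 1" t] by (auto elim!: eventually_mono intro: rl)
    ultimately have "right_deriv k t \<le> left_deriv k t"
      by (rule tendsto_upperbound) simp
    with lr[of t] show ?thesis by simp
  qed
  ultimately show ?thesis by (elim countable_subset[rotated]) auto
qed

lemma convex_on_line:
  fixes f :: "'e::real_vector \<Rightarrow> real"
  assumes "convex_on UNIV f"
  shows "convex_on UNIV (\<lambda>t::real. f (w + t *\<^sub>R e))"
proof (rule convex_onI)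
  fix t x y :: real assume t: "0 < t" "t < 1"
  have "w + ((1 - t) *\<^sub>R x + t *\<^sub>R y) *\<^sub>R e = (1 - t) *\<^sub>R (w + x *\<^sub>R e) + t *\<^sub>R (w + y *\<^sub>R e)"
    by (simp add: algebra_simps)
  then show "f (w + ((1 - t) *\<^sub>R x + t *\<^sub>R y) *\<^sub>R e) \<le> (1 - t) * f (w + x *\<^sub>R e) + t * f (w + y *\<^sub>R e)"
    using convex_onD[OF assms, of t "w + x *\<^sub>R e" "w + y *\<^sub>R e"] t by simp
qed simp

text \<open>Because slopes are monotone, the two inequalities at one step 1/(n+1) already control
  all smaller |t|, so the limits along a sequence are sufficient.\<close>

lemma convex_remainder_bound:
  assumes k: "convex_on UNIV k" and eq: "right_deriv k 0 = left_deriv k 0" and \<epsilon>: "\<epsilon> > 0"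
  shows "\<exists>\<delta>>0. \<forall>t. \<bar>t\<bar> < \<delta> \<longrightarrow> k t - k 0 - t * right_deriv k 0 \<le> \<epsilon> * \<bar>t\<bar>"
proof -
  let ?c = "right_deriv k 0"
  have "eventually (\<lambda>n. real (Suc n) * (k (0 + 1 / real (Suc n)) - k 0) < ?c + \<epsilon>) sequentially"
    using right_deriv_tendsto(1)[OF k] by (rule order_tendstoD) (use \<epsilon> in simp)
  moreover have "eventually (\<lambda>n. ?c - \<epsilon> < real (Suc n) * (k 0 - k (0 - 1 / real (Suc n)))) sequentially"
    using left_deriv_tendsto(1)[OF k, of 0] unfolding eq by (rule order_tendstoD) (use \<epsilon> in simp)
  ultimately have "eventually (\<lambda>n. real (Suc n) * (k (0 + 1 / real (Suc n)) - k 0) < ?c + \<epsilon> \<and>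
      ?c - \<epsilon> < real (Suc n) * (k 0 - k (0 - 1 / real (Suc n)))) sequentially"
    by (rule eventually_conj)
  then obtain n where n: "real (Suc n) * (k (0 + 1 / real (Suc n)) - k 0) < ?c + \<epsilon>"
      "?c - \<epsilon> < real (Suc n) * (k 0 - k (0 - 1 / real (Suc n)))"
    unfolding eventually_sequentially by blast
  define \<delta> where "\<delta> = 1 / real (Suc n)"
  have \<delta>: "\<delta> > 0" by (simp add: \<delta>_def)
  have n1: "(k \<delta> - k 0) / (\<delta> - 0) < ?c + \<epsilon>" and n2: "?c - \<epsilon> < (k 0 - k (- \<delta>)) / (0 - - \<delta>)"
    using n by (simp_all add: \<delta>_def mult.commute)
  show ?thesis
  proof (intro exI[of _ \<delta>] conjI allI impI \<delta>)
    fix t assume t: "\<bar>t\<bar> < \<delta>"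
    consider "t = 0" | "t > 0" | "t < 0" by linarith
    then show "k t - k 0 - t * ?c \<le> \<epsilon> * \<bar>t\<bar>"
    proof cases
      case 2
      have "(k t - k 0) / (t - 0) \<le> (k \<delta> - k 0) / (\<delta> - 0)" by (rule convex_slopes(1)[OF k]) (use 2 t in auto)
      also note n1
      finally have "k t - k 0 < (?c + \<epsilon>) * t" using 2 by (simp add: pos_divide_less_eq)
      then show ?thesis using 2 by (simp add: algebra_simps)
    next
      case 3
      note n2
      also have "(k 0 - k (- \<delta>)) / (0 - - \<delta>) \<le> (k 0 - k t) / (0 - t)" by (rule convex_slopes(2)[OF k]) (use 3 t in auto)
      finally have "(?c - \<epsilon>) * (0 - t) < k 0 - k t" by (subst (asm) pos_less_divide_eq) (use 3 in auto)
      then show ?thesis using 3 by (simp add: algebra_simps)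
    qed auto
  qed
qed

text \<open>For a convex function the partial derivatives suffice. The remainder \<open>r\<close> is
  convex: writing v as the average of its d components, each multiplied by d, Jensen's inequality
  bounds \<open>r\<close> above by its values on the axes. Convexity with r(0) = 0 gives r(v) +
  r(-v) >= 0, which turns the upper bound into a lower one.\<close>

lemma convex_differentiable_if_partial:
  fixes f :: "'e::euclidean_space \<Rightarrow> real"
  assumes f: "convex_on UNIV f"
    and eq: "\<And>e. e \<in> Basis \<Longrightarrow> right_deriv (\<lambda>t. f (w + t *\<^sub>R e)) 0 = left_deriv (\<lambda>t. f (w + t *\<^sub>R e)) 0"
  shows "f differentiable (at w)"
proof -
  define c where "c e = right_deriv (\<lambda>t. f (w + t *\<^sub>R e)) 0" for e
  define G where "G = (\<Sum>e\<in>Basis. c e *\<^sub>R e)"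
  define r where "r v = f (w + v) - f w - G \<bullet> v" for v
  define d where "d = real DIM('e)"
  have d: "d > 0" by (simp add: d_def)
  have Ge: "G \<bullet> e = c e" if "e \<in> Basis" for e using that by (simp add: G_def)
  have r_conv: "convex_on UNIV r"
  proof (rule convex_onI)
    fix t x y assume t: "(0::real) < t" "t < 1"
    have "w + ((1 - t) *\<^sub>R x + t *\<^sub>R y) = (1 - t) *\<^sub>R (w + x) + t *\<^sub>R (w + y)"
      by (simp add: algebra_simps)
    then have "f (w + ((1 - t) *\<^sub>R x + t *\<^sub>R y)) \<le> (1 - t) * f (w + x) + t * f (w + y)"
      using convex_onD[OF f, of t "w + x" "w + y"] t by simp
    then show "r ((1 - t) *\<^sub>R x + t *\<^sub>R y) \<le> (1 - t) * r x + t * r y"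
      by (simp add: r_def inner_add_right algebra_simps)
  qed simp
  have small: "\<exists>\<delta>>0. \<forall>v. norm v < \<delta> \<longrightarrow> r v \<le> \<epsilon> * norm v" if \<epsilon>: "\<epsilon> > 0" for \<epsilon>
  proof -
    have "\<exists>\<delta>>0. \<forall>t. \<bar>t\<bar> < \<delta> \<longrightarrow> r (t *\<^sub>R e) \<le> \<epsilon> / d * \<bar>t\<bar>" if "e \<in> Basis" for e
      using convex_remainder_bound[OF convex_on_line[OF f] eq[OF that], of "\<epsilon> / d"] \<epsilon> d
      by (simp add: r_def Ge[OF that] c_def)
    then obtain \<delta> where \<delta>: "\<And>e. e \<in> Basis \<Longrightarrow> \<delta> e > 0"
      "\<And>e t. e \<in> Basis \<Longrightarrow> \<bar>t\<bar> < \<delta> e \<Longrightarrow> r (t *\<^sub>R e) \<le> \<epsilon> / d * \<bar>t\<bar>" by metis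
    \<comment> \<open>The division by \<open>d\<close> compensates for the factor \<open>d\<close>
      by which the components of v are stretched in the average.\<close>
    define \<delta>' where "\<delta>' = Min (\<delta> ` Basis) / d"
    have "\<delta>' > 0" using \<delta>(1) d by (simp add: \<delta>'_def)
    moreover have "r v \<le> \<epsilon> * norm v" if v: "norm v < \<delta>'" for v
    proof -
      have b: "r ((d * (v \<bullet> e)) *\<^sub>R e) \<le> \<epsilon> * norm v" if e: "e \<in> Basis" for e
      proof -
        have ve: "\<bar>v \<bullet> e\<bar> \<le> norm v" using e by (rule Basis_le_norm)
        have "d * norm v < Min (\<delta> ` Basis)" using v d by (simp add: \<delta>'_def field_simps)
        also have "\<dots> \<le> \<delta> e" using e by simp
        finally have "\<bar>d * (v \<bullet> e)\<bar> < \<delta> e" using ve d by (simp add: abs_mult) (smt (verit) mult_left_mono)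
        then have "r ((d * (v \<bullet> e)) *\<^sub>R e) \<le> \<epsilon> / d * \<bar>d * (v \<bullet> e)\<bar>" by (rule \<delta>(2)[OF e])
        also have "\<dots> = \<epsilon> * \<bar>v \<bullet> e\<bar>" using d by (simp add: abs_mult)
        also have "\<dots> \<le> \<epsilon> * norm v" using ve \<epsilon> by simp
        finally show ?thesis .
      qed
      have "v = (\<Sum>e\<in>Basis. (1 / d) *\<^sub>R ((d * (v \<bullet> e)) *\<^sub>R e))"
        using d by (simp add: euclidean_representation)
      then have "r v = r (\<Sum>e\<in>Basis. (1 / d) *\<^sub>R ((d * (v \<bullet> e)) *\<^sub>R e))" by simp
      also have "\<dots> \<le> (\<Sum>e\<in>Basis. (1 / d) * r ((d * (v \<bullet> e)) *\<^sub>R e))"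
        by (rule convex_on_sum[OF _ _ r_conv]) (use d in \<open>auto simp: d_def\<close>)
      also have "\<dots> \<le> (\<Sum>e\<in>(Basis::'e set). (1 / d) * (\<epsilon> * norm v))"
        using b d by (intro sum_mono mult_left_mono) auto
      also have "\<dots> = \<epsilon> * norm v" using d by (simp add: d_def)
      finally show ?thesis .
    qed
    ultimately show ?thesis by blast
  qed
  have "(f has_derivative (\<lambda>v. G \<bullet> v)) (at w)"
    unfolding has_derivative_at_alt
  proof (intro conjI allI impI bounded_linear_inner_right)
    fix \<epsilon> :: real assume "\<epsilon> > 0"
    from small[OF this] obtain \<delta> where \<delta>: "\<delta> > 0" "\<And>v. norm v < \<delta> \<Longrightarrow> r v \<le> \<epsilon> * norm v" by blast
    show "\<exists>\<delta>>0. \<forall>y. norm (y - w) < \<delta> \<longrightarrow> norm (f y - f w - G \<bullet> (y - w)) \<le> \<epsilon> * norm (y - w)"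
    proof (intro exI[of _ \<delta>] conjI allI impI \<delta>(1))
      fix y assume y: "norm (y - w) < \<delta>"
      define v where "v = y - w"
      have yv: "norm v < \<delta>" using y by (simp add: v_def)
      have "r ((1 - 1/2) *\<^sub>R v + (1/2) *\<^sub>R (- v)) \<le> (1 - 1/2) * r v + (1/2) * r (- v)"
        by (rule convex_onD[OF r_conv]) auto
      moreover have "r ((1 - 1/2) *\<^sub>R v + (1/2) *\<^sub>R (- v)) = 0" by (simp add: r_def)
      ultimately have "0 \<le> r v + r (- v)" by simp
      moreover have "r (- v) \<le> \<epsilon> * norm v" using \<delta>(2)[of "- v"] yv by simp
      moreover have "r v \<le> \<epsilon> * norm v" using \<delta>(2)[of v] y by (simp add: v_def)
      moreover have "f y - f w - G \<bullet> (y - w) = r v" by (simp add: r_def v_def)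
      ultimately show "norm (f y - f w - G \<bullet> (y - w)) \<le> \<epsilon> * norm (y - w)" by (simp add: abs_le_iff v_def)
    qed
  qed
  then show ?thesis by (auto simp: differentiable_def)
qed

text \<open>Each basis direction \<open>e\<close> is either invisible to \<phi> or realised by a
  direction \<open>u\<close> of x that moves \<open>z\<close> along \<open>e\<close> and keeps
  \<open>b\<close> fixed. In the second case the restriction to a line in direction \<open>u\<close>
  is one convex function, with countably many bad points. Nothing beyond measurability is asked of
  the dependence on \<open>b\<close>.\<close>

lemma AE_differentiable_convex:
  fixes \<mu> :: "'a::euclidean_space measure" and b :: "'a \<Rightarrow> 'p::second_countable_topology"
    and z :: "'a \<Rightarrow> 'e::euclidean_space" and \<phi> :: "'p \<Rightarrow> 'e \<Rightarrow> real"
  assumes sets: "sets \<mu> = sets borel" and ac: "absolutely_continuous lborel \<mu>"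
    and [measurable]: "b \<in> borel_measurable borel" "z \<in> borel_measurable borel"
    and \<phi>: "case_prod \<phi> \<in> borel_measurable (borel \<Otimes>\<^sub>M borel)" "\<And>p. convex_on UNIV (\<phi> p)"
    and dirs: "\<And>e. e \<in> Basis \<Longrightarrow> (\<forall>p w t. \<phi> p (w + t *\<^sub>R e) = \<phi> p w) \<or>
      (\<exists>u. \<forall>x t. b (x + t *\<^sub>R u) = b x \<and> z (x + t *\<^sub>R u) = z x + t *\<^sub>R e)"
  shows "AE x in \<mu>. \<phi> (b x) differentiable (at (z x))"
proof -
  define k where "k e x t = \<phi> (b x) (z x + t *\<^sub>R e)" for e x and t :: real
  define S where "S e = {x. right_deriv (k e x) 0 \<noteq> left_deriv (k e x) 0}" for e
  have "AE x in \<mu>. x \<notin> S e" if e: "e \<in> Basis" for e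
    using dirs[OF e]
  proof
    assume "\<forall>p w t. \<phi> p (w + t *\<^sub>R e) = \<phi> p w"
    then have "k e x = (\<lambda>_. \<phi> (b x) (z x))" for x by (simp add: k_def fun_eq_iff)
    then have "S e = {}" by (simp add: S_def right_deriv_def left_deriv_def)
    then show ?thesis by simp
  next
    assume "\<exists>u. \<forall>x t. b (x + t *\<^sub>R u) = b x \<and> z (x + t *\<^sub>R u) = z x + t *\<^sub>R e"
    then obtain u where u: "\<And>x t. b (x + t *\<^sub>R u) = b x" "\<And>x t. z (x + t *\<^sub>R u) = z x + t *\<^sub>R e" by blast
    have [measurable]: "(\<lambda>x. k e x t) \<in> borel_measurable borel" for t
    proof -
      have "(\<lambda>x. case_prod \<phi> (b x, z x + t *\<^sub>R e)) \<in> borel_measurable borel"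
        by (rule measurable_compose[OF _ \<phi>(1)]) measurable
      then show ?thesis by (simp add: k_def)
    qed
    have "{x \<in> space borel. right_deriv (k e x) 0 \<noteq> left_deriv (k e x) 0} \<in> sets borel"
      unfolding right_deriv_def left_deriv_def by measurable
    then have Sm: "S e \<in> sets borel" by (simp add: S_def)
    have "S e \<in> null_sets lborel"
    proof (rule null_set_if_countable_on_lines[OF Sm, where u=u])
      fix x
      have "k e (x + t *\<^sub>R u) s = k e x (t + s)" for t s
        by (simp add: k_def u algebra_simps)
      then have "{t. x + t *\<^sub>R u \<in> S e} = {t. right_deriv (k e x) t \<noteq> left_deriv (k e x) t}"
        by (simp add: S_def right_deriv_def left_deriv_def)
      also have "countable \<dots>"
        unfolding k_def by (intro countable_one_sided_deriv_neq convex_on_line \<phi>(2))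
      finally show "countable {t. x + t *\<^sub>R u \<in> S e}" .
    qed
    then have "S e \<in> null_sets \<mu>" using ac by (auto simp: absolutely_continuous_def)
    then show ?thesis by (rule AE_not_in)
  qed
  then have "AE x in \<mu>. \<forall>e\<in>Basis. x \<notin> S e" by (intro AE_finite_allI) auto
  then show ?thesis
    by eventually_elim (rule convex_differentiable_if_partial[OF \<phi>(2)], auto simp: S_def k_def[abs_def])
qed

section \<open>The singular value decomposition\<close>

text \<open>First-order condition for the maximum of |Ax|/|x|: along w + t v the denominator has no
  linear term in t because v is orthogonal to w, so the linear term 2t \<langle>Aw, Av\<rangle> of
  the squared numerator must vanish.\<close>

lemma orthogonal_image_if_maximal:
  fixes A :: "'a::euclidean_space \<Rightarrow> 'b::euclidean_space"
  assumes A: "linear A" and V: "subspace V" and w: "w \<in> V" "norm w = 1"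
    and max: "\<And>x. x \<in> V \<Longrightarrow> norm x = 1 \<Longrightarrow> norm (A x) \<le> norm (A w)"
    and v: "v \<in> V" "v \<bullet> w = 0"
  shows "A w \<bullet> A v = 0"
proof (rule ccontr)
  assume ne: "A w \<bullet> A v \<noteq> 0"
  have scaled: "norm (A x) \<le> norm (A w) * norm x" if "x \<in> V" for x
  proof (cases "x = 0")
    case False
    then have "norm (A ((1 / norm x) *\<^sub>R x)) \<le> norm (A w)"
      using V that by (intro max) (auto simp: subspace_scale)
    then show ?thesis using False by (simp add: linear_scale[OF A] field_simps)
  qed (simp add: linear_0[OF A])
  have quad: "2 * t * (A w \<bullet> A v) \<le> t\<^sup>2 * ((norm (A w))\<^sup>2 * (norm v)\<^sup>2)" for t :: real
  proof -
    have "w + t *\<^sub>R v \<in> V" using V w v by (simp add: subspace_add subspace_scale)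
    from scaled[OF this] have "(norm (A (w + t *\<^sub>R v)))\<^sup>2 \<le> (norm (A w) * norm (w + t *\<^sub>R v))\<^sup>2"
      by (intro power_mono) auto
    moreover have "(norm (w + t *\<^sub>R v))\<^sup>2 = 1 + t\<^sup>2 * (norm v)\<^sup>2"
    proof -
      have "w \<bullet> w = 1" "w \<bullet> v = 0" using w(2) v(2) by (simp_all add: norm_eq_1 inner_commute)
      then show ?thesis
        unfolding power2_norm_eq_inner using v(2)
        by (simp add: inner_add_left inner_add_right power2_eq_square mult.assoc)
    qed
    moreover have "(norm (A (w + t *\<^sub>R v)))\<^sup>2 = (norm (A w))\<^sup>2 + 2 * t * (A w \<bullet> A v) + t\<^sup>2 * (norm (A v))\<^sup>2"
      unfolding linear_add[OF A] linear_scale[OF A] power2_norm_eq_inner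
      by (simp add: inner_add_left inner_add_right inner_commute power2_eq_square algebra_simps)
    ultimately have "2 * t * (A w \<bullet> A v) + t\<^sup>2 * (norm (A v))\<^sup>2 \<le> t\<^sup>2 * ((norm (A w))\<^sup>2 * (norm v)\<^sup>2)"
      by (simp add: power_mult_distrib algebra_simps)
    moreover have "0 \<le> t\<^sup>2 * (norm (A v))\<^sup>2" by simp
    ultimately show ?thesis by linarith
  qed
  define c where "c = (norm (A w))\<^sup>2 * (norm v)\<^sup>2"
  define s where "s = A w \<bullet> A v"
  have c0: "0 \<le> c" by (simp add: c_def)
  \<comment> \<open>This choice of t makes the linear term dominate the quadratic one; the added 1
    avoids division by zero.\<close>
  have "2 * (s / (c + 1)) * s \<le> (s / (c + 1))\<^sup>2 * c" using quad[of "s / (c + 1)"] by (simp add: c_def s_def)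
  then have "2 * s\<^sup>2 / (c + 1) * (c + 1)\<^sup>2 \<le> (s / (c + 1))\<^sup>2 * c * (c + 1)\<^sup>2"
    by (intro mult_right_mono) (auto simp: power2_eq_square)
  then have "2 * s\<^sup>2 * (c + 1) \<le> s\<^sup>2 * c"
    using c0 by (simp add: power_divide power2_eq_square)
  then have "s\<^sup>2 * (c + 2) \<le> 0" by (simp add: algebra_simps)
  moreover have "s\<^sup>2 * (c + 2) > 0" using ne c0 by (simp add: s_def)
  ultimately show False by simp
qed

text \<open>Induction on the dimension: take a unit vector of \<open>V\<close> with the longest
  image and continue in its orthogonal complement inside \<open>V\<close>, whose images are
  orthogonal to that of the chosen vector. On the whole space the result is an eigenbasis of A^T
  A.\<close>

lemma orthonormal_basis_with_orthogonal_images: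
  fixes A :: "'a::euclidean_space \<Rightarrow> 'b::euclidean_space"
  assumes A: "linear A" and "subspace V"
  shows "\<exists>W. finite W \<and> W \<subseteq> V \<and> V \<subseteq> span W \<and> pairwise orthogonal W \<and> (\<forall>w\<in>W. norm w = 1) \<and>
    pairwise (\<lambda>v w. A v \<bullet> A w = 0) W"
  using \<open>subspace V\<close>
proof (induction "dim V" arbitrary: V rule: less_induct)
  case less
  note V = less.prems
  show ?case
  proof (cases "V \<subseteq> {0}")
    case True
    then show ?thesis by (intro exI[of _ "{}"]) auto
  next
    case False
    then obtain x0 where x0: "x0 \<in> V" "x0 \<noteq> 0" by blast
    have "(1 / norm x0) *\<^sub>R x0 \<in> sphere 0 1 \<inter> V" using x0 V by (auto simp: subspace_scale)
    then have ne: "sphere 0 1 \<inter> V \<noteq> {}" by blast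
    have "compact (sphere 0 1 \<inter> V)" by (intro compact_Int_closed closed_subspace V) simp
    moreover have "continuous_on (sphere 0 1 \<inter> V) (\<lambda>x. norm (A x))"
      by (intro continuous_intros linear_continuous_on linear_conv_bounded_linear[THEN iffD1] A)
    ultimately obtain w where w: "w \<in> sphere 0 1 \<inter> V"
      and max: "\<forall>x\<in>sphere 0 1 \<inter> V. norm (A x) \<le> norm (A w)"
      using continuous_attains_sup[OF _ ne] by blast
    define V' where "V' = {v \<in> V. v \<bullet> w = 0}"
    have V': "subspace V'" using V by (auto simp: V'_def subspace_def inner_add_left)
    have w1: "w \<in> V" "norm w = 1" using w by auto
    have "w \<notin> V'" using w1 by (auto simp: V'_def)
    moreover have "V' \<subseteq> V" by (auto simp: V'_def)
    ultimately have "V' \<subset> V" using w1(1) by blast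
    then have "dim V' < dim V"
      using V V' by (intro dim_psubset) (simp add: span_eq_iff[THEN iffD2])
    from less.hyps[OF this V'] obtain W where W: "finite W" "W \<subseteq> V'" "V' \<subseteq> span W" "pairwise orthogonal W"
      "\<forall>w\<in>W. norm w = 1" "pairwise (\<lambda>v w. A v \<bullet> A w = 0) W" by blast
    have Aw: "A w \<bullet> A v = 0" if "v \<in> V'" for v
      by (rule orthogonal_image_if_maximal[OF A V w1]) (use max that in \<open>auto simp: V'_def\<close>)
    show ?thesis
    proof (intro exI[of _ "insert w W"] conjI)
      show "insert w W \<subseteq> V" using w1 W(2) by (auto simp: V'_def)
      show "V \<subseteq> span (insert w W)"
      proof
        fix v assume v: "v \<in> V"
        have "(v - (v \<bullet> w) *\<^sub>R w) \<in> V'"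
          using v w1 V by (simp add: V'_def subspace_diff subspace_scale inner_diff_left norm_eq_1)
        then have "v - (v \<bullet> w) *\<^sub>R w \<in> span W" using W(3) by blast
        then show "v \<in> span (insert w W)" by (auto simp: span_breakdown_eq)
      qed
      show "pairwise orthogonal (insert w W)"
        using W(2,4) by (auto simp: pairwise_insert V'_def orthogonal_def inner_commute)
      show "pairwise (\<lambda>v w. A v \<bullet> A w = 0) (insert w W)"
        using W(2,6) Aw by (auto simp: pairwise_insert inner_commute)
    qed (use W w1 in auto)
  qed
qed

lemma card_orthonormal_basis:
  fixes W :: "'a::euclidean_space set"
  assumes "pairwise orthogonal W" "\<forall>w\<in>W. norm w = 1" "span W = UNIV"
  shows "card W = DIM('a)"
proof -
  have "independent W" using assms(1,2) by (intro pairwise_orthogonal_independent) auto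
  then have "card W = dim (span W)" by (simp add: dim_eq_card_independent)
  then show ?thesis using assms(3) by (simp)
qed

lemma orthonormal_extend:
  fixes U :: "'a::euclidean_space set"
  assumes U: "finite U" "pairwise orthogonal U" "\<forall>u\<in>U. norm u = 1"
  obtains U' where "U \<subseteq> U'" "pairwise orthogonal U'" "\<forall>u\<in>U'. norm u = 1" "finite U'" "card U' = DIM('a)"
proof -
  define V where "V = {x. \<forall>u\<in>U. u \<bullet> x = 0}"
  have V: "subspace V" by (auto simp: V_def subspace_def inner_add_right)
  obtain B where B: "B \<subseteq> V" "pairwise orthogonal B" "\<And>x. x \<in> B \<Longrightarrow> norm x = 1" "span B = V"
    using orthonormal_basis_subspace[OF V] by metis
  have orth: "pairwise orthogonal (U \<union> B)"
    unfolding pairwise_def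
  proof (intro ballI impI)
    fix x y assume "x \<in> U \<union> B" "y \<in> U \<union> B" "x \<noteq> y"
    then show "orthogonal x y"
      using U(2) B(1,2) by (auto simp: pairwise_def V_def orthogonal_def inner_commute subset_eq)
  qed
  have nrm: "\<forall>u\<in>U \<union> B. norm u = 1" using U(3) B(3) by auto
  have "x \<in> span (U \<union> B)" for x
  proof -
    define y where "y = (\<Sum>u\<in>U. (u \<bullet> x) *\<^sub>R u)"
    have "v \<bullet> (x - y) = 0" if v: "v \<in> U" for v
    proof -
      have "v \<bullet> y = (\<Sum>u\<in>U. (u \<bullet> x) * (v \<bullet> u))" by (simp add: y_def inner_sum_right)
      also have "\<dots> = (\<Sum>u\<in>U. if u = v then v \<bullet> x else 0)"
      proof (rule sum.cong)
        fix u assume u: "u \<in> U"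
        show "(u \<bullet> x) * (v \<bullet> u) = (if u = v then v \<bullet> x else 0)"
          using U(2,3) u v by (auto simp: pairwise_def orthogonal_def norm_eq_1 inner_commute)
      qed simp
      also have "\<dots> = v \<bullet> x" using v U(1) by simp
      finally show ?thesis by (simp add: inner_diff_right)
    qed
    then have "x - y \<in> span B" unfolding B(4) V_def by blast
    then have "x - y \<in> span (U \<union> B)" using span_mono[of B "U \<union> B"] by blast
    moreover have "y \<in> span (U \<union> B)" unfolding y_def by (intro span_sum span_scale span_base) auto
    ultimately show ?thesis by (metis diff_add_cancel span_add)
  qed
  then have sp: "span (U \<union> B) = UNIV" by blast
  have "card (U \<union> B) = DIM('a)" by (rule card_orthonormal_basis[OF orth nrm sp])
  moreover from this have "finite (U \<union> B)" by (metis card.infinite DIM_positive less_numeral_extra(3))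
  ultimately show ?thesis using orth nrm by (intro that[of "U \<union> B"]) auto
qed

section \<open>Orthogonal matrices assembled from numbered orthonormal rows\<close>

lemma card_coord_no_le:
  assumes "h \<le> CARD('d::{finite,linorder})"
  shows "card {i::'d. coord_no i \<le> h} = h"
proof -
  have "coord_no ` {i::'d. coord_no i \<le> h} = {1..h}"
  proof (intro set_eqI iffI)
    fix k assume "k \<in> coord_no ` {i::'d. coord_no i \<le> h}"
    then show "k \<in> {1..h}" using bij_betwE[OF bij_betw_coord_no] by fastforce
  next
    fix k assume "k \<in> {1..h}"
    then have "coord_no (coord_at k :: 'd) = k" using assms by (intro coord_no_coord_at) auto
    with \<open>k \<in> {1..h}\<close> show "k \<in> coord_no ` {i::'d. coord_no i \<le> h}" by (intro image_eqI[of _ _ "coord_at k"]) auto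
  qed
  moreover have "inj_on coord_no {i::'d. coord_no i \<le> h}"
    using bij_betw_imp_inj_on[OF bij_betw_coord_no] by (rule inj_on_subset) simp
  ultimately show ?thesis using card_image by fastforce
qed

lemma orthogonal_matrix_rows:
  fixes r :: "'n::finite \<Rightarrow> real ^ 'n"
  assumes "inj r" "range r \<subseteq> U" "pairwise orthogonal U" "\<forall>u\<in>U. norm u = 1"
  shows "orthogonal_matrix (\<chi> i. r i)"
proof -
  have "row i (\<chi> i. r i) = r i" for i by (simp add: row_def vec_eq_iff)
  moreover have "orthogonal (r i) (r j)" if "i \<noteq> j" for i j
  proof -
    have "r i \<noteq> r j" using that assms(1) by (auto dest: injD)
    then show ?thesis using assms(2) by (intro pairwiseD[OF assms(3)]) auto
  qed
  moreover have "norm (r i) = 1" for i using assms(2,4) by auto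
  ultimately show ?thesis
    unfolding orthogonal_matrix_orthonormal_rows by simp
qed

text \<open>The rows of \<open>OY\<close> are the left singular vectors, the normalised nonzero
  images under the transpose of \<open>M\<close> are the first rows of \<open>OX\<close>, and
  \<open>h\<close> counts those images.\<close>

lemma singular_value_decomposition:
  fixes M :: "real ^ 'n::{finite,linorder} ^ 'd::{finite,linorder}"
  assumes dn: "CARD('d) \<le> CARD('n)"
  obtains OX OY h and S :: "real ^ 'd::{finite,linorder} ^ 'd::{finite,linorder}" where "orthogonal_matrix OX" "orthogonal_matrix OY" "h \<le> CARD('d)" "pos_diagonal h S"
    "\<And>x. OY *v (M *v x) = S *v first_block h (proj_first (OX *v x))"
proof -
  \<comment> \<open>Starting from the transpose puts the full basis in the space of dimension d;
    only the images have to be completed to a basis in dimension n.\<close>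
  define A where "A w = transpose M *v w" for w
  have A: "linear A" unfolding A_def by (rule matrix_vector_mul_linear)
  obtain W where W: "finite W" "UNIV \<subseteq> span W" "pairwise orthogonal W" "\<forall>w\<in>W. norm w = 1"
    "pairwise (\<lambda>v w. A v \<bullet> A w = 0) W"
    using orthonormal_basis_with_orthogonal_images[OF A subspace_UNIV] by blast
  have cW: "card W = CARD('d)" using card_orthonormal_basis[of W] W by auto
  define W1 where "W1 = {w \<in> W. A w \<noteq> 0}"
  define h where "h = card W1"
  have W1: "W1 \<subseteq> W" "finite W1" using W(1) by (auto simp: W1_def)
  have h: "h \<le> CARD('d)" unfolding h_def cW[symmetric] by (rule card_mono[OF W(1) W1(1)])
  let ?I = "{i::'d. coord_no i \<le> h}"
  have "card ?I = card W1" using card_coord_no_le[OF h] by (simp add: h_def)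
  then obtain f1 where f1: "bij_betw f1 ?I W1" using finite_same_card_bij[of ?I W1] W1 by auto
  have "card (- ?I) = card (W - W1)"
    using W(1) W1 cW card_coord_no_le[OF h] by (simp add: card_Diff_subset h_def Compl_eq_Diff_UNIV)
  then obtain f2 where f2: "bij_betw f2 (- ?I) (W - W1)" using finite_same_card_bij[of "- ?I" "W - W1"] W by auto
  \<comment> \<open>Numbers the basis so that the vectors with nonzero image come first, as the
    shape of \<open>pos_diagonal\<close> demands.\<close>
  define w where "w i = (if coord_no i \<le> h then f1 i else f2 i)" for i
  have w1: "w i \<in> W1" if "coord_no i \<le> h" for i using bij_betwE[OF f1] that by (simp add: w_def)
  have w2: "w i \<in> W - W1" if "\<not> coord_no i \<le> h" for i using bij_betwE[OF f2] that by (simp add: w_def)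
  have wW: "w i \<in> W" for i using w1[of i] w2[of i] W1 by blast
  have "inj w"
  proof (rule injI)
    fix i j assume eq: "w i = w j"
    then have "coord_no i \<le> h \<longleftrightarrow> coord_no j \<le> h" using w1[of i] w1[of j] w2[of i] w2[of j] by force
    then show "i = j"
      using eq bij_betw_imp_inj_on[OF f1] bij_betw_imp_inj_on[OF f2]
      by (cases "coord_no i \<le> h") (auto simp: w_def inj_on_def)
  qed
  define OY where "OY = (\<chi> i. w i)"
  have OY: "orthogonal_matrix OY"
    unfolding OY_def by (rule orthogonal_matrix_rows[OF \<open>inj w\<close> _ W(3,4)]) (use wW in auto)
  define \<sigma> where "\<sigma> i = norm (A (w i))" for i
  have \<sigma>: "\<sigma> i > 0" if "coord_no i \<le> h" for i using w1[OF that] by (simp add: \<sigma>_def W1_def)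
  define u where "u i = (1 / \<sigma> i) *\<^sub>R A (w i)" for i
  have u_norm: "norm (u i) = 1" if "coord_no i \<le> h" for i using \<sigma>[OF that] by (simp add: u_def \<sigma>_def)
  have u_orth: "u i \<bullet> u j = 0" if "i \<noteq> j" for i j
  proof -
    have "w i \<noteq> w j" using that \<open>inj w\<close> by (auto dest: injD)
    then show ?thesis using W(5) wW by (simp add: u_def pairwise_def)
  qed
  define U1 where "U1 = u ` ?I"
  have u_inj: "inj_on u ?I"
  proof (rule inj_onI)
    fix i j assume ij: "i \<in> ?I" "j \<in> ?I" "u i = u j"
    show "i = j"
    proof (rule ccontr)
      assume "i \<noteq> j"
      then have "u i \<bullet> u i = 0" using u_orth[of i j] ij(3) by simp
      then show False using u_norm[of i] ij(1) by simp
    qed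
  qed
  have cU1: "card U1 = h" unfolding U1_def using card_image[OF u_inj] card_coord_no_le[OF h] by simp
  have "pairwise orthogonal U1" unfolding U1_def pairwise_def orthogonal_def using u_orth by (metis imageE)
  moreover have "\<forall>u\<in>U1. norm u = 1" using u_norm by (auto simp: U1_def)
  moreover have "finite U1" by (simp add: U1_def)
  ultimately obtain U where U: "U1 \<subseteq> U" "pairwise orthogonal U" "\<forall>u\<in>U. norm u = 1" "finite U" "card U = CARD('n)"
    using orthonormal_extend[of U1] by (metis DIM_cart DIM_real mult.right_neutral)
  let ?J = "{j::'n. coord_no j \<le> h}"
  have hn: "h \<le> CARD('n)" using h dn by simp
  have "card (- ?J) = card (U - U1)"
    using U cU1 card_coord_no_le[OF hn] \<open>finite U1\<close> by (simp add: card_Diff_subset Compl_eq_Diff_UNIV)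
  then obtain g where g: "bij_betw g (- ?J) (U - U1)" using finite_same_card_bij[of "- ?J" "U - U1"] U by auto
  \<comment> \<open>Up to \<open>h\<close> the rows are carried over from index type 'd to 'n
    through the common coordinate number; the remaining rows come from the orthonormal
    completion.\<close>
  define r where "r j = (if coord_no j \<le> h then u (coord_at (coord_no j)) else g j)" for j
  have cat: "coord_no (coord_at (coord_no j) :: 'd) = coord_no j" if "coord_no j \<le> h" for j :: 'n
    using that h bspec[OF bij_betwE[OF bij_betw_coord_no], of j] by (intro coord_no_coord_at) auto
  have r1: "r j \<in> U1" if "coord_no j \<le> h" for j
    using that cat[OF that] by (simp add: r_def U1_def)
  have r2: "r j \<in> U - U1" if "\<not> coord_no j \<le> h" for j using bij_betwE[OF g] that by (simp add: r_def)
  have rU: "r j \<in> U" for j using r1[of j] r2[of j] U by blast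
  have "inj r"
  proof (rule injI)
    fix i j assume eq: "r i = r j"
    then have iff: "coord_no i \<le> h \<longleftrightarrow> coord_no j \<le> h" using r1[of i] r1[of j] r2[of i] r2[of j] by force
    show "i = j"
    proof (cases "coord_no i \<le> h")
      case True
      then have "(coord_at (coord_no i) :: 'd) = coord_at (coord_no j)"
        using eq iff cat by (intro inj_onD[OF u_inj]) (auto simp: r_def)
      then have "coord_no i = coord_no j" using cat[of i] cat[of j] True iff by simp
      then show ?thesis using bij_betw_imp_inj_on[OF bij_betw_coord_no] by (auto dest: injD)
    next
      case False
      then show ?thesis using eq iff bij_betw_imp_inj_on[OF g] by (auto simp: r_def inj_on_def)
    qed
  qed
  define OX where "OX = (\<chi> j. r j)"
  have OX: "orthogonal_matrix OX"
    unfolding OX_def by (rule orthogonal_matrix_rows[OF \<open>inj r\<close> _ U(2,3)]) (use rU in auto)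
  define S where "S = (\<chi> i j. if i = j \<and> coord_no i \<le> h then \<sigma> i else 0)"
  have S: "pos_diagonal h S" using \<sigma> by (auto simp: pos_diagonal_def S_def)
  have "OY *v (M *v x) = S *v first_block h (proj_first (OX *v x))" for x
  proof (subst vec_eq_iff, intro allI)
    fix i
    have L: "(OY *v (M *v x)) $ i = A (w i) \<bullet> x"
      unfolding matrix_vector_mul_component OY_def A_def by (simp add: dot_lmul_matrix transpose_matrix_vector)
    have R: "(S *v v) $ i = (if coord_no i \<le> h then \<sigma> i else 0) * v $ i" for v
      by (simp add: matrix_vector_mult_def S_def if_distrib[of "\<lambda>c. c * _"] sum.delta' cong: if_cong)
    show "(OY *v (M *v x)) $ i = (S *v first_block h (proj_first (OX *v x))) $ i"
    proof (cases "coord_no i \<le> h")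
      case True
      have "coord_no (coord_at (coord_no i) :: 'n) = coord_no i"
        using bspec[OF bij_betwE[OF bij_betw_coord_no], of i] dn by (intro coord_no_coord_at) auto
      then have "(proj_first (OX *v x)) $ i = u i \<bullet> x"
        using True by (simp add: proj_first_def matrix_vector_mul_component OX_def r_def)
      then show ?thesis using True \<sigma>[OF True] by (simp add: L R first_block_def u_def)
    next
      case False
      then have "A (w i) = 0" using w2[OF False] wW[of i] by (auto simp: W1_def)
      then show ?thesis using False by (simp add: L R)
    qed
  qed
  then show ?thesis using OX OY h S that by blast
qed

section \<open>The inner product Gromov--Wasserstein cost\<close>

lemma borel_measurable_vec_nth_comp [measurable (raw)]:
  fixes f :: "'a \<Rightarrow> real ^ 'n"
  assumes "f \<in> borel_measurable M"
  shows "(\<lambda>x. f x $ i) \<in> borel_measurable M"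
  by (rule measurable_compose[OF assms]) (intro borel_measurable_continuous_onI continuous_intros)

lemma borel_measurable_matrix_vector_mult_comp [measurable (raw)]:
  fixes A :: "real ^ 'n ^ 'm"
  assumes "f \<in> borel_measurable M"
  shows "(\<lambda>x. A *v f x) \<in> borel_measurable M"
  by (rule measurable_compose[OF assms]) (intro borel_measurable_continuous_onI matrix_vector_mult_linear_continuous_on)

text \<open>Every point outside the support has a null neighbourhood from a countable basis, so the
  complement lies in a countable union of null sets.\<close>

lemma AE_msupport:
  fixes M :: "'a::second_countable_topology measure"
  assumes sets: "sets M = sets borel"
  shows "AE x in M. x \<in> msupport M"
proof -
  obtain B :: "'a set set" where B: "countable B" "topological_basis B"
    using ex_countable_basis by blast
  have "(\<Union>U\<in>{U \<in> B. emeasure M U = 0}. U) \<in> null_sets M"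
    using B(1) by (intro null_sets_UN') (auto simp: sets intro!: null_setsI borel_open topological_basis_open[OF B(2)])
  moreover have "{x \<in> space M. x \<notin> msupport M} \<subseteq> (\<Union>U\<in>{U \<in> B. emeasure M U = 0}. U)"
  proof
    fix x assume "x \<in> {x \<in> space M. x \<notin> msupport M}"
    then obtain U where U: "open U" "x \<in> U" "emeasure M U = 0" by (auto simp: msupport_def)
    then obtain V where V: "V \<in> B" "x \<in> V" "V \<subseteq> U" using topological_basisE[OF B(2)] by metis
    have "emeasure M V \<le> emeasure M U" using U(1) by (intro emeasure_mono V(3)) (simp add: sets)
    with U V show "x \<in> (\<Union>U\<in>{U \<in> B. emeasure M U = 0}. U)" by auto
  qed
  ultimately show ?thesis by (rule AE_I')
qed

text \<open>Guarantees that the set over which \<open>C\<close> is chosen is nonempty.\<close>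

lemma couplings_pair_measure:
  assumes "prob_space \<mu>" "prob_space \<nu>"
  shows "\<mu> \<Otimes>\<^sub>M \<nu> \<in> couplings \<mu> \<nu>"
proof -
  interpret \<mu>: prob_space \<mu> by fact
  interpret \<nu>: prob_space \<nu> by fact
  interpret P: pair_prob_space \<mu> \<nu> ..
  have "distr (\<mu> \<Otimes>\<^sub>M \<nu>) \<mu> fst = \<mu>"
  proof (rule measure_eqI)
    fix A assume A: "A \<in> sets (distr (\<mu> \<Otimes>\<^sub>M \<nu>) \<mu> fst)"
    then have "fst -` A \<inter> space (\<mu> \<Otimes>\<^sub>M \<nu>) = A \<times> space \<nu>"
      using sets.sets_into_space[of A \<mu>] by (auto simp: space_pair_measure)
    then show "emeasure (distr (\<mu> \<Otimes>\<^sub>M \<nu>) \<mu> fst) A = emeasure \<mu> A"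
      using A by (simp add: emeasure_distr \<nu>.emeasure_pair_measure_Times \<nu>.emeasure_space_1)
  qed simp
  moreover have "distr (\<mu> \<Otimes>\<^sub>M \<nu>) \<nu> snd = \<nu>"
  proof (rule measure_eqI)
    fix A assume A: "A \<in> sets (distr (\<mu> \<Otimes>\<^sub>M \<nu>) \<nu> snd)"
    then have "snd -` A \<inter> space (\<mu> \<Otimes>\<^sub>M \<nu>) = space \<mu> \<times> A"
      using sets.sets_into_space[of A \<nu>] by (auto simp: space_pair_measure)
    then show "emeasure (distr (\<mu> \<Otimes>\<^sub>M \<nu>) \<nu> snd) A = emeasure \<nu> A"
      using A by (simp add: emeasure_distr \<nu>.emeasure_pair_measure_Times \<mu>.emeasure_space_1)
  qed simp
  ultimately show ?thesis
    using P.prob_space_axioms by (simp add: couplings_def)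
qed

locale bounded_marginals = M: prob_space \<mu> + N: prob_space \<nu>
  for \<mu> :: "(real ^ 'n) measure" and \<nu> :: "(real ^ 'd) measure" +
  fixes r :: real
  assumes sets_\<mu> [measurable_cong]: "sets \<mu> = sets borel" and sets_\<nu> [measurable_cong]: "sets \<nu> = sets borel"
    and bound_\<mu>: "AE x in \<mu>. norm x \<le> r" and bound_\<nu>: "AE y in \<nu>. norm y \<le> r"
begin

lemma r_nonneg: "0 \<le> r"
proof (rule ccontr)
  assume "\<not> 0 \<le> r"
  then have "AE x in \<mu>. False"
    using bound_\<mu> by (elim eventually_mono) (use norm_ge_zero order_trans in blast)
  then show False by simp
qed

lemma couplingsD:
  assumes "\<pi> \<in> couplings \<mu> \<nu>"
  shows "prob_space \<pi>" "sets \<pi> = sets (borel \<Otimes>\<^sub>M borel)"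
    "distr \<pi> \<mu> fst = \<mu>" "distr \<pi> \<nu> snd = \<nu>"
    "AE p in \<pi>. norm (fst p) \<le> r" "AE p in \<pi>. norm (snd p) \<le> r"
proof -
  show *: "prob_space \<pi>" "sets \<pi> = sets (borel \<Otimes>\<^sub>M borel)" "distr \<pi> \<mu> fst = \<mu>" "distr \<pi> \<nu> snd = \<nu>"
    using assms sets_pair_measure_cong[OF sets_\<mu> sets_\<nu>] by (auto simp: couplings_def)
  note [measurable_cong] = *(2)
  have "AE x in distr \<pi> \<mu> fst. norm x \<le> r" "AE x in distr \<pi> \<nu> snd. norm x \<le> r"
    unfolding * by (rule bound_\<mu>, rule bound_\<nu>)
  then show "AE p in \<pi>. norm (fst p) \<le> r" "AE p in \<pi>. norm (snd p) \<le> r"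
    by (subst (asm) (1 2) AE_distr_iff; measurable)+
qed

definition cross :: "((real ^ 'n) \<times> (real ^ 'd)) measure \<Rightarrow> real ^ 'n ^ 'd" where
  "cross \<pi> = (\<chi> i j. \<integral>p. snd p $ i * fst p $ j \<partial>\<pi>)"

context
  fixes \<pi> assumes \<pi>: "\<pi> \<in> couplings \<mu> \<nu>"
begin

lemma entry_bound: "AE p in \<pi>. \<bar>snd p $ i * fst p $ j\<bar> \<le> r * r"
  using couplingsD(5,6)[OF \<pi>]
proof eventually_elim
  case (elim p)
  show ?case
    unfolding abs_mult using elim component_le_norm_cart[of "fst p" j] component_le_norm_cart[of "snd p" i] r_nonneg
    by (intro mult_mono) auto
qed

lemma entry_integrable: "integrable \<pi> (\<lambda>p. snd p $ i * fst p $ j)"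
proof -
  interpret prob_space \<pi> by (rule couplingsD[OF \<pi>])
  note [measurable_cong] = couplingsD(2)[OF \<pi>]
  show ?thesis
    by (rule integrable_const_bound[where B="r * r"]) (use entry_bound in simp, measurable)
qed

lemma inner_matrix_eq:
  "y \<bullet> (N *v x) = (\<Sum>i\<in>UNIV. \<Sum>j\<in>UNIV. N $ i $ j * (y $ i * x $ j))"
  for x :: "real ^ 'n" and y :: "real ^ 'd"
  by (simp add: inner_vec_def matrix_vector_mult_def sum_distrib_left algebra_simps)

lemma integral_bilinear:
  "integrable \<pi> (\<lambda>p. snd p \<bullet> (N *v fst p))"
  "(\<integral>p. snd p \<bullet> (N *v fst p) \<partial>\<pi>) = N \<bullet> cross \<pi>"
  unfolding inner_matrix_eq using entry_integrable
  by (auto simp: inner_vec_def cross_def intro!: integrable_sum)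

lemma integral_product:
  "integrable \<pi> (\<lambda>p. (y \<bullet> snd p) * (x \<bullet> fst p))"
  "(\<integral>p. (y \<bullet> snd p) * (x \<bullet> fst p) \<partial>\<pi>) = y \<bullet> (cross \<pi> *v x)"
proof -
  define N :: "real ^ 'n ^ 'd" where "N = (\<chi> i j. y $ i * x $ j)"
  have eq: "(y \<bullet> snd p) * (x \<bullet> fst p) = snd p \<bullet> (N *v fst p)" for p :: "(real ^ 'n) \<times> (real ^ 'd)"
    unfolding inner_matrix_eq by (simp add: N_def inner_vec_def sum_product algebra_simps)
  show "integrable \<pi> (\<lambda>p. (y \<bullet> snd p) * (x \<bullet> fst p))"
    unfolding eq by (rule integral_bilinear)
  show "(\<integral>p. (y \<bullet> snd p) * (x \<bullet> fst p) \<partial>\<pi>) = y \<bullet> (cross \<pi> *v x)"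
  proof -
    have "(\<integral>p. (y \<bullet> snd p) * (x \<bullet> fst p) \<partial>\<pi>) = N \<bullet> cross \<pi>"
      unfolding eq by (rule integral_bilinear)
    also have "\<dots> = y \<bullet> (cross \<pi> *v x)"
      unfolding inner_matrix_eq by (simp add: N_def inner_vec_def algebra_simps)
    finally show ?thesis .
  qed
qed

lemma norm_cross_le: "norm (cross \<pi>) \<le> real CARD('d) * (real CARD('n) * (r * r))"
proof -
  interpret prob_space \<pi> by (rule couplingsD[OF \<pi>])
  have e: "\<bar>cross \<pi> $ i $ j\<bar> \<le> r * r" for i j
  proof -
    have "\<bar>cross \<pi> $ i $ j\<bar> \<le> (\<integral>p. \<bar>snd p $ i * fst p $ j\<bar> \<partial>\<pi>)"
      unfolding cross_def by simp
    also have "\<dots> \<le> r * r" 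
      by (intro integral_le_const integrable_abs entry_integrable entry_bound)
    finally show ?thesis .
  qed
  have "norm (cross \<pi> $ i) \<le> real CARD('n) * (r * r)" for i
  proof -
    have "norm (cross \<pi> $ i) \<le> (\<Sum>j\<in>UNIV. \<bar>cross \<pi> $ i $ j\<bar>)" by (rule norm_le_l1_cart)
    also have "\<dots> \<le> (\<Sum>j\<in>(UNIV::'n set). r * r)" by (intro sum_mono e)
    finally show ?thesis by simp
  qed
  then have "(\<Sum>i\<in>UNIV. norm (cross \<pi> $ i)) \<le> real CARD('d) * (real CARD('n) * (r * r))"
    using sum_bounded_above[of UNIV "\<lambda>i. norm (cross \<pi> $ i)"] by simp
  then show ?thesis
    using L2_set_le_sum[of UNIV "\<lambda>i. norm (cross \<pi> $ i)"] by (simp add: norm_vec_def)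
qed

end

lemma square_integral:
  fixes K :: "('a::euclidean_space) measure"
  assumes K: "prob_space K" and [measurable_cong]: "sets K = sets borel" and b: "AE x in K. norm x \<le> r"
  shows "integrable K (\<lambda>x'. (x \<bullet> x')\<^sup>2)" "integrable K (\<lambda>x. \<integral>x'. (x \<bullet> x')\<^sup>2 \<partial>K)"
proof -
  interpret K: prob_space K by fact
  have bd: "AE x' in K. (x \<bullet> x')\<^sup>2 \<le> (norm x * r)\<^sup>2" for x
    using b
  proof eventually_elim
    case (elim x')
    have "\<bar>x \<bullet> x'\<bar> \<le> norm x * norm x'" by (rule Cauchy_Schwarz_ineq2)
    also have "\<dots> \<le> norm x * r" using elim by (intro mult_left_mono) auto
    finally show ?case by (simp add: abs_le_square_iff[symmetric])
  qed
  show i: "integrable K (\<lambda>x'. (x \<bullet> x')\<^sup>2)" for x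
    by (rule K.integrable_const_bound[where B="(norm x * r)\<^sup>2"]) (use bd in simp, measurable)
  show "integrable K (\<lambda>x. \<integral>x'. (x \<bullet> x')\<^sup>2 \<partial>K)"
  proof (rule K.integrable_const_bound[where B="(r * r)\<^sup>2"])
    show "AE x in K. norm (\<integral>x'. (x \<bullet> x')\<^sup>2 \<partial>K) \<le> (r * r)\<^sup>2"
      using b
    proof eventually_elim
      case (elim x)
      have "(\<integral>x'. (x \<bullet> x')\<^sup>2 \<partial>K) \<le> (norm x * r)\<^sup>2" by (rule K.integral_le_const[OF i bd])
      also have "\<dots> \<le> (r * r)\<^sup>2" using elim r_nonneg by (intro power_mono mult_right_mono) auto
      finally show ?case by simp
    qed
    show "(\<lambda>x. \<integral>x'. (x \<bullet> x')\<^sup>2 \<partial>K) \<in> borel_measurable K" by measurable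
  qed
qed

text \<open>The two square terms depend only on the marginals. In the mixed term the inner integral
  replaces y' x'^T by \<open>cross \<pi>\<close>, and the outer integral pairs
  \<open>cross \<pi>\<close> with itself.\<close>

lemma gw_cost_eq:
  assumes \<pi>: "\<pi> \<in> couplings \<mu> \<nu>"
  shows "gw_cost \<pi> = ennreal ((\<integral>x. \<integral>x'. (x \<bullet> x')\<^sup>2 \<partial>\<mu> \<partial>\<mu>) + (\<integral>y. \<integral>y'. (y \<bullet> y')\<^sup>2 \<partial>\<nu> \<partial>\<nu>) - 2 * (norm (cross \<pi>))\<^sup>2)"
proof -
  interpret \<pi>: prob_space \<pi> by (rule couplingsD[OF \<pi>])
  note [measurable_cong] = couplingsD(2)[OF \<pi>]
  have fs [measurable]: "fst \<in> measurable \<pi> \<mu>" "snd \<in> measurable \<pi> \<nu>" by measurable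
  define Q1 where "Q1 x = (\<integral>x'. (x \<bullet> x')\<^sup>2 \<partial>\<mu>)" for x
  define Q2 where "Q2 y = (\<integral>y'. (y \<bullet> y')\<^sup>2 \<partial>\<nu>)" for y
  note s1 = square_integral[OF M.prob_space_axioms sets_\<mu> bound_\<mu>]
    and s2 = square_integral[OF N.prob_space_axioms sets_\<nu> bound_\<nu>]
  have f1: "integrable \<pi> (\<lambda>p. f (fst p))" "(\<integral>p. f (fst p) \<partial>\<pi>) = (\<integral>x. f x \<partial>\<mu>)" if "integrable \<mu> f" for f :: "_ \<Rightarrow> real"
    using that integrable_distr[OF fs(1), of f] integral_distr[OF fs(1), of f] by (auto simp: couplingsD(3)[OF \<pi>])
  have f2: "integrable \<pi> (\<lambda>p. f (snd p))" "(\<integral>p. f (snd p) \<partial>\<pi>) = (\<integral>x. f x \<partial>\<nu>)" if "integrable \<nu> f" for f :: "_ \<Rightarrow> real"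
    using that integrable_distr[OF fs(2), of f] integral_distr[OF fs(2), of f] by (auto simp: couplingsD(4)[OF \<pi>])
  define q where "q p = Q1 (fst p) + Q2 (snd p) - 2 * (snd p \<bullet> (cross \<pi> *v fst p))" for p
  have inner: "(\<integral>\<^sup>+p'. ennreal (\<bar>fst p \<bullet> fst p' - snd p \<bullet> snd p'\<bar>\<^sup>2) \<partial>\<pi>) = ennreal (q p)" "0 \<le> q p" for p
  proof -
    have eq: "\<bar>fst p \<bullet> fst p' - snd p \<bullet> snd p'\<bar>\<^sup>2 = (fst p \<bullet> fst p')\<^sup>2 + (snd p \<bullet> snd p')\<^sup>2 - 2 * ((snd p \<bullet> snd p') * (fst p \<bullet> fst p'))" for p'
      by (simp add: power2_diff)
    note i = f1[OF s1(1)[of "fst p"]] f2[OF s2(1)[of "snd p"]] integral_product[OF \<pi>, of "snd p" "fst p"]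
    have int: "integrable \<pi> (\<lambda>p'. \<bar>fst p \<bullet> fst p' - snd p \<bullet> snd p'\<bar>\<^sup>2)"
      unfolding eq using i by simp
    have "(\<integral>p'. \<bar>fst p \<bullet> fst p' - snd p \<bullet> snd p'\<bar>\<^sup>2 \<partial>\<pi>) = q p"
      unfolding eq using i by (simp add: q_def Q1_def Q2_def)
    moreover have "0 \<le> (\<integral>p'. \<bar>fst p \<bullet> fst p' - snd p \<bullet> snd p'\<bar>\<^sup>2 \<partial>\<pi>)" by simp
    ultimately show "(\<integral>\<^sup>+p'. ennreal (\<bar>fst p \<bullet> fst p' - snd p \<bullet> snd p'\<bar>\<^sup>2) \<partial>\<pi>) = ennreal (q p)" "0 \<le> q p"
      using nn_integral_eq_integral[OF int] by simp_all
  qed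
  have iq: "integrable \<pi> q" "(\<integral>p. q p \<partial>\<pi>) = (\<integral>x. Q1 x \<partial>\<mu>) + (\<integral>y. Q2 y \<partial>\<nu>) - 2 * (cross \<pi> \<bullet> cross \<pi>)"
    using f1[OF s1(2)] f2[OF s2(2)] integral_bilinear[OF \<pi>, of "cross \<pi>"]
    by (auto simp: q_def[abs_def] Q1_def Q2_def)
  have "gw_cost \<pi> = (\<integral>\<^sup>+p. ennreal (q p) \<partial>\<pi>)"
    unfolding gw_cost_def split_beta' inner(1) ..
  also have "\<dots> = ennreal (\<integral>p. q p \<partial>\<pi>)"
    using iq(1) inner(2) by (intro nn_integral_eq_integral) auto
  finally show ?thesis unfolding iq(2) by (simp add: Q1_def[abs_def] Q2_def[abs_def] power2_norm_eq_inner)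
qed

text \<open>The norm attains its maximum on the compact closure. The half-space of matrices D with
  \<langle>C, D\<rangle> <= c is closed, so a bound valid on the couplings also holds at D = C; this
  substitutes for a coupling that realises \<open>C\<close>.\<close>

lemma maximal_cross_limit:
  obtains C where "\<And>\<pi>. \<pi> \<in> couplings \<mu> \<nu> \<Longrightarrow> norm (cross \<pi>) \<le> norm C"
    "\<And>c. (\<And>\<pi>. \<pi> \<in> couplings \<mu> \<nu> \<Longrightarrow> C \<bullet> cross \<pi> \<le> c) \<Longrightarrow> (norm C)\<^sup>2 \<le> c"
proof -
  let ?K = "cross ` couplings \<mu> \<nu>"
  have ne: "closure ?K \<noteq> {}"
    using couplings_pair_measure[OF M.prob_space_axioms N.prob_space_axioms] by auto
  have "bounded ?K" unfolding bounded_iff using norm_cross_le by blast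
  then have "compact (closure ?K)" by simp
  from continuous_attains_sup[OF this ne continuous_on_norm_id]
  obtain C where C: "C \<in> closure ?K" "\<forall>D\<in>closure ?K. norm D \<le> norm C" by blast
  show ?thesis
  proof (rule that)
    show "norm (cross \<pi>) \<le> norm C" if "\<pi> \<in> couplings \<mu> \<nu>" for \<pi>
      using C(2) that closure_subset[of ?K] by blast
    fix c assume "\<And>\<pi>. \<pi> \<in> couplings \<mu> \<nu> \<Longrightarrow> C \<bullet> cross \<pi> \<le> c"
    then have "C \<bullet> C \<le> c"
      by (intro continuous_le_on_closure[OF _ C(1), of "\<lambda>D. C \<bullet> D"] continuous_intros) auto
    then show "(norm C)\<^sup>2 \<le> c" by (simp add: power2_norm_eq_inner)
  qed
qed

lemma optimal_map_if_linear_optimal: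
  assumes C: "\<And>\<pi>. \<pi> \<in> couplings \<mu> \<nu> \<Longrightarrow> norm (cross \<pi>) \<le> norm C"
    "\<And>c. (\<And>\<pi>. \<pi> \<in> couplings \<mu> \<nu> \<Longrightarrow> C \<bullet> cross \<pi> \<le> c) \<Longrightarrow> (norm C)\<^sup>2 \<le> c"
    and T [measurable]: "T \<in> borel_measurable borel" and law: "distr \<mu> borel T = \<nu>"
    and opt: "\<And>\<pi>. \<pi> \<in> couplings \<mu> \<nu> \<Longrightarrow> (\<integral>p. snd p \<bullet> (C *v fst p) \<partial>\<pi>) \<le> (\<integral>x. T x \<bullet> (C *v x) \<partial>\<mu>)"
  shows "optimal_map \<mu> \<nu> T"
proof -
  have T' [measurable]: "T \<in> measurable \<mu> \<nu>" by measurable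
  have law': "distr \<mu> \<nu> T = \<nu>" using law sets_\<nu> by (simp cong: distr_cong)
  define \<pi> where "\<pi> = distr \<mu> (\<mu> \<Otimes>\<^sub>M \<nu>) (\<lambda>x. (x, T x))"
  have G [measurable]: "(\<lambda>x. (x, T x)) \<in> measurable \<mu> (\<mu> \<Otimes>\<^sub>M \<nu>)" by measurable
  have \<pi>: "\<pi> \<in> couplings \<mu> \<nu>"
    unfolding couplings_def \<pi>_def mem_Collect_eq
    by (simp add: M.prob_space_distr distr_distr comp_def law')
  have "(\<integral>p. snd p \<bullet> (C *v fst p) \<partial>\<pi>) = (\<integral>x. T x \<bullet> (C *v x) \<partial>\<mu>)"
    unfolding \<pi>_def by (subst integral_distr[OF G]) auto
  then have eq: "C \<bullet> cross \<pi> = (\<integral>x. T x \<bullet> (C *v x) \<partial>\<mu>)" by (simp add: integral_bilinear[OF \<pi>])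
  \<comment> \<open>Taken with \<open>c\<close> equal to the linear value of \<pi>, which by
    \<open>opt\<close> bounds that of every coupling.\<close>
  have "(norm C)\<^sup>2 \<le> C \<bullet> cross \<pi>"
    by (rule C(2)) (use opt eq integral_bilinear in auto)
  also have "\<dots> \<le> norm C * norm (cross \<pi>)" by (rule norm_cauchy_schwarz)
  finally have "norm C \<le> norm (cross \<pi>)"
    by (cases "norm C = 0") (auto simp: power2_eq_square)
  then have max: "norm (cross \<pi>') \<le> norm (cross \<pi>)" if "\<pi>' \<in> couplings \<mu> \<nu>" for \<pi>'
    using C(1)[OF that] by simp
  have "gw_minimizer \<mu> \<nu> \<pi>"
    unfolding gw_minimizer_def
  proof (intro conjI ballI \<pi>)
    fix \<pi>' assume \<pi>': "\<pi>' \<in> couplings \<mu> \<nu>"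
    show "gw_cost \<pi> \<le> gw_cost \<pi>'"
      unfolding gw_cost_eq[OF \<pi>] gw_cost_eq[OF \<pi>'] using max[OF \<pi>']
      by (intro ennreal_leI diff_left_mono mult_left_mono power_mono) auto
  qed
  then show ?thesis using T' law' by (simp add: optimal_map_def \<pi>_def)
qed

end

section \<open>The block gradient map\<close>

lemma linear_first_block: "linear (first_block h)"
  by (rule linearI) (auto simp: first_block_def vec_eq_iff)

lemma linear_last_block: "linear (last_block h)"
  by (rule linearI) (auto simp: last_block_def vec_eq_iff)

lemma linear_proj_first: "linear proj_first"
  by (rule linearI) (auto simp: proj_first_def vec_eq_iff)

lemma first_block_add_last_block: "first_block h x + last_block h x = x"
  by (simp add: first_block_def last_block_def vec_eq_iff)

lemma subspace_first_space: "subspace (first_space h)"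
  by (auto simp: subspace_def first_space_def)

lemma subspace_last_space: "subspace (last_space h)"
  by (auto simp: subspace_def last_space_def)

lemma first_block_in_first_space: "first_block h x \<in> first_space h"
  by (simp add: first_block_def first_space_def)

lemma last_block_in_last_space: "last_block h x \<in> last_space h"
  by (simp add: last_block_def last_space_def)

lemma inner_first_last_space: "x \<in> first_space h \<Longrightarrow> y \<in> last_space h \<Longrightarrow> x \<bullet> y = 0"
  unfolding inner_vec_def
proof (intro sum.neutral ballI)
  fix i assume "x \<in> first_space h" "y \<in> last_space h"
  then show "x $ i \<bullet> y $ i = 0"
    by (cases "coord_no i \<le> h") (auto simp: first_space_def last_space_def)
qed

lemma pos_diagonal_mult_component:
  assumes "pos_diagonal h S"
  shows "(S *v v) $ i = S $ i $ i * v $ i"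
proof -
  have "(S *v v) $ i = (\<Sum>j\<in>UNIV. S $ i $ j * v $ j)" by (simp add: matrix_vector_mult_def)
  also have "\<dots> = (\<Sum>j\<in>UNIV. if j = i then S $ i $ i * v $ i else 0)"
    by (rule sum.cong) (use assms in \<open>auto simp: pos_diagonal_def\<close>)
  finally show ?thesis by simp
qed

lemma pos_diagonal_in_first_space:
  assumes "pos_diagonal h S"
  shows "S *v v \<in> first_space h"
  using assms by (auto simp: first_space_def pos_diagonal_mult_component[OF assms] pos_diagonal_def dest: spec)

lemma linear_borel_measurable:
  fixes f :: "'a::euclidean_space \<Rightarrow> 'b::euclidean_space"
  assumes "linear f"
  shows "f \<in> borel_measurable borel"
  by (intro borel_measurable_continuous_onI linear_continuous_on linear_conv_bounded_linear[THEN iffD1] assms)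

lemma orthogonal_matrix_transpose_mult:
  assumes "orthogonal_matrix Q"
  shows "transpose Q *v (Q *v x) = x" "Q *v (transpose Q *v x) = x"
  using assms unfolding orthogonal_matrix_def matrix_vector_mul_assoc by simp_all

lemma orthogonal_matrix_inner:
  fixes Q :: "real ^ 'n ^ 'n"
  assumes "orthogonal_matrix Q"
  shows "(Q *v x) \<bullet> (Q *v y) = x \<bullet> y"
proof -
  have "(Q *v x) \<bullet> (Q *v y) = (transpose Q *v (Q *v x)) \<bullet> y"
    unfolding transpose_matrix_vector by (rule dot_lmul_matrix[symmetric])
  then show ?thesis unfolding orthogonal_matrix_transpose_mult(1)[OF assms] .
qed

text \<open>Here d <= n enters: every direction of the first d rotated coordinates is realised by a
  direction of x, as the differentiability argument requires.\<close>

lemma proj_first_orthogonal_surj: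
  fixes OX :: "real ^ 'n::{finite,linorder} ^ 'n::{finite,linorder}"
  assumes "CARD('d::{finite,linorder}) \<le> CARD('n)" "orthogonal_matrix OX"
  shows "\<exists>u. proj_first (OX *v u) = (v :: real ^ 'd::{finite,linorder})"
proof -
  define w :: "real ^ 'n::{finite,linorder}" where "w = (\<chi> j. v $ coord_at (coord_no j))"
  have "coord_no (coord_at (coord_no i) :: 'n) = coord_no i" for i :: 'd
    using bspec[OF bij_betwE[OF bij_betw_coord_no], of i] assms(1) by (intro coord_no_coord_at) auto
  then have "proj_first w = v" by (simp add: proj_first_def w_def vec_eq_iff)
  then show ?thesis using orthogonal_matrix_transpose_mult(2)[OF assms(2)] by metis
qed

text \<open>Two candidates differ by a vector of \<open>V\<close>; comparing the derivatives along
  the line in that direction, which stays in \<open>V\<close>, shows that its square norm is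
  zero.\<close>

lemma grad_on_eq:
  assumes V: "subspace V" "w \<in> V" and u: "u \<in> V" and d: "(f has_derivative (\<lambda>v. u \<bullet> v)) (at w within V)"
  shows "grad_on V f w = u"
  unfolding grad_on_def
proof (rule the_equality)
  show "u \<in> V \<and> (f has_derivative (\<lambda>v. u \<bullet> v)) (at w within V)" using u d by simp
  fix u' assume u': "u' \<in> V \<and> (f has_derivative (\<lambda>v. u' \<bullet> v)) (at w within V)"
  define e where "e = u' - u"
  have e: "e \<in> V" using u u' V(1) by (simp add: e_def subspace_diff)
  have sub: "(\<lambda>t::real. w + t *\<^sub>R e) ` UNIV \<subseteq> V" using V e by (auto simp: subspace_add subspace_scale)
  have line: "((\<lambda>t::real. w + t *\<^sub>R e) has_derivative (\<lambda>t. t *\<^sub>R e)) (at 0)"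
    by (auto intro!: derivative_eq_intros)
  have D: "((\<lambda>t. f (w + t *\<^sub>R e)) has_derivative (\<lambda>t. x \<bullet> (t *\<^sub>R e))) (at 0)"
    if "(f has_derivative (\<lambda>v. x \<bullet> v)) (at w within V)" for x
  proof (rule has_derivative_in_compose[OF line])
    show "(f has_derivative (\<lambda>v. x \<bullet> v)) (at (w + 0 *\<^sub>R e) within range (\<lambda>t. w + t *\<^sub>R e))"
      using has_derivative_subset[OF that sub] by simp
  qed
  have "(\<lambda>t::real. u' \<bullet> (t *\<^sub>R e)) = (\<lambda>t. u \<bullet> (t *\<^sub>R e))"
    using D[of u'] D[OF d] u' by (intro has_derivative_unique[of "\<lambda>t. f (w + t *\<^sub>R e)"]) auto
  from fun_cong[OF this, of 1] have "e \<bullet> e = 0" by (simp add: e_def inner_diff_left)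
  then show "u' = u" by (simp add: e_def)
qed

text \<open>The final inequality is the linear problem for \<open>C\<close> in rotated coordinates.
  It is proved by duality from the potentials of the first problem alone: they bound the value of
  every coupling, with equality for \<open>T\<close>. The second problem makes the joint law of both
  blocks correct.\<close>

lemma block_gradient_map:
  fixes \<mu> :: "(real ^ 'n::{finite,linorder}) measure" and \<nu> :: "(real ^ 'd::{finite,linorder}) measure"
    and S :: "real ^ 'd::{finite,linorder} ^ 'd::{finite,linorder}"
  assumes dn: "CARD('d) \<le> CARD('n)"
    and \<mu>: "prob_space \<mu>" and \<nu>: "prob_space \<nu>"
    and sets_\<mu> [measurable_cong]: "sets \<mu> = sets borel" and sets_\<nu> [measurable_cong]: "sets \<nu> = sets borel"
    and ac: "absolutely_continuous lborel \<mu>"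
    and bound: "AE x in \<mu>. norm x \<le> r" "AE y in \<nu>. norm y \<le> r"
    and OX: "orthogonal_matrix OX" and OY: "orthogonal_matrix OY" and S: "pos_diagonal h S"
  obtains T f g where "T \<in> borel_measurable borel" "distr \<mu> borel T = \<nu>"
    "convex_on (first_space h) f" "\<And>a. convex_on (last_space h) (g a)"
    "AE x in \<mu>. proj_first (OX *v x) \<in> T0_domain h S f g \<and>
       T x = transpose OY *v T0_map h S f g (proj_first (OX *v x))"
    "\<And>\<pi>. \<pi> \<in> couplings \<mu> \<nu> \<Longrightarrow>
       (\<integral>p. (OY *v snd p) \<bullet> (S *v first_block h (proj_first (OX *v fst p))) \<partial>\<pi>)
       \<le> (\<integral>x. (OY *v T x) \<bullet> (S *v first_block h (proj_first (OX *v x))) \<partial>\<mu>)"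
proof -
  interpret M: prob_space \<mu> by fact
  interpret N: prob_space \<nu> by fact
  interpret bm: bounded_marginals \<mu> \<nu> r
    by unfold_locales (fact sets_\<mu> sets_\<nu> bound)+
  define p where "p x = (proj_first (OX *v x) :: real ^ 'd::{finite,linorder})" for x
  define z1 where "z1 x = S *v first_block h (p x)" for x
  define z2 where "z2 x = last_block h (p x)" for x
  define y1 where "y1 y = first_block h (OY *v y)" for y
  define y2 where "y2 y = last_block h (OY *v y)" for y
  have lp: "linear p"
    unfolding p_def using linear_compose[OF matrix_vector_mul_linear linear_proj_first] by (simp add: comp_def)
  have lz1: "linear z1"
    unfolding z1_def using linear_compose[OF linear_compose[OF lp linear_first_block] matrix_vector_mul_linear]
    by (simp add: comp_def)
  have lz2: "linear z2"
    unfolding z2_def using linear_compose[OF lp linear_last_block] by (simp add: comp_def)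
  have ly1: "linear y1"
    unfolding y1_def using linear_compose[OF matrix_vector_mul_linear linear_first_block] by (simp add: comp_def)
  have ly2: "linear y2"
    unfolding y2_def using linear_compose[OF matrix_vector_mul_linear linear_last_block] by (simp add: comp_def)
  note [measurable] = linear_borel_measurable[OF lz1] linear_borel_measurable[OF lz2]
    linear_borel_measurable[OF ly1] linear_borel_measurable[OF ly2]
  have bl: "\<exists>K>0. \<forall>x. norm (q x) \<le> norm x * K" if "linear q" for q :: "'v::euclidean_space \<Rightarrow> 'w::euclidean_space"
    using that linear_conv_bounded_linear bounded_linear.pos_bounded by blast
  obtain K1 K2 K3 K4 where K: "K1 > 0" "K2 > 0" "K3 > 0" "K4 > 0"
    "\<And>x. norm (z1 x) \<le> norm x * K1" "\<And>x. norm (z2 x) \<le> norm x * K2"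
    "\<And>x. norm (y1 x) \<le> norm x * K3" "\<And>x. norm (y2 x) \<le> norm x * K4"
    using bl[OF lz1] bl[OF lz2] bl[OF ly1] bl[OF ly2] by metis
  \<comment> \<open>One radius that bounds all four linear images of the ball of radius
    \<open>r\<close>.\<close>
  define R where "R = r * (K1 + K2 + K3 + K4)"
  have r0: "0 \<le> r" by (rule bm.r_nonneg)
  have R0: "0 \<le> R" unfolding R_def using r0 K(1-4) by simp
  have nR: "norm v \<le> R" if "norm v \<le> norm x * K" "norm x \<le> r" "0 < K" "K \<le> K1 + K2 + K3 + K4"
    for v :: "'v::real_normed_vector" and x :: "'w::real_normed_vector" and K
  proof -
    have "norm x * K \<le> r * (K1 + K2 + K3 + K4)" using that r0 by (intro mult_mono) auto
    with that(1) show ?thesis by (simp add: R_def)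
  qed
  \<comment> \<open>Restricting to the block subspace has two effects: the gradients land in it, as
    \<open>grad_on\<close> demands, and the potentials are constant along the other block.\<close>
  define Y1 :: "(real ^ 'd::{finite,linorder}) set" where "Y1 = first_space h \<inter> cball 0 R"
  define Y2 :: "(real ^ 'd::{finite,linorder}) set" where "Y2 = last_space h \<inter> cball 0 R"
  have Y1: "compact Y1" "0 \<in> Y1" "Y1 \<subseteq> cball 0 R" "Y1 \<subseteq> first_space h"
    using R0 subspace_0[OF subspace_first_space]
    by (auto simp: Y1_def intro!: closed_Int_compact closed_subspace subspace_first_space)
  have Y2: "compact Y2" "0 \<in> Y2" "Y2 \<subseteq> cball 0 R" "Y2 \<subseteq> last_space h"
    using R0 subspace_0[OF subspace_last_space]
    by (auto simp: Y2_def intro!: closed_Int_compact closed_subspace subspace_last_space)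
  have z1_in: "AE x in \<mu>. z1 x \<in> cball 0 R"
    using bound(1) by eventually_elim (use nR[OF K(5)] K(1-4) in auto)
  have z2_in: "AE x in \<mu>. z2 x \<in> cball 0 R"
    using bound(1) by eventually_elim (use nR[OF K(6)] K(1-4) in auto)
  have y1_in: "AE y in \<nu>. y1 y \<in> Y1"
    using bound(2) by eventually_elim (use nR[OF K(7)] K(1-4) in \<open>auto simp: Y1_def y1_def first_block_in_first_space\<close>)
  have y2_in: "AE y in \<nu>. y2 y \<in> Y2"
    using bound(2) by eventually_elim (use nR[OF K(8)] K(1-4) in \<open>auto simp: Y2_def y2_def last_block_in_last_space\<close>)
  have z1_first: "z1 x \<in> first_space h" for x unfolding z1_def by (rule pos_diagonal_in_first_space[OF S])
  have z2_last: "z2 x \<in> last_space h" for x unfolding z2_def by (rule last_block_in_last_space)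
  have p_surj: "\<exists>u. p u = v" for v unfolding p_def by (rule proj_first_orthogonal_surj[OF dn OX])

  \<comment> \<open>A constant parameter reduces the problem to ordinary transport of the first
    block.\<close>
  interpret D1: dual_problem \<mu> \<nu> "\<lambda>_. 0::real" "\<lambda>_. 0" z1 y1 Y1 R
  proof (intro dual_problem.intro dual_problem_axioms.intro)
    show "distr \<mu> borel (\<lambda>_. 0::real) = distr \<nu> borel (\<lambda>_. 0)" by simp
    show "z1 \<in> borel_measurable \<mu>" "y1 \<in> borel_measurable \<nu>" by measurable
  qed (simp_all only: \<mu> \<nu> Y1 z1_in y1_in borel_measurable_const)
  have diff1: "AE x in \<mu>. \<phi> 0 differentiable (at (z1 x))"
    if \<phi>: "case_prod \<phi> \<in> borel_measurable (borel \<Otimes>\<^sub>M borel)" "\<And>p. convex_on UNIV (\<phi> p)"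
      and inv: "\<And>p w v. (\<And>y. y \<in> Y1 \<Longrightarrow> y \<bullet> v = 0) \<Longrightarrow> \<phi> p (w + v) = \<phi> p w"
    for \<phi> :: "real \<Rightarrow> real ^ 'd::{finite,linorder} \<Rightarrow> real"
  proof (rule AE_differentiable_convex[OF sets_\<mu> ac _ _ \<phi>, where b="\<lambda>_. 0"])
    fix e :: "real ^ 'd::{finite,linorder}" assume "e \<in> Basis"
    then obtain i where e: "e = axis i 1" by (auto simp: Basis_vec_def)
    show "(\<forall>p w t. \<phi> p (w + t *\<^sub>R e) = \<phi> p w) \<or>
      (\<exists>u. \<forall>x t. (0::real) = 0 \<and> z1 (x + t *\<^sub>R u) = z1 x + t *\<^sub>R e)"
    proof (cases "coord_no i \<le> h")
      case True
      then have Si: "S $ i $ i > 0" using S by (simp add: pos_diagonal_def)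
      \<comment> \<open>The factor undoes the scaling by \<open>S\<close>, so that \<open>u\<close>
        moves \<open>z1\<close> exactly along \<open>e\<close>.\<close>
      obtain u where u: "p u = (1 / S $ i $ i) *\<^sub>R e" using p_surj by blast
      have "z1 u = e"
        unfolding z1_def u using True Si
        by (auto simp: vec_eq_iff pos_diagonal_mult_component[OF S] first_block_def e axis_def)
      then show ?thesis by (intro disjI2 exI[of _ u]) (simp add: linear_add[OF lz1] linear_scale[OF lz1])
    next
      case False
      then have "t *\<^sub>R e \<in> last_space h" for t by (auto simp: last_space_def e axis_def)
      then have "\<phi> q (w + t *\<^sub>R e) = \<phi> q w" for q w t
        using Y1(4) by (intro inv inner_first_last_space) auto
      then show ?thesis by blast
    qed
  qed measurable
  obtain \<phi>1 \<psi>1 :: "real \<Rightarrow> real ^ 'd::{finite,linorder} \<Rightarrow> real" where 1: "case_prod \<phi>1 \<in> borel_measurable (borel \<Otimes>\<^sub>M borel)" "\<And>q. convex_on UNIV (\<phi>1 q)"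
    "AE x in \<mu>. \<phi>1 0 differentiable (at (z1 x))"
    "integrable \<mu> (\<lambda>x. \<phi>1 0 (z1 x))" "case_prod \<psi>1 \<in> borel_measurable (borel \<Otimes>\<^sub>M borel)"
    "integrable \<nu> (\<lambda>y. \<psi>1 0 (y1 y))"
    "\<And>q w y. y \<in> Y1 \<Longrightarrow> y \<bullet> w \<le> \<phi>1 q w + \<psi>1 q y"
    "AE x in \<mu>. quot_grad (\<phi>1 0) (z1 x) \<in> Y1"
    "AE x in \<mu>. quot_grad (\<phi>1 0) (z1 x) \<bullet> z1 x = \<phi>1 0 (z1 x) + \<psi>1 0 (quot_grad (\<phi>1 0) (z1 x))"
    "distr \<mu> borel (\<lambda>x. (0::real, quot_grad (\<phi>1 0) (z1 x))) = distr \<nu> borel (\<lambda>y. (0, y1 y))"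
  proof (rule D1.optimal_potentials, goal_cases)
    case (1 \<phi>)
    from 1(2-4) show ?case by (rule diff1[of \<phi>])
  next
    case (2 \<phi> \<psi>)
    show ?case by (rule 2(1)[of \<phi> \<psi>]) (fact 2)+
  qed
  define G where "G w = quot_grad (\<phi>1 0) w" for w
  have Gm [measurable]: "G \<in> borel_measurable borel"
    using measurable_compose[OF measurable_Pair1' quot_grad_measurable[OF 1(1)], of 0] by (simp add: G_def[abs_def])
  have law1: "distr \<mu> borel (\<lambda>x. G (z1 x)) = distr \<nu> borel y1"
  proof -
    have [measurable]: "(snd :: real \<times> (real ^ 'd::{finite,linorder}) \<Rightarrow> _) \<in> borel_measurable borel"
      by (intro borel_measurable_continuous_onI continuous_intros)
    have "distr (distr \<mu> borel (\<lambda>x. (0::real, G (z1 x)))) borel snd = distr (distr \<nu> borel (\<lambda>y. (0::real, y1 y))) borel snd"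
      using 1(10) by (simp add: G_def)
    then show ?thesis by (simp add: distr_distr comp_def)
  qed

  interpret D2: dual_problem \<mu> \<nu> "\<lambda>x. G (z1 x)" y1 z2 y2 Y2 R
  proof (intro dual_problem.intro dual_problem_axioms.intro)
    show "(\<lambda>x. G (z1 x)) \<in> borel_measurable \<mu>" "y1 \<in> borel_measurable \<nu>"
      "z2 \<in> borel_measurable \<mu>" "y2 \<in> borel_measurable \<nu>" by measurable
  qed (simp_all only: \<mu> \<nu> Y2 z2_in y2_in law1)
  have diff2: "AE x in \<mu>. \<phi> (G (z1 x)) differentiable (at (z2 x))"
    if \<phi>: "case_prod \<phi> \<in> borel_measurable (borel \<Otimes>\<^sub>M borel)" "\<And>p. convex_on UNIV (\<phi> p)"
      and inv: "\<And>p w v. (\<And>y. y \<in> Y2 \<Longrightarrow> y \<bullet> v = 0) \<Longrightarrow> \<phi> p (w + v) = \<phi> p w"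
    for \<phi> :: "real ^ 'd::{finite,linorder} \<Rightarrow> real ^ 'd::{finite,linorder} \<Rightarrow> real"
  proof (rule AE_differentiable_convex[OF sets_\<mu> ac _ _ \<phi>, where b="\<lambda>x. G (z1 x)"])
    fix e :: "real ^ 'd::{finite,linorder}" assume "e \<in> Basis"
    then obtain i where e: "e = axis i 1" by (auto simp: Basis_vec_def)
    show "(\<forall>p w t. \<phi> p (w + t *\<^sub>R e) = \<phi> p w) \<or>
      (\<exists>u. \<forall>x t. G (z1 (x + t *\<^sub>R u)) = G (z1 x) \<and> z2 (x + t *\<^sub>R u) = z2 x + t *\<^sub>R e)"
    proof (cases "coord_no i \<le> h")
      case True
      then have "t *\<^sub>R e \<in> first_space h" for t by (auto simp: first_space_def e axis_def)
      from inner_first_last_space[OF this] Y2(4) have "y \<bullet> t *\<^sub>R e = 0" if "y \<in> Y2" for y t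
        using that by (subst inner_commute) blast
      then have "\<phi> q (w + t *\<^sub>R e) = \<phi> q w" for q w t by (rule inv)
      then show ?thesis by blast
    next
      case False
      \<comment> \<open>A direction in the last block leaves \<open>z1\<close> unchanged, and with
        it the parameter \<open>G (z1 x)\<close>, however irregular \<open>G\<close> may be.\<close>
      obtain u where u: "p u = e" using p_surj by blast
      have "first_block h e = 0" "last_block h e = e"
        using False by (auto simp: vec_eq_iff first_block_def last_block_def e axis_def)
      then have "z1 u = 0" "z2 u = e" by (simp_all add: z1_def z2_def u)
      then show ?thesis
        by (intro disjI2 exI[of _ u]) (simp add: linear_add[OF lz1] linear_scale[OF lz1] linear_add[OF lz2] linear_scale[OF lz2])
    qed
  qed measurable
  obtain \<phi>2 \<psi>2 where 2: "case_prod \<phi>2 \<in> borel_measurable (borel \<Otimes>\<^sub>M borel)" "\<And>q. convex_on UNIV (\<phi>2 q)"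
    "AE x in \<mu>. \<phi>2 (G (z1 x)) differentiable (at (z2 x))"
    "integrable \<mu> (\<lambda>x. \<phi>2 (G (z1 x)) (z2 x))" "case_prod \<psi>2 \<in> borel_measurable (borel \<Otimes>\<^sub>M borel)"
    "integrable \<nu> (\<lambda>y. \<psi>2 (y1 y) (y2 y))"
    "\<And>q w y. y \<in> Y2 \<Longrightarrow> y \<bullet> w \<le> \<phi>2 q w + \<psi>2 q y"
    "AE x in \<mu>. quot_grad (\<phi>2 (G (z1 x))) (z2 x) \<in> Y2"
    "AE x in \<mu>. quot_grad (\<phi>2 (G (z1 x))) (z2 x) \<bullet> z2 x = \<phi>2 (G (z1 x)) (z2 x) + \<psi>2 (G (z1 x)) (quot_grad (\<phi>2 (G (z1 x))) (z2 x))"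
    "distr \<mu> borel (\<lambda>x. (G (z1 x), quot_grad (\<phi>2 (G (z1 x))) (z2 x))) = distr \<nu> borel (\<lambda>y. (y1 y, y2 y))"
  proof (rule D2.optimal_potentials, goal_cases)
    case (1 \<phi>)
    from 1(2-4) show ?case by (rule diff2[of \<phi>])
  next
    case (2 \<phi> \<psi>)
    show ?case by (rule 2(1)[of \<phi> \<psi>]) (fact 2)+
  qed
  define H where "H x = quot_grad (\<phi>2 (G (z1 x))) (z2 x)" for x
  have Hm [measurable]: "H \<in> borel_measurable borel"
  proof -
    have "(\<lambda>x. (G (z1 x), z2 x)) \<in> borel \<rightarrow>\<^sub>M borel \<Otimes>\<^sub>M borel" by measurable
    from measurable_compose[OF this quot_grad_measurable[OF 2(1)]] show ?thesis by (simp add: H_def[abs_def])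
  qed
  define T where "T x = transpose OY *v (G (z1 x) + H x)" for x
  have Tm [measurable]: "T \<in> borel_measurable borel" unfolding T_def by measurable
  \<comment> \<open>Adding the blocks and undoing the rotation recovers y from (y1, y2); the same
    map applied to the matching joint law of (G, H) yields \<nu>.\<close>
  have lawT: "distr \<mu> borel T = \<nu>"
  proof -
    let ?s = "\<lambda>q. transpose OY *v (fst q + snd q)"
    have s: "?s \<in> borel_measurable borel"
      by (intro linear_borel_measurable linearI) (simp_all add: matrix_vector_right_distrib algebra_simps)
    have GH: "(\<lambda>x. (G (z1 x), H x)) \<in> borel_measurable \<mu>" and Y12: "(\<lambda>y. (y1 y, y2 y)) \<in> borel_measurable \<nu>"
      by measurable
    have "distr \<mu> borel T = distr (distr \<mu> borel (\<lambda>x. (G (z1 x), H x))) borel ?s"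
      unfolding distr_distr[OF s GH] by (simp add: comp_def T_def[abs_def])
    also have "\<dots> = distr (distr \<nu> borel (\<lambda>y. (y1 y, y2 y))) borel ?s" using 2(10) by (simp add: H_def)
    also have "\<dots> = distr \<nu> borel (?s \<circ> (\<lambda>y. (y1 y, y2 y)))" by (rule distr_distr[OF s Y12])
    also have "?s \<circ> (\<lambda>y. (y1 y, y2 y)) = (\<lambda>y. y)"
      unfolding comp_def fst_conv snd_conv y1_def y2_def first_block_add_last_block
        orthogonal_matrix_transpose_mult[OF OY] ..
    also have "distr \<nu> borel (\<lambda>y. y) = \<nu>" by (rule distr_id2) (simp add: sets_\<nu>)
    finally show ?thesis .
  qed
  define f where "f = \<phi>1 0"
  \<comment> \<open>The family is indexed by the first block of x itself, while \<phi>2 takes the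
    value of the first gradient; the composition with \<open>G\<close> and \<open>S\<close>
    translates.\<close>
  define g where "g a = \<phi>2 (G (S *v a))" for a
  have gz: "g (first_block h (p x)) = \<phi>2 (G (z1 x))" for x by (simp add: g_def z1_def)
  have T_grad: "AE x in \<mu>. p x \<in> T0_domain h S f g \<and> T x = transpose OY *v T0_map h S f g (p x)"
    using 1(3) 1(8) 2(3) 2(8)
  proof eventually_elim
    case (elim x)
    have "grad_on (first_space h) f (z1 x) = G (z1 x)"
      unfolding G_def f_def
      by (rule grad_on_eq[OF subspace_first_space z1_first subsetD[OF Y1(4) elim(2)]
            has_derivative_at_withinI[OF differentiable_quot_grad[OF elim(1)]]])
    moreover have "grad_on (last_space h) (\<phi>2 (G (z1 x))) (z2 x) = H x"
      unfolding H_def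
      by (rule grad_on_eq[OF subspace_last_space z2_last subsetD[OF Y2(4) elim(4)]
            has_derivative_at_withinI[OF differentiable_quot_grad[OF elim(3)]]])
    ultimately have "T0_map h S f g (p x) = G (z1 x) + H x"
      by (simp add: T0_map_def gz flip: z1_def z2_def)
    moreover have "p x \<in> T0_domain h S f g"
      using elim(1,3) by (simp add: T0_domain_def gz f_def differentiable_at_withinI flip: z1_def z2_def)
    ultimately show ?case by (simp add: T_def)
  qed
  have opt: "(\<integral>q. (OY *v snd q) \<bullet> z1 (fst q) \<partial>\<pi>) \<le> (\<integral>x. (OY *v T x) \<bullet> z1 x \<partial>\<mu>)" if \<pi>: "\<pi> \<in> couplings \<mu> \<nu>" for \<pi>
  proof -
    note c = bm.couplingsD[OF \<pi>]
    interpret \<pi>: prob_space \<pi> by (rule c)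
    note [measurable_cong] = c(2)
    have fs [measurable]: "fst \<in> measurable \<pi> \<mu>" "snd \<in> measurable \<pi> \<nu>" by measurable
    have \<phi>m [measurable]: "\<phi>1 0 \<in> borel_measurable borel" "\<psi>1 0 \<in> borel_measurable borel"
      using measurable_compose[OF measurable_Pair1' 1(1), of 0] measurable_compose[OF measurable_Pair1' 1(5), of 0] by simp_all
    have i1: "integrable \<pi> (\<lambda>q. \<phi>1 0 (z1 (fst q)))" "(\<integral>q. \<phi>1 0 (z1 (fst q)) \<partial>\<pi>) = (\<integral>x. \<phi>1 0 (z1 x) \<partial>\<mu>)"
      using 1(4) integrable_distr[OF fs(1), of "\<lambda>x. \<phi>1 0 (z1 x)"] integral_distr[OF fs(1), of "\<lambda>x. \<phi>1 0 (z1 x)"]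
      by (auto simp: c(3))
    have i2: "integrable \<pi> (\<lambda>q. \<psi>1 0 (y1 (snd q)))" "(\<integral>q. \<psi>1 0 (y1 (snd q)) \<partial>\<pi>) = (\<integral>y. \<psi>1 0 (y1 y) \<partial>\<nu>)"
      using 1(6) integrable_distr[OF fs(2), of "\<lambda>y. \<psi>1 0 (y1 y)"] integral_distr[OF fs(2), of "\<lambda>y. \<psi>1 0 (y1 y)"]
      by (auto simp: c(4))
    \<comment> \<open>\<open>z1\<close> is orthogonal to the second block, so only \<open>y1\<close>
      contributes to the linear cost.\<close>
    have OYz: "(OY *v y) \<bullet> z1 x = y1 y \<bullet> z1 x" for y x
    proof -
      have "y2 y \<bullet> z1 x = 0"
        by (subst inner_commute) (simp add: y2_def inner_first_last_space[OF z1_first last_block_in_last_space])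
      moreover have "OY *v y = y1 y + y2 y" by (simp add: y1_def y2_def first_block_add_last_block)
      ultimately show ?thesis by (simp add: inner_add_left)
    qed
    have "AE y in distr \<pi> \<nu> snd. y1 y \<in> Y1" unfolding c(4) by (rule y1_in)
    then have AEy: "AE q in \<pi>. y1 (snd q) \<in> Y1"
      by (rule AE_distrD[OF fs(2)])
    \<comment> \<open>The integrand is a bilinear form in (x, y), whose integrability is already
      known for an arbitrary matrix.\<close>
    have "integrable \<pi> (\<lambda>q. snd q \<bullet> ((transpose OY ** matrix z1) *v fst q))" by (rule bm.integral_bilinear[OF \<pi>])
    also have "(\<lambda>q. snd q \<bullet> ((transpose OY ** matrix z1) *v fst q)) = (\<lambda>q. (OY *v snd q) \<bullet> z1 (fst q))"
    proof
      fix q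
      have "snd q \<bullet> ((transpose OY ** matrix z1) *v fst q) = snd q \<bullet> (transpose OY *v z1 (fst q))"
        by (simp add: fun_cong[OF matrix_vector_mul(2)[OF lz1]] flip: matrix_vector_mul_assoc)
      also have "\<dots> = (OY *v snd q) \<bullet> (OY *v (transpose OY *v z1 (fst q)))"
        by (rule orthogonal_matrix_inner[OF OY, symmetric])
      finally show "snd q \<bullet> ((transpose OY ** matrix z1) *v fst q) = (OY *v snd q) \<bullet> z1 (fst q)"
        unfolding orthogonal_matrix_transpose_mult[OF OY] .
    qed
    finally have int: "integrable \<pi> (\<lambda>q. (OY *v snd q) \<bullet> z1 (fst q))" .
    have "(\<integral>q. (OY *v snd q) \<bullet> z1 (fst q) \<partial>\<pi>) \<le> (\<integral>q. \<phi>1 0 (z1 (fst q)) + \<psi>1 0 (y1 (snd q)) \<partial>\<pi>)"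
      using AEy by (intro integral_mono_AE int Bochner_Integration.integrable_add i1 i2)
        (auto simp: OYz intro: 1(7) elim: eventually_mono)
    also have "\<dots> = (\<integral>x. \<phi>1 0 (z1 x) \<partial>\<mu>) + (\<integral>y. \<psi>1 0 (y1 y) \<partial>\<nu>)" using i1 i2 by simp
    \<comment> \<open>Since \<open>G (z1 x)\<close> and \<open>y1\<close> have the same law, the
      bound can be written as a single integral over \<mu>, where complementary slackness identifies
      it with the value of \<open>T\<close>.\<close>
    also have "(\<integral>y. \<psi>1 0 (y1 y) \<partial>\<nu>) = (\<integral>w. \<psi>1 0 w \<partial>distr \<nu> borel y1)" by (simp add: integral_distr)
    also have "\<dots> = (\<integral>x. \<psi>1 0 (G (z1 x)) \<partial>\<mu>)" unfolding law1[symmetric] by (simp add: integral_distr)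
    also have "(\<integral>x. \<phi>1 0 (z1 x) \<partial>\<mu>) + (\<integral>x. \<psi>1 0 (G (z1 x)) \<partial>\<mu>) = (\<integral>x. \<phi>1 0 (z1 x) + \<psi>1 0 (G (z1 x)) \<partial>\<mu>)"
    proof (rule Bochner_Integration.integral_add[symmetric, OF 1(4)])
      have "integrable (distr \<nu> borel y1) (\<psi>1 0)" using 1(6) by (simp add: integrable_distr_eq)
      then show "integrable \<mu> (\<lambda>x. \<psi>1 0 (G (z1 x)))" unfolding law1[symmetric] by (simp add: integrable_distr_eq)
    qed
    also have "\<dots> = (\<integral>x. (OY *v T x) \<bullet> z1 x \<partial>\<mu>)"
    proof (rule integral_cong_AE)
      show "AE x in \<mu>. \<phi>1 0 (z1 x) + \<psi>1 0 (G (z1 x)) = (OY *v T x) \<bullet> z1 x"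
        using 1(9) 2(8)
      proof eventually_elim
        case (elim x)
        have "H x \<bullet> z1 x = 0"
          using Y2(4) elim(2) by (subst inner_commute) (auto simp: H_def intro: inner_first_last_space[OF z1_first])
        then show ?case
          using elim(1) unfolding T_def orthogonal_matrix_transpose_mult[OF OY] by (simp add: inner_add_left G_def)
      qed
    qed measurable
    finally show ?thesis .
  qed
  show ?thesis
  proof (rule that[OF Tm lawT])
    show "convex_on (first_space h) f"
      unfolding f_def by (rule convex_on_subset[OF 1(2)]) (auto intro: subspace_imp_convex subspace_first_space)
    show "convex_on (last_space h) (g a)" for a
      unfolding g_def by (rule convex_on_subset[OF 2(2)]) (auto intro: subspace_imp_convex subspace_last_space)
    show "AE x in \<mu>. proj_first (OX *v x) \<in> T0_domain h S f g \<and>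
       T x = transpose OY *v T0_map h S f g (proj_first (OX *v x))"
      using T_grad by (simp add: p_def)
    show "(\<integral>p. (OY *v snd p) \<bullet> (S *v first_block h (proj_first (OX *v fst p))) \<partial>\<pi>)
       \<le> (\<integral>x. (OY *v T x) \<bullet> (S *v first_block h (proj_first (OX *v x))) \<partial>\<mu>)"
      if "\<pi> \<in> couplings \<mu> \<nu>" for \<pi>
      using opt[OF that] by (simp add: z1_def p_def)
  qed
qed

theorem theorem3p2:
  fixes \<mu> :: "(real ^ 'n::{finite,linorder}) measure"
    and \<nu> :: "(real ^ 'd::{finite,linorder}) measure"
  assumes "CARD('d) \<le> CARD('n)"
    and "prob_space \<mu>" and "sets \<mu> = sets borel" and "compact (msupport \<mu>)"
    and "prob_space \<nu>" and "sets \<nu> = sets borel" and "compact (msupport \<nu>)"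
    and "absolutely_continuous lborel \<mu>"
  shows "\<exists>T OX OY (h :: nat) S f g.
      optimal_map \<mu> \<nu> T \<and>
      orthogonal_matrix OX \<and> orthogonal_matrix OY \<and>
      h \<le> CARD('d) \<and> pos_diagonal h S \<and>
      convex_on (first_space h) f \<and>
      (\<forall>a\<in>first_space h. convex_on (last_space h) (g a)) \<and>
      (AE x in \<mu>. proj_first (OX *v x) \<in> T0_domain h S f g \<and>
         T x = ((\<lambda>y. transpose OY *v y) \<circ> T0_map h S f g \<circ> proj_first \<circ> (\<lambda>x. OX *v x)) x)"
proof -
  obtain r1 r2 where r: "\<And>x. x \<in> msupport \<mu> \<Longrightarrow> norm x \<le> r1" "\<And>y. y \<in> msupport \<nu> \<Longrightarrow> norm y \<le> r2"
    using compact_imp_bounded[OF assms(4)] compact_imp_bounded[OF assms(7)] unfolding bounded_iff by blast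
  define r where "r = max r1 r2"
  have bound: "AE x in \<mu>. norm x \<le> r" "AE y in \<nu>. norm y \<le> r"
    using AE_msupport[OF assms(3)] AE_msupport[OF assms(6)]
    by (auto elim!: eventually_mono dest!: r simp: r_def)
  interpret M: prob_space \<mu> by fact
  interpret N: prob_space \<nu> by fact
  interpret bounded_marginals \<mu> \<nu> r
    by unfold_locales (fact assms bound)+
  obtain C where C: "\<And>\<pi>. \<pi> \<in> couplings \<mu> \<nu> \<Longrightarrow> norm (cross \<pi>) \<le> norm C"
    "\<And>c. (\<And>\<pi>. \<pi> \<in> couplings \<mu> \<nu> \<Longrightarrow> C \<bullet> cross \<pi> \<le> c) \<Longrightarrow> (norm C)\<^sup>2 \<le> c"
    by (rule maximal_cross_limit) blast
  obtain OX OY h and S :: "real ^ 'd::{finite,linorder} ^ 'd::{finite,linorder}" where svd: "orthogonal_matrix OX" "orthogonal_matrix OY" "h \<le> CARD('d)" "pos_diagonal h S"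
    "\<And>x. OY *v (C *v x) = S *v first_block h (proj_first (OX *v x))"
    by (rule singular_value_decomposition[OF assms(1)]) blast
  obtain T f g where T: "T \<in> borel_measurable borel" "distr \<mu> borel T = \<nu>"
    "convex_on (first_space h) f" "\<And>a. convex_on (last_space h) (g a)"
    "AE x in \<mu>. proj_first (OX *v x) \<in> T0_domain h S f g \<and>
       T x = transpose OY *v T0_map h S f g (proj_first (OX *v x))"
    "\<And>\<pi>. \<pi> \<in> couplings \<mu> \<nu> \<Longrightarrow>
       (\<integral>p. (OY *v snd p) \<bullet> (S *v first_block h (proj_first (OX *v fst p))) \<partial>\<pi>)
       \<le> (\<integral>x. (OY *v T x) \<bullet> (S *v first_block h (proj_first (OX *v x))) \<partial>\<mu>)"
    by (rule block_gradient_map[OF assms(1,2,5,3,6,8) bound svd(1,2,4)]) blast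
  have "optimal_map \<mu> \<nu> T"
  proof (rule optimal_map_if_linear_optimal[OF C T(1,2)])
    show "(\<integral>p. snd p \<bullet> (C *v fst p) \<partial>\<pi>) \<le> (\<integral>x. T x \<bullet> (C *v x) \<partial>\<mu>)" if "\<pi> \<in> couplings \<mu> \<nu>" for \<pi>
      \<comment> \<open>Rotating both arguments by \<open>OY\<close> preserves the inner product,
        and the decomposition turns the rotated \<open>C *v x\<close> into the block form.\<close>
      using T(6)[OF that] by (simp add: orthogonal_matrix_inner[OF svd(2)] flip: svd(5))
  qed
  moreover have "AE x in \<mu>. proj_first (OX *v x) \<in> T0_domain h S f g \<and>
       T x = ((\<lambda>y. transpose OY *v y) \<circ> T0_map h S f g \<circ> proj_first \<circ> (\<lambda>x. OX *v x)) x"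
    using T(5) by simp
  ultimately show ?thesis using svd(1-4) T(3,4) by blast
qed

end
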